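(* Let $(\mathcal{S},\mathcal{A},\mathcal{P},r)$ be a weakly communicating average reward MDP with $r(s,a)\in[0,1]$ for all $(s,a)\in\mathcal{S}\times\mathcal{A}$. Let $Q^*$ be any solution of Bellman's equation $Q^*=\mathcal{T}(Q^* )-g^*$, let $h^*=\max_{\mathcal{A}}(Q^* )$, and assume $\|h^*\|_{\mathrm{sp}}\ge1$. Let $0<\varepsilon\le1$ and $\delta=\varepsilon^2/17$, and let $(Q^N,T^N,\pi^N)$ be the output of $\mathrm{SAVIA}\textbf{+}(Q^0,\varepsilon/17,\delta)$ with $Q^0=0$, run with $c_k=5(k+2)\ln^2(k+2)$ and $\beta_k=k/(k+2)$. Then, for all $s\in\mathcal{S}$, $$\mathbb{E}[g^*-g_{\pi^N}(s)]\le\varepsilon,$$ with expected sample complexity $\widetilde{O}\big(|\mathcal{S}||\mathcal{A}|\,\|h^*\|_{\mathrm{sp}}^2/\varepsilon^2\big)$.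
   Context: An average reward MDP $(\mathcal{S},\mathcal{A},\mathcal{P},r)$ has finite nonempty state space $\mathcal{S}$, finite nonempty action space $\mathcal{A}$, transition kernel $\mathcal{P}$ (each $\mathcal{P}(\cdot|s,a)$ is a probability distribution on $\mathcal{S}$) and reward $r:\mathcal{S}\times\mathcal{A}\to\mathbb{R}$. A policy is a map $\pi:\mathcal{S}\to\mathcal{A}$, with gain $g_\pi(s)=\lim_{n\to\infty}\mathbb{E}_\pi\big[\frac1n\sum_{t=0}^{n-1}r(s_t,a_t)|s_0=s\big]$, where $a_t=\pi(s_t)$, $s_{t+1}\sim\mathcal{P}(\cdot|s_t,a_t)$. The optimal gain is $g^*(s)=\max_\pi g_\pi(s)$. The MDP is weakly communicating if there is a set of states such that each state of the set is accessible from every other state of the set under some policy, and all remaining states (possibly none) are transient under every policy; then $g^*(s)\equiv g^*\in\mathbb{R}$ is constant. Notation: $\|x\|_{\mathrm{sp}}=\max_jx(j)-\min_jx(j)$. $\max_{\mathcal{A}}(Q)(s)=\max_{a}Q(s,a)$. $\mathcal{T}(Q)(s,a)=r(s,a)+\sum_{s'}\mathcal{P}(s'|s,a)\max_{\mathcal{A}}(Q)(s')$. The Bellman equation $Q=\mathcal{T}(Q)-g^*$ always has solutions. Subroutine $\mathrm{SAMPLE}(d,m)$, $d\in\mathbb{R}^{\mathcal{S}}$, $m\ge1$ integer: for each $(s,a)$ draw $m$ fresh i.i.d. samples $s_1,\dots,s_m\sim\mathcal{P}(\cdot|s,a)$ (independent of the past) and return the matrix $D(s,a)=\frac1m\sum_{j=1}^m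 d(s_j)$. It uses $|\mathcal{S}||\mathcal{A}|m$ samples. Algorithm $\mathrm{SAVIA}(Q^0,n,\varepsilon,\delta)$ (with sequences $c_k,\beta_k$): set $\alpha=\ln(2|\mathcal{S}||\mathcal{A}|(n+1)/\delta)$, $T^{-1}=r$, $h^{-1}=0$, $\beta_0=0$. For $k=0,\dots,n$: $Q^k=(1-\beta_k)Q^0+\beta_kT^{k-1}$; $h^k=\max_{\mathcal{A}}(Q^k)$; $d^k=h^k-h^{k-1}$; $m_k=\max\{\lceil\alpha c_k\|d^k\|_{\mathrm{sp}}^2/\varepsilon^2\rceil,1\}$; $D^k=\mathrm{SAMPLE}(d^k,m_k)$; $T^k=T^{k-1}+D^k$. Finally choose $\pi^n(s)\in\operatorname{argmax}_aQ^n(s,a)$ and output $(Q^n,T^n,\pi^n)$. Algorithm $\mathrm{SAVIA}\textbf{+}(Q^0,\varepsilon,\delta)$: for $i=0,1,2,\dots$ set $n_i=2^i$, $\delta_i=\delta/c_i$, and run $\mathrm{SAVIA}(Q^0,n_i,\varepsilon,\delta_i)$ afresh (with samples independent of earlier loops) to get $(Q^{n_i},T^{n_i},\pi^{n_i})$; stop at the first $i$ with $\|Q^{n_i}-T^{n_i}\|_{\mathrm{sp}}\le14\varepsilon$ and output $(Q^{n_i},T^{n_i},\pi^{n_i})$, denoted $(Q^N,T^N,\pi^N)$ with $N=n_i$ for this $i$ (the algorithm stops almost surely). In the claim the algorithm is called with $\varepsilon/17$ in place of $\varepsilon$. Sample complexity is the total number of samples drawn over all loops until stopping; expectations are over the randomness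 of the sampling. The notation $\widetilde{O}(\cdot)$ hides logarithmic factors: here $X=\widetilde{O}(Y)$ means that there are absolute constants $C,p>0$ with $X\le C\,Y\,\big[\ln\big(e\,|\mathcal{S}||\mathcal{A}|\,\|h^*\|_{\mathrm{sp}}/(\varepsilon\delta)\big)\big]^p$. *)

theory Defs
  imports "HOL-Probability.Probability"
begin

text \<open>
  State and action spaces are finite carrier sets rather than finite types, so that their sizes
  can be quantified over inside a formula: an ``absolute constant'' has to be chosen before the
  MDP. (A statement with one constant for all MDPs over the types \<open>'s\<close> and \<open>'a\<close> gives,
  for \<open>'s = 'a = nat\<close>, one constant for all finite MDPs up to renaming of states and actions.)
  Values of the kernel and of the reward outside the carriers are irrelevant.
\<close>

record ('s, 'a) mdp =
  states :: "'s set"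
  actions :: "'a set"
  kernel :: "'s \<Rightarrow> 'a \<Rightarrow> 's pmf"
  reward :: "'s \<times> 'a \<Rightarrow> real"

definition finite_mdp :: "('s, 'a) mdp \<Rightarrow> bool" where
  "finite_mdp M \<longleftrightarrow>
     finite (states M) \<and> states M \<noteq> {} \<and> finite (actions M) \<and> actions M \<noteq> {} \<and>
     (\<forall>s\<in>states M. \<forall>a\<in>actions M. set_pmf (kernel M s a) \<subseteq> states M)"

abbreviation state_actions :: "('s, 'a) mdp \<Rightarrow> ('s \<times> 'a) set" where
  "state_actions M \<equiv> states M \<times> actions M"

definition policies :: "('s, 'a) mdp \<Rightarrow> ('s \<Rightarrow> 'a) set" where
  "policies M = states M \<rightarrow>\<^sub>E actions M"

text \<open>Joint law of the first \<open>n\<close> states \<open>[s\<^sub>0, \<dots>, s\<^bsub>n-1\<^esub>]\<close> under a policy, started in \<open>s\<^sub>0 = s\<close>.\<close>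

primrec trajectory :: "('s, 'a) mdp \<Rightarrow> ('s \<Rightarrow> 'a) \<Rightarrow> nat \<Rightarrow> 's \<Rightarrow> 's list pmf" where
  "trajectory M \<pi> 0 s = return_pmf []"
| "trajectory M \<pi> (Suc n) s =
     do {s' \<leftarrow> kernel M s (\<pi> s); \<omega> \<leftarrow> trajectory M \<pi> n s'; return_pmf (s # \<omega>)}"

definition gain :: "('s, 'a) mdp \<Rightarrow> ('s \<Rightarrow> 'a) \<Rightarrow> 's \<Rightarrow> real" where
  "gain M \<pi> s =
     lim (\<lambda>n. measure_pmf.expectation (trajectory M \<pi> n s)
                (\<lambda>\<omega>. 1 / real n * (\<Sum>t<n. reward M (\<omega> ! t, \<pi> (\<omega> ! t)))))"

definition opt_gain :: "('s, 'a) mdp \<Rightarrow> 's \<Rightarrow> real" where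
  "opt_gain M s = Max ((\<lambda>\<pi>. gain M \<pi> s) ` policies M)"

definition accessible :: "('s, 'a) mdp \<Rightarrow> ('s \<Rightarrow> 'a) \<Rightarrow> 's \<Rightarrow> 's \<Rightarrow> bool" where
  "accessible M \<pi> s s' \<longleftrightarrow>
     (\<exists>n. measure_pmf.prob (trajectory M \<pi> (Suc n) s) {\<omega>. \<omega> ! n = s'} > 0)"

text \<open>
  By continuity from below, the probability of ever returning to \<open>s\<close> is the supremum of the
  probabilities of returning within \<open>n\<close> steps.
\<close>

definition return_prob :: "('s, 'a) mdp \<Rightarrow> ('s \<Rightarrow> 'a) \<Rightarrow> 's \<Rightarrow> real" where
  "return_prob M \<pi> s =
     (SUP n. measure_pmf.prob (trajectory M \<pi> (Suc n) s) {\<omega>. \<exists>t\<in>{1..n}. \<omega> ! t = s})"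

definition transient :: "('s, 'a) mdp \<Rightarrow> ('s \<Rightarrow> 'a) \<Rightarrow> 's \<Rightarrow> bool" where
  "transient M \<pi> s \<longleftrightarrow> return_prob M \<pi> s < 1"

definition weakly_communicating :: "('s, 'a) mdp \<Rightarrow> bool" where
  "weakly_communicating M \<longleftrightarrow>
     (\<exists>C \<subseteq> states M.
        (\<forall>s\<in>C. \<forall>s'\<in>C. \<exists>\<pi>\<in>policies M. accessible M \<pi> s s') \<and>
        (\<forall>s\<in>states M - C. \<forall>\<pi>\<in>policies M. transient M \<pi> s))"

definition sp :: "'i set \<Rightarrow> ('i \<Rightarrow> real) \<Rightarrow> real" where
  "sp I x = Max (x ` I) - Min (x ` I)"

type_synonym ('s, 'a) qfun = "'s \<times> 'a \<Rightarrow> real"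

definition max_act :: "('s, 'a) mdp \<Rightarrow> ('s, 'a) qfun \<Rightarrow> 's \<Rightarrow> real" where
  "max_act M Q s = Max ((\<lambda>a. Q (s, a)) ` actions M)"

definition bellman_op :: "('s, 'a) mdp \<Rightarrow> ('s, 'a) qfun \<Rightarrow> ('s, 'a) qfun" where
  "bellman_op M Q =
     (\<lambda>(s, a). reward M (s, a) + (\<Sum>s'\<in>states M. pmf (kernel M s a) s' * max_act M Q s'))"

text \<open>
  For a weakly communicating MDP, \<^term>\<open>opt_gain M\<close> is constant on the states, and its value is
  the scalar \<open>g\<^sup>*\<close> of the Bellman equation.
\<close>

definition bellman_solution :: "('s, 'a) mdp \<Rightarrow> ('s, 'a) qfun \<Rightarrow> bool" where
  "bellman_solution M Q \<longleftrightarrow>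
     (\<forall>s\<in>states M. \<forall>a\<in>actions M. Q (s, a) = bellman_op M Q (s, a) - opt_gain M s)"

definition greedy :: "('s, 'a) mdp \<Rightarrow> ('s, 'a) qfun \<Rightarrow> ('s \<Rightarrow> 'a) set" where
  "greedy M Q = {\<pi>\<in>policies M. \<forall>s\<in>states M. \<forall>a\<in>actions M. Q (s, a) \<le> Q (s, \<pi> s)}"

text \<open>
  How the argmax policy is selected is left open: a selection rule may depend on all of
  \<open>n\<close>, \<open>Q\<^sup>n\<close> and \<open>T\<^sup>n\<close>, and may be randomized.
\<close>

type_synonym ('s, 'a) selection = "nat \<Rightarrow> ('s, 'a) qfun \<Rightarrow> ('s, 'a) qfun \<Rightarrow> ('s \<Rightarrow> 'a) pmf"

definition argmax_selection :: "('s, 'a) mdp \<Rightarrow> ('s, 'a) selection \<Rightarrow> bool" where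
  "argmax_selection M sel \<longleftrightarrow> (\<forall>n Q T. set_pmf (sel n Q T) \<subseteq> greedy M Q)"

definition sample :: "('s, 'a) mdp \<Rightarrow> ('s \<Rightarrow> real) \<Rightarrow> nat \<Rightarrow> ('s, 'a) qfun pmf" where
  "sample M d m =
     Pi_pmf (state_actions M) 0
       (\<lambda>(s, a). map_pmf (\<lambda>xs. 1 / real m * (\<Sum>x\<leftarrow>xs. d x)) (replicate_pmf m (kernel M s a)))"

definition batch_size :: "('s, 'a) mdp \<Rightarrow> real \<Rightarrow> real \<Rightarrow> real \<Rightarrow> ('s \<Rightarrow> real) \<Rightarrow> nat" where
  "batch_size M \<alpha> ck \<epsilon> d = max (nat \<lceil>\<alpha> * ck * (sp (states M) d)\<^sup>2 / \<epsilon>\<^sup>2\<rceil>) 1"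

text \<open>
  State of the main loop after an iteration \<open>k\<close>: \<open>Q\<^sup>k\<close>, \<open>T\<^sup>k\<close>, \<open>h\<^sup>k\<close> and the number of samples drawn
  so far. Before iteration \<open>0\<close> the component \<open>lq\<close> is only a placeholder.
\<close>

record ('s, 'a) loop_state =
  lq :: "('s, 'a) qfun"
  lt :: "('s, 'a) qfun"
  lh :: "'s \<Rightarrow> real"
  lsamples :: nat

definition savia_step ::
  "('s, 'a) mdp \<Rightarrow> (nat \<Rightarrow> real) \<Rightarrow> (nat \<Rightarrow> real) \<Rightarrow> ('s, 'a) qfun \<Rightarrow> real \<Rightarrow> real \<Rightarrow>
   nat \<Rightarrow> ('s, 'a) loop_state \<Rightarrow> ('s, 'a) loop_state pmf" where
  "savia_step M c \<beta> Q0 \<alpha> \<epsilon> k x =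
     (let b = (if k = 0 then 0 else \<beta> k);
          Q = (\<lambda>z. (1 - b) * Q0 z + b * lt x z);
          h = max_act M Q;
          d = (\<lambda>s. h s - lh x s);
          m = batch_size M \<alpha> (c k) \<epsilon> d
      in do {
        D \<leftarrow> sample M d m;
        return_pmf \<lparr>lq = Q, lt = (\<lambda>z. lt x z + D z), lh = h,
          lsamples = lsamples x + card (states M) * card (actions M) * m\<rparr>
      })"

text \<open>The first \<open>j\<close> iterations, i.e. those with index \<open>k < j\<close>.\<close>

primrec savia_loop ::
  "('s, 'a) mdp \<Rightarrow> (nat \<Rightarrow> real) \<Rightarrow> (nat \<Rightarrow> real) \<Rightarrow> ('s, 'a) qfun \<Rightarrow> real \<Rightarrow> real \<Rightarrow>
   nat \<Rightarrow> ('s, 'a) loop_state pmf" where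
  "savia_loop M c \<beta> Q0 \<alpha> \<epsilon> 0 = return_pmf \<lparr>lq = Q0, lt = reward M, lh = (\<lambda>_. 0), lsamples = 0\<rparr>"
| "savia_loop M c \<beta> Q0 \<alpha> \<epsilon> (Suc k) =
     do {x \<leftarrow> savia_loop M c \<beta> Q0 \<alpha> \<epsilon> k; savia_step M c \<beta> Q0 \<alpha> \<epsilon> k x}"

record ('s, 'a) savia_output =
  out_Q :: "('s, 'a) qfun"
  out_T :: "('s, 'a) qfun"
  out_policy :: "'s \<Rightarrow> 'a"
  out_samples :: nat

definition savia ::
  "('s, 'a) mdp \<Rightarrow> (nat \<Rightarrow> real) \<Rightarrow> (nat \<Rightarrow> real) \<Rightarrow> ('s, 'a) selection \<Rightarrow>
   ('s, 'a) qfun \<Rightarrow> nat \<Rightarrow> real \<Rightarrow> real \<Rightarrow> ('s, 'a) savia_output pmf" where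
  "savia M c \<beta> sel Q0 n \<epsilon> \<delta> =
     (let \<alpha> = ln (2 * real (card (states M)) * real (card (actions M)) * (real n + 1) / \<delta>)
      in do {
        x \<leftarrow> savia_loop M c \<beta> Q0 \<alpha> \<epsilon> (Suc n);
        \<pi> \<leftarrow> sel n (lq x) (lt x);
        return_pmf \<lparr>out_Q = lq x, out_T = lt x, out_policy = \<pi>, out_samples = lsamples x\<rparr>
      })"

text \<open>
  SAVIA+ is realized on the product space of independent runs of SAVIA, one for each index \<open>i\<close>;
  the algorithm inspects only the runs up to the first one that passes the stopping test.
\<close>

definition savia_plus_space ::
  "('s, 'a) mdp \<Rightarrow> (nat \<Rightarrow> real) \<Rightarrow> (nat \<Rightarrow> real) \<Rightarrow> ('s, 'a) selection \<Rightarrow>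
   ('s, 'a) qfun \<Rightarrow> real \<Rightarrow> real \<Rightarrow> (nat \<Rightarrow> ('s, 'a) savia_output) measure" where
  "savia_plus_space M c \<beta> sel Q0 \<epsilon> \<delta> =
     PiM UNIV (\<lambda>i. measure_pmf (savia M c \<beta> sel Q0 (2 ^ i) \<epsilon> (\<delta> / c i)))"

definition stop_test :: "('s, 'a) mdp \<Rightarrow> real \<Rightarrow> ('s, 'a) savia_output \<Rightarrow> bool" where
  "stop_test M \<epsilon> y \<longleftrightarrow> sp (state_actions M) (\<lambda>z. out_Q y z - out_T y z) \<le> 14 * \<epsilon>"

text \<open>The output is meaningful only if some run passes the stopping test.\<close>

definition savia_plus_output ::
  "('s, 'a) mdp \<Rightarrow> real \<Rightarrow> (nat \<Rightarrow> ('s, 'a) savia_output) \<Rightarrow> ('s, 'a) savia_output" where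
  "savia_plus_output M \<epsilon> \<omega> = \<omega> (LEAST i. stop_test M \<epsilon> (\<omega> i))"

text \<open>
  Run \<open>i\<close> is executed iff no earlier run has passed the test; the total is infinite if the
  algorithm never stops.
\<close>

definition savia_plus_samples ::
  "('s, 'a) mdp \<Rightarrow> real \<Rightarrow> (nat \<Rightarrow> ('s, 'a) savia_output) \<Rightarrow> ennreal" where
  "savia_plus_samples M \<epsilon> \<omega> =
     (\<Sum>i. if \<forall>j<i. \<not> stop_test M \<epsilon> (\<omega> j) then of_nat (out_samples (\<omega> i)) else 0)"

end

theory Submission
  imports Defs
begin

text \<open>
  For every \<open>Q\<close>, \<open>g\<^sup>*\<close> is at most the maximum of \<open>\<T>(Q) - Q\<close>, and a greedy policy has gain at least its
  minimum, so the gap is at most \<open>\<parallel>\<T>(Q) - Q\<parallel>\<close> in span seminorm. The errors \<open>T\<^sup>k - \<T>(Q\<^sup>k)\<close> form a martingale whose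
  increments are averages of bounded samples; the batch sizes make its variance proxy summable to
  \<open>\<epsilon>\<^sup>2 / (4\<alpha>)\<close>, and Hoeffding's lemma with a union bound keeps all errors below \<open>\<epsilon>\<close> outside an event of
  probability at most \<open>\<delta>\<close>. On the good event the anchored iteration satisfies
  \<open>\<parallel>Q\<^sup>k - Q\<^sup>*\<parallel> \<le> \<parallel>Q\<^sup>*\<parallel> + O(\<epsilon>k)\<close> and hence \<open>\<parallel>Q\<^bsup>k+1\<^esup> - Q\<^sup>k\<parallel> = O(\<parallel>h\<^sup>*\<parallel>/k + \<epsilon>)\<close>, which bounds the batch sizes and forces
  the stopping test to succeed once \<open>n \<ge> \<parallel>Q\<^sup>*\<parallel>/\<epsilon>\<close>. On the bad event \<open>\<parallel>d\<^sup>k\<parallel> \<le> 1\<close> still holds surely, so a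
  failing loop costs \<open>O(n\<^sup>2/\<epsilon>\<^sup>2)\<close> samples per pair, up to logarithms; the factor \<open>\<delta> = O(\<epsilon>\<^sup>2)\<close> and the independence of the loops
  make the contribution of failures a convergent geometric series.
\<close>

section \<open>The span seminorm\<close>

text \<open>Constancy of the optimal gain is proved here, because the Bellman equation subtracts
  \<open>opt_gain M s\<close> state by state while the gap argument needs one scalar. The obstacle
  is that accessibility speaks of one policy at a time and policies cannot be concatenated. The
  proof therefore passes to the graph of all possible transitions and builds a stationary policy
  that steers towards the states where a best policy has the largest gain. This needs gains to be
  harmonic, hence a mean ergodic theorem.

  The constant 17 is 14 + 2 + 1. In units of \<epsilon>/17, the stopping test contributes 14 to the
  gap, the sampling error in the test contributes 2, and failures contribute at most 1, since a gap
  never exceeds 1 and \<delta> <= \<epsilon>/17.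

  The sequence \<open>c\<close> has two roles, both resting on its reciprocals summing to at most 1:
  it distributes the variance over the iterations of one run and the failure probability over the
  loops.\<close>

lemma sp_ge:
  assumes "finite I" "i \<in> I" "j \<in> I"
  shows "x i - x j \<le> sp I x"
proof -
  have "x i \<le> Max (x ` I)" "Min (x ` I) \<le> x j" using assms by auto
  thus ?thesis by (simp add: sp_def)
qed

lemma sp_leI:
  assumes "finite I" "I \<noteq> {}" "\<And>i j. i \<in> I \<Longrightarrow> j \<in> I \<Longrightarrow> x i - x j \<le> c"
  shows "sp I x \<le> c"
proof -
  have "Max (x ` I) \<in> x ` I" "Min (x ` I) \<in> x ` I" using assms by auto
  then obtain i j where "i \<in> I" "j \<in> I" "Max (x ` I) = x i" "Min (x ` I) = x j" by auto
  thus ?thesis using assms(3)[of i j] by (simp add: sp_def)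
qed

lemma sp_nonneg: "finite I \<Longrightarrow> I \<noteq> {} \<Longrightarrow> 0 \<le> sp I x"
  using sp_ge[of I _ _ x] by fastforce

lemma sp_cong: "(\<And>i. i \<in> I \<Longrightarrow> x i = y i) \<Longrightarrow> sp I x = sp I y"
  by (simp add: sp_def cong: image_cong)

lemma sp_const: "I \<noteq> {} \<Longrightarrow> sp I (\<lambda>_. k) = 0"
  by (simp add: sp_def image_constant_conv)

lemma sp_add_le:
  assumes "finite I" "I \<noteq> {}"
  shows "sp I (\<lambda>i. x i + y i) \<le> sp I x + sp I y"
  by (rule sp_leI[OF assms])
    (use sp_ge[OF assms(1), of _ _ x] sp_ge[OF assms(1), of _ _ y] in \<open>smt (verit)\<close>)

lemma sp_cmult_le:
  assumes "finite I" "I \<noteq> {}" "0 \<le> c"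
  shows "sp I (\<lambda>i. c * x i) \<le> c * sp I x"
proof (rule sp_leI[OF assms(1,2)])
  fix i j assume "i \<in> I" "j \<in> I"
  from mult_left_mono[OF sp_ge[OF assms(1) this, of x] assms(3)]
  show "c * x i - c * x j \<le> c * sp I x" by (simp add: algebra_simps)
qed

lemma sp_uminus_eq: "finite I \<Longrightarrow> I \<noteq> {} \<Longrightarrow> sp I (\<lambda>i. - x i) = sp I x"
  by (rule antisym; rule sp_leI)
    (use sp_ge[of I _ _ x] sp_ge[of I _ _ "\<lambda>i. - x i"] in \<open>force+\<close>)

lemma sp_diff_le:
  assumes "finite I" "I \<noteq> {}"
  shows "sp I (\<lambda>i. x i - y i) \<le> sp I x + sp I y"
  using sp_add_le[OF assms, of x "\<lambda>i. - y i"] sp_uminus_eq[OF assms, of y] by simp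

lemma sp_le_of_abs_le:
  assumes "finite I" "I \<noteq> {}" "\<And>i. i \<in> I \<Longrightarrow> \<bar>x i\<bar> \<le> c"
  shows "sp I x \<le> 2 * c"
  by (rule sp_leI[OF assms(1,2)]) (use assms(3) in \<open>smt (verit)\<close>)

section \<open>Finite stochastic matrices\<close>

text \<open>Bolzano-Weierstrass one coordinate at a time: a further subsequence keeps the limits
  already obtained. Nothing is claimed outside the carrier \<open>S\<close>.\<close>

lemma finite_convergent_subseq:
  fixes x :: "nat \<Rightarrow> 's \<Rightarrow> real"
  assumes "finite S" "\<And>s. s \<in> S \<Longrightarrow> Bseq (\<lambda>n. x n s)"
  obtains r :: "nat \<Rightarrow> nat" and l where "strict_mono r" "\<And>s. s \<in> S \<Longrightarrow> (\<lambda>k. x (r k) s) \<longlonglongrightarrow> l s"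
proof -
  have "\<exists>r l. strict_mono (r :: nat \<Rightarrow> nat) \<and> (\<forall>s\<in>S. (\<lambda>k. x (r k) s) \<longlonglongrightarrow> l s)"
    using assms
  proof (induction S rule: finite_induct)
    case empty
    show ?case by (rule exI[of _ id]) (auto simp: strict_mono_def)
  next
    case (insert s S)
    then obtain r l where r: "strict_mono (r :: nat \<Rightarrow> nat)" "\<forall>s\<in>S. (\<lambda>k. x (r k) s) \<longlonglongrightarrow> l s"
      by auto
    have "Bseq (\<lambda>n. x n s)" using insert by auto
    then obtain B where B: "\<And>n. norm (x n s) \<le> B" unfolding Bseq_def by auto
    have "Bseq (\<lambda>k. x (r k) s)" by (rule BseqI'[of _ B]) (use B in auto)
    hence "bounded (range (\<lambda>k. x (r k) s))" by (simp add: Bseq_eq_bounded)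
    then obtain l' r' where r': "strict_mono (r' :: nat \<Rightarrow> nat)" "((\<lambda>k. x (r k) s) \<circ> r') \<longlonglongrightarrow> l'"
      using bounded_imp_convergent_subsequence by blast
    have "(\<lambda>k. x ((r \<circ> r') k) t) \<longlonglongrightarrow> (l(s := l')) t" if "t \<in> insert s S" for t
    proof (cases "t = s")
      case True
      thus ?thesis using r'(2) by (simp add: comp_def)
    next
      case False
      hence "(\<lambda>k. x (r k) t) \<longlonglongrightarrow> l t" using r(2) that by auto
      from LIMSEQ_subseq_LIMSEQ[OF this r'(1)] False show ?thesis by (simp add: comp_def)
    qed
    moreover have "strict_mono (r \<circ> r')" using r(1) r'(1) by (rule strict_mono_o)
    ultimately show ?case by blast
  qed
  thus ?thesis using that by blast
qed

section \<open>Cesaro averages of a Markov operator\<close>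

locale stochastic_matrix =
  fixes S :: "'s set" and P :: "'s \<Rightarrow> 's \<Rightarrow> real"
  assumes fin: "finite S"
    and P_nonneg: "s \<in> S \<Longrightarrow> t \<in> S \<Longrightarrow> 0 \<le> P s t"
    and P_sum: "s \<in> S \<Longrightarrow> (\<Sum>t\<in>S. P s t) = 1"
begin

definition av :: "('s \<Rightarrow> real) \<Rightarrow> 's \<Rightarrow> real" where
  "av f s = (\<Sum>t\<in>S. P s t * f t)"

definition closed_set :: "'s set \<Rightarrow> bool" where
  "closed_set X \<longleftrightarrow> X \<subseteq> S \<and> (\<forall>s\<in>X. \<forall>t\<in>S. 0 < P s t \<longrightarrow> t \<in> X)"

definition cesaro :: "nat \<Rightarrow> ('s \<Rightarrow> real) \<Rightarrow> 's \<Rightarrow> real" where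
  "cesaro n f s = (\<Sum>t<n. (av ^^ t) f s) / real n"

lemma av_mono:
  assumes "s \<in> S" "\<And>t. t \<in> S \<Longrightarrow> f t \<le> g t"
  shows "av f s \<le> av g s"
  unfolding av_def by (intro sum_mono mult_left_mono) (use assms P_nonneg in auto)

lemma av_const [simp]: "s \<in> S \<Longrightarrow> av (\<lambda>_. c) s = c"
  by (simp add: av_def P_sum flip: sum_distrib_right)

lemma av_cong: "(\<And>t. t \<in> S \<Longrightarrow> f t = g t) \<Longrightarrow> av f = av g"
  by (auto simp: av_def fun_eq_iff)

lemma av_add: "av (\<lambda>t. f t + g t) = (\<lambda>s. av f s + av g s)"
  by (simp add: av_def fun_eq_iff sum.distrib distrib_left)

lemma av_diff: "av (\<lambda>t. f t - g t) = (\<lambda>s. av f s - av g s)"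
  by (simp add: av_def fun_eq_iff sum_subtractf right_diff_distrib)

lemma av_sum: "av (\<lambda>t. \<Sum>i\<in>I. f i t) = (\<lambda>s. \<Sum>i\<in>I. av (f i) s)"
  unfolding av_def fun_eq_iff sum_distrib_left by (intro allI sum.swap)

lemma av_cmult: "av (\<lambda>t. c * f t) = (\<lambda>s. c * av f s)"
  by (simp add: av_def fun_eq_iff sum_distrib_left mult.left_commute)

lemma av_pow_mono:
  assumes "s \<in> S" "\<And>t. t \<in> S \<Longrightarrow> f t \<le> g t"
  shows "(av ^^ n) f s \<le> (av ^^ n) g s"
  using assms(1) by (induction n arbitrary: s) (auto intro: assms av_mono)

lemma av_pow_const [simp]: "s \<in> S \<Longrightarrow> (av ^^ n) (\<lambda>_. c) s = c"
proof (induction n arbitrary: s)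
  case (Suc n)
  have "av ((av ^^ n) (\<lambda>_. c)) = av (\<lambda>_. c)" by (rule av_cong) (use Suc in auto)
  thus ?case using Suc by simp
qed simp

lemma av_pow_add: "(av ^^ n) (\<lambda>t. f t + g t) = (\<lambda>s. (av ^^ n) f s + (av ^^ n) g s)"
  by (induction n) (simp_all add: av_add)

lemma av_pow_diff: "(av ^^ n) (\<lambda>t. f t - g t) = (\<lambda>s. (av ^^ n) f s - (av ^^ n) g s)"
  by (induction n) (simp_all add: av_diff)

lemma av_pow_cmult: "(av ^^ n) (\<lambda>t. c * f t) = (\<lambda>s. c * (av ^^ n) f s)"
  by (induction n) (simp_all add: av_cmult)

lemma av_pow_sum: "(av ^^ n) (\<lambda>t. \<Sum>i\<in>I. f i t) = (\<lambda>s. \<Sum>i\<in>I. (av ^^ n) (f i) s)"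
  by (induction n) (simp_all add: av_sum)

lemma av_pow_abs_le:
  assumes "s \<in> S" "\<And>t. t \<in> S \<Longrightarrow> \<bar>f t\<bar> \<le> B"
  shows "\<bar>(av ^^ n) f s\<bar> \<le> B"
proof -
  have "(av ^^ n) f s \<le> (av ^^ n) (\<lambda>_. B) s" "(av ^^ n) (\<lambda>_. - B) s \<le> (av ^^ n) f s"
    by (intro av_pow_mono; use assms in force)+
  thus ?thesis using assms(1) by simp
qed

lemma cesaro_abs_le:
  assumes "s \<in> S" "\<And>t. t \<in> S \<Longrightarrow> \<bar>f t\<bar> \<le> B"
  shows "\<bar>cesaro n f s\<bar> \<le> B"
proof (cases "n = 0")
  \<comment> \<open>Division by zero gives the value 0 here, and \<open>0 \<le> B\<close> follows
    from the hypothesis at \<open>s\<close>.\<close>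
  case True
  thus ?thesis using assms by (force simp: cesaro_def)
next
  case False
  have "\<bar>\<Sum>t<n. (av ^^ t) f s\<bar> \<le> (\<Sum>t<n. B)"
    by (rule order_trans[OF sum_abs sum_mono], rule av_pow_abs_le) (use assms in auto)
  thus ?thesis using False by (simp add: cesaro_def field_simps)
qed

lemma bounded_on_S:
  fixes f :: "'s \<Rightarrow> real"
  obtains B where "0 \<le> B" "\<And>t. t \<in> S \<Longrightarrow> \<bar>f t\<bar> \<le> B"
  using that[of "\<Sum>t\<in>S. \<bar>f t\<bar>"] member_le_sum[of _ S "\<lambda>t. \<bar>f t\<bar>"] fin
  by (auto intro: sum_nonneg)

text \<open>Shifting by one index telescopes: the sum changes only by its two boundary terms, each
  of size at most \<open>B\<close>. The general case adds up \<open>j\<close> such shifts.\<close>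

lemma cesaro_shift:
  assumes "s \<in> S" "\<And>t. t \<in> S \<Longrightarrow> \<bar>f t\<bar> \<le> B"
  shows "\<bar>cesaro m ((av ^^ j) f) s - cesaro m f s\<bar> \<le> 2 * real j * B / real m"
proof -
  have bd: "\<bar>(av ^^ n) f s\<bar> \<le> B" for n by (rule av_pow_abs_le) (use assms in auto)
  have *: "\<bar>(\<Sum>t<m. (av ^^ t) ((av ^^ j) f) s) - (\<Sum>t<m. (av ^^ t) f s)\<bar> \<le> 2 * real j * B"
  proof (induction j)
    case (Suc j)
    have "(\<Sum>t<m. (av ^^ t) ((av ^^ Suc j) f) s) - (\<Sum>t<m. (av ^^ t) ((av ^^ j) f) s)
        = (\<Sum>t<m. (av ^^ (Suc t + j)) f s - (av ^^ (t + j)) f s)"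
      by (simp add: sum_subtractf funpow_add flip: funpow_swap1)
    also have "\<dots> = (av ^^ (m + j)) f s - (av ^^ j) f s"
      using sum_lessThan_telescope[of "\<lambda>t. (av ^^ (t + j)) f s" m] by simp
    finally show ?case using Suc bd[of "m + j"] bd[of j]
      by (simp only: abs_le_iff of_nat_Suc ring_distribs) linarith
  qed simp
  show ?thesis
    using divide_right_mono[OF *, of "real m"]
    by (simp add: cesaro_def diff_divide_distrib[symmetric] abs_divide)
qed

text \<open>Mean ergodic theorem by compactness, without spectral theory. A subsequential limit
  \<open>g\<close> is harmonic. For a fixed good index \<open>n\<close> of the subsequence,
  \<open>cesaro m (cesaro n f)\<close> is close to \<open>cesaro m f\<close> by shift invariance,
  and close to \<open>cesaro m g = g\<close> because \<open>cesaro n f\<close> is close to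
  \<open>g\<close>. So the whole sequence converges to \<open>g\<close>.\<close>

theorem cesaro_convergence:
  obtains g where "\<And>s. s \<in> S \<Longrightarrow> (\<lambda>n. cesaro n f s) \<longlonglongrightarrow> g s" "\<And>s. s \<in> S \<Longrightarrow> av g s = g s"
proof -
  obtain B where B: "0 \<le> B" "\<And>t. t \<in> S \<Longrightarrow> \<bar>f t\<bar> \<le> B" using bounded_on_S[of f] by blast
  have "Bseq (\<lambda>n. cesaro n f s)" if "s \<in> S" for s
    by (rule BseqI'[of _ B]) (use cesaro_abs_le[where f = f, OF that B(2)] in auto)
  then obtain r g where r: "strict_mono (r :: nat \<Rightarrow> nat)"
    and g: "\<And>s. s \<in> S \<Longrightarrow> (\<lambda>k. cesaro (r k) f s) \<longlonglongrightarrow> g s"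
    using finite_convergent_subseq[OF fin, of "\<lambda>n. cesaro n f"] by blast
  have lim0: "(\<lambda>n. C / real n) \<longlonglongrightarrow> 0" for C by real_asymp
  have harm: "av g s = g s" if s: "s \<in> S" for s
  proof -
    have 1: "(\<lambda>k. av (cesaro (r k) f) s) \<longlonglongrightarrow> av g s"
      unfolding av_def by (intro tendsto_intros g)
    have 2: "(\<lambda>k. av (cesaro (r k) f) s - cesaro (r k) f s) \<longlonglongrightarrow> 0"
    proof (rule Lim_null_comparison)
      \<comment> \<open>Applying \<open>av\<close> to an average shifts it by one index, which costs
        at most \<open>2 * B / n\<close>.\<close>
      have "av (cesaro n f) s = cesaro n ((av ^^ 1) f) s" for n
      proof -
        have "av (cesaro n f) s = av (\<lambda>s. 1 / real n * (\<Sum>t<n. (av ^^ t) f s)) s"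
          by (simp add: cesaro_def[abs_def])
        also have "\<dots> = 1 / real n * (\<Sum>t<n. (av ^^ t) (av f) s)"
          unfolding av_cmult av_sum by (simp add: funpow_swap1)
        finally show ?thesis by (simp add: cesaro_def)
      qed
      thus "\<forall>\<^sub>F k in sequentially. norm (av (cesaro (r k) f) s - cesaro (r k) f s)
          \<le> 2 * B / real (r k)"
        using cesaro_shift[where f = f and j = 1, OF s B(2)] by (intro always_eventually allI) simp
      show "(\<lambda>k. 2 * B / real (r k)) \<longlonglongrightarrow> 0"
        using LIMSEQ_subseq_LIMSEQ[OF lim0 r, of "2 * B"] by (simp add: comp_def)
    qed
    have "(\<lambda>k. cesaro (r k) f s) \<longlonglongrightarrow> av g s"
      using tendsto_diff[OF 1 2] by simp
    thus ?thesis using g[OF s] LIMSEQ_unique by blast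
  qed
  have pow_g: "(av ^^ t) g s = g s" if "s \<in> S" for s t
    using that
  proof (induction t arbitrary: s)
    case (Suc t)
    have "av ((av ^^ t) g) = av g" by (rule av_cong) (use Suc in auto)
    thus ?case using Suc harm by simp
  qed simp
  have "(\<lambda>n. cesaro n f s) \<longlonglongrightarrow> g s" if s: "s \<in> S" for s
  proof (rule LIMSEQ_I)
    fix e :: real assume e: "e > 0"
    have "\<forall>\<^sub>F k in sequentially. \<forall>t\<in>S. \<bar>cesaro (r k) f t - g t\<bar> < e / 2"
    proof (intro eventually_ball_finite[OF fin] ballI)
      fix t assume "t \<in> S"
      from tendstoD[OF g[OF this], of "e / 2"] e
      show "\<forall>\<^sub>F k in sequentially. \<bar>cesaro (r k) f t - g t\<bar> < e / 2" by (simp add: dist_real_def)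
    qed
    moreover have "\<forall>\<^sub>F k in sequentially. r k \<ge> 1"
      using filterlim_subseq[OF r] by (auto simp: filterlim_at_top)
    ultimately have "\<forall>\<^sub>F k in sequentially. r k \<ge> 1 \<and> (\<forall>t\<in>S. \<bar>cesaro (r k) f t - g t\<bar> < e / 2)"
      by eventually_elim auto
    then obtain k where k: "r k \<ge> 1" "\<And>t. t \<in> S \<Longrightarrow> \<bar>cesaro (r k) f t - g t\<bar> < e / 2"
      by (auto simp: eventually_sequentially)
    \<comment> \<open>From here on \<open>n\<close> is frozen and \<open>m\<close> tends to
      infinity, so the shift error \<open>2 * n * B / m\<close> vanishes.\<close>
    define n where "n = r k"
    have n: "n \<ge> 1" using k by (simp add: n_def)
    have "\<forall>\<^sub>F m in sequentially. 2 * real n * B / real m < e / 2"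
      using order_tendstoD(2)[OF lim0, of "e / 2" "2 * real n * B"] e by simp
    moreover have "\<forall>\<^sub>F m in sequentially. m \<ge> (1 :: nat)" by (rule eventually_ge_at_top)
    ultimately have "\<forall>\<^sub>F m in sequentially. \<bar>cesaro m f s - g s\<bar> < e"
    proof eventually_elim
      case (elim m)
      have "cesaro m (cesaro n f) s = (\<Sum>t<n. cesaro m ((av ^^ t) f) s) / real n"
      proof -
        have "(av ^^ i) (cesaro n f) s = (\<Sum>t<n. (av ^^ i) ((av ^^ t) f) s) / real n" for i
          using av_pow_cmult[of i "1 / real n" "\<lambda>s. \<Sum>t<n. (av ^^ t) f s"]
          by (simp add: cesaro_def[abs_def] av_pow_sum)
        hence "cesaro m (cesaro n f) s = (\<Sum>i<m. \<Sum>t<n. (av ^^ i) ((av ^^ t) f) s / real n) / real m"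
          unfolding cesaro_def[of m] by (simp add: sum_divide_distrib)
        also have "\<dots> = (\<Sum>t<n. \<Sum>i<m. (av ^^ i) ((av ^^ t) f) s / real n) / real m"
          by (subst sum.swap) simp
        also have "\<dots> = (\<Sum>t<n. cesaro m ((av ^^ t) f) s) / real n"
          by (simp add: cesaro_def sum_divide_distrib field_simps)
        finally show ?thesis .
      qed
      hence "cesaro m (cesaro n f) s - cesaro m f s
          = (\<Sum>t<n. cesaro m ((av ^^ t) f) s - cesaro m f s) / real n"
        using n by (simp add: sum_subtractf diff_divide_distrib)
      moreover have "\<bar>\<Sum>t<n. cesaro m ((av ^^ t) f) s - cesaro m f s\<bar> \<le> (\<Sum>t<n. 2 * real n * B / real m)"
      proof (rule order_trans[OF sum_abs sum_mono])
        fix t assume "t \<in> {..<n}"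
        hence "2 * real t * B / real m \<le> 2 * real n * B / real m"
          using B(1) by (intro divide_right_mono mult_right_mono) auto
        thus "\<bar>cesaro m ((av ^^ t) f) s - cesaro m f s\<bar> \<le> 2 * real n * B / real m"
          using cesaro_shift[where f = f and j = t and m = m, OF s B(2)] by linarith
      qed
      ultimately have "\<bar>cesaro m (cesaro n f) s - cesaro m f s\<bar> \<le> (\<Sum>t<n. 2 * real n * B / real m) / real n"
        by (simp only: abs_divide abs_of_nat) (rule divide_right_mono, simp_all)
      also have "\<dots> = 2 * real n * B / real m" using n by simp
      finally have 1: "\<bar>cesaro m (cesaro n f) s - cesaro m f s\<bar> \<le> 2 * real n * B / real m" .
      have "cesaro m (\<lambda>t. cesaro n f t - g t) s = cesaro m (cesaro n f) s - cesaro m g s"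
        by (simp add: cesaro_def[of m] av_pow_diff sum_subtractf diff_divide_distrib)
      moreover have "cesaro m g s = g s" using pow_g[OF s] elim by (simp add: cesaro_def)
      moreover have "\<bar>cesaro m (\<lambda>t. cesaro n f t - g t) s\<bar> \<le> e / 2"
        by (rule cesaro_abs_le[OF s]) (use k(2) less_imp_le in \<open>auto simp: n_def\<close>)
      ultimately show ?case using 1 elim by linarith
    qed
    thus "\<exists>no. \<forall>n\<ge>no. norm (cesaro n f s - g s) < e"
      by (auto simp: eventually_sequentially)
  qed
  thus ?thesis using that harm by blast
qed

text \<open>Averaging the inequality along the chain telescopes the potential \<open>h\<close>,
  which then contributes only \<open>2 * B / n\<close> and disappears in the limit.\<close>

lemma cesaro_limit_ge:
  assumes "s \<in> S" "(\<lambda>n. cesaro n f s) \<longlonglongrightarrow> l" "\<And>t. t \<in> S \<Longrightarrow> c \<le> f t + av h t - h t"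
  shows "c \<le> l"
proof -
  obtain B where B: "0 \<le> B" "\<And>t. t \<in> S \<Longrightarrow> \<bar>h t\<bar> \<le> B" using bounded_on_S[of h] by blast
  have lim: "(\<lambda>n. cesaro n f s + 2 * B / real n) \<longlonglongrightarrow> l + 0"
    by (intro tendsto_add assms) real_asymp
  have le: "c \<le> cesaro n f s + 2 * B / real n" if n: "n \<ge> 1" for n
  proof -
    have "c \<le> (av ^^ t) f s + ((av ^^ t) (av h) s - (av ^^ t) h s)" for t
    proof -
      have "(av ^^ t) (\<lambda>_. c) s \<le> (av ^^ t) (\<lambda>t. f t + (av h t - h t)) s"
        using assms(3) by (intro av_pow_mono assms(1)) (simp add: algebra_simps)
      thus ?thesis using assms(1) by (simp add: av_pow_add av_pow_diff)
    qed
    hence "(\<Sum>t<n. c) \<le> (\<Sum>t<n. (av ^^ t) f s + ((av ^^ t) (av h) s - (av ^^ t) h s))"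
      by (intro sum_mono) auto
    hence "c \<le> cesaro n f s + (cesaro n ((av ^^ 1) h) s - cesaro n h s)"
      using n by (simp add: cesaro_def sum.distrib sum_subtractf field_simps)
    thus ?thesis using cesaro_shift[where f = h and j = 1 and m = n, OF assms(1) B(2)] by simp
  qed
  have "c \<le> l + 0" by (rule LIMSEQ_le_const[OF lim]) (use le in blast)
  thus ?thesis by simp
qed

text \<open>Minimum principle: an average of values that are at least \<open>m\<close> can be at
  most \<open>m\<close> only if every successor of positive weight has the value \<open>m\<close>.
  The inequality is required at minimizers only, so the principle also covers hitting probabilities,
  which are not harmonic at their target.\<close>

lemma superharmonic_argmin_closed:
  assumes "closed_set X" "\<And>s. s \<in> X \<Longrightarrow> m \<le> f s" "\<And>s. s \<in> X \<Longrightarrow> f s = m \<Longrightarrow> av f s \<le> m"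
  shows "closed_set {s \<in> X. f s = m}"
  unfolding closed_set_def
proof safe
  fix s assume "s \<in> X" thus "s \<in> S" using assms by (auto simp: closed_set_def)
next
  fix s t assume s: "s \<in> X" "m = f s" and t: "t \<in> S" "0 < P s t"
  thus "t \<in> X" using assms(1) by (auto simp: closed_set_def)
  have sS: "s \<in> S" using s assms by (auto simp: closed_set_def)
  have X: "u \<in> X" if "u \<in> S" "0 < P s u" for u using assms(1) s that by (auto simp: closed_set_def)
  show "f t = f s"
  proof (rule ccontr)
    assume "f t \<noteq> f s"
    hence "f t > m" using assms(2)[of t] X t s by force
    have "(\<Sum>u\<in>S. P s u * m) < (\<Sum>u\<in>S. P s u * f u)"
    proof (rule sum_strict_mono_ex1[OF fin])
      show "\<forall>u\<in>S. P s u * m \<le> P s u * f u"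
      proof
        fix u assume u: "u \<in> S"
        show "P s u * m \<le> P s u * f u"
          using P_nonneg[OF sS u] X[OF u] assms(2)[of u] by (cases "P s u = 0") auto
      qed
      show "\<exists>u\<in>S. P s u * m < P s u * f u" using t \<open>f t > m\<close> by (intro bexI[of _ t]) auto
    qed
    moreover have "(\<Sum>u\<in>S. P s u * m) = m" using P_sum[OF sS] by (simp flip: sum_distrib_right)
    ultimately show False using assms(3)[OF s(1)] s by (simp add: av_def)
  qed
qed

end

section \<open>Gains of stationary policies\<close>

locale fin_mdp =
  fixes M :: "('s, 'a) mdp"
  assumes finite_mdp: "finite_mdp M"
begin

abbreviation "S \<equiv> states M"
abbreviation "A \<equiv> actions M"

definition trans :: "('s \<Rightarrow> 'a) \<Rightarrow> 's \<Rightarrow> 's \<Rightarrow> real" where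
  "trans \<pi> s t = pmf (kernel M s (\<pi> s)) t"

abbreviation "av\<^sub>\<pi> \<pi> \<equiv> stochastic_matrix.av S (trans \<pi>)"
abbreviation "closed\<^sub>\<pi> \<pi> \<equiv> stochastic_matrix.closed_set S (trans \<pi>)"
abbreviation "rew\<^sub>\<pi> \<pi> \<equiv> \<lambda>s. reward M (s, \<pi> s)"

lemma finS: "finite S" and neS: "S \<noteq> {}" and finA: "finite A" and neA: "A \<noteq> {}"
  and ker: "s \<in> S \<Longrightarrow> a \<in> A \<Longrightarrow> set_pmf (kernel M s a) \<subseteq> S"
  using finite_mdp by (auto simp: finite_mdp_def)

lemma finSA: "finite (state_actions M)" and neSA: "state_actions M \<noteq> {}"
  using finS finA neS neA by auto

lemma policy_mem: "\<pi> \<in> policies M \<Longrightarrow> s \<in> S \<Longrightarrow> \<pi> s \<in> A"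
  by (auto simp: policies_def)

lemma finite_policies: "finite (policies M)" and policies_ne: "policies M \<noteq> {}"
  unfolding policies_def using finS finA neA by (auto intro: finite_PiE simp: PiE_eq_empty_iff)

lemma sum_kernel: "s \<in> S \<Longrightarrow> a \<in> A \<Longrightarrow> (\<Sum>t\<in>S. pmf (kernel M s a) t) = 1"
  using ker finS by (intro sum_pmf_eq_1) auto

lemma stoch: "\<pi> \<in> policies M \<Longrightarrow> stochastic_matrix S (trans \<pi>)"
  by unfold_locales (auto simp: trans_def finS sum_kernel policy_mem)

lemma finite_trajectory:
  "\<pi> \<in> policies M \<Longrightarrow> s \<in> S \<Longrightarrow> finite (set_pmf (trajectory M \<pi> n s))"
proof (induction n arbitrary: s)
  case (Suc n)
  have "set_pmf (kernel M s (\<pi> s)) \<subseteq> S" using ker Suc.prems policy_mem by auto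
  thus ?case using Suc finite_subset[OF _ finS] by (auto simp: set_bind_pmf)
qed simp

lemma trajectory_hd: "\<omega> \<in> set_pmf (trajectory M \<pi> (Suc n) s) \<Longrightarrow> \<omega> ! 0 = s"
  by auto

lemma trajectory_expectation_Suc:
  fixes F :: "'s list \<Rightarrow> real"
  assumes "\<pi> \<in> policies M" "s \<in> S"
  shows "measure_pmf.expectation (trajectory M \<pi> (Suc n) s) F
    = (\<Sum>t\<in>S. trans \<pi> s t * measure_pmf.expectation (trajectory M \<pi> n t) (\<lambda>\<omega>. F (s # \<omega>)))"
proof -
  have eq: "trajectory M \<pi> (Suc n) s
      = kernel M s (\<pi> s) \<bind> (\<lambda>t. map_pmf ((#) s) (trajectory M \<pi> n t))"
    by (simp add: map_pmf_def)
  have "set_pmf (kernel M s (\<pi> s)) \<subseteq> S" using ker assms policy_mem by auto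
  hence "measure_pmf.expectation (trajectory M \<pi> (Suc n) s) F
    = (\<Sum>t\<in>S. pmf (kernel M s (\<pi> s)) t *\<^sub>R
        measure_pmf.expectation (map_pmf ((#) s) (trajectory M \<pi> n t)) F)"
    unfolding eq by (intro pmf_expectation_bind[OF finS]) (use assms finite_trajectory in auto)
  thus ?thesis by (simp add: trans_def)
qed

lemma trajectory_prob_Suc:
  assumes "\<pi> \<in> policies M" "s \<in> S"
  shows "measure_pmf.prob (trajectory M \<pi> (Suc n) s) X
    = (\<Sum>t\<in>S. trans \<pi> s t * measure_pmf.prob (trajectory M \<pi> n t) {\<omega>. s # \<omega> \<in> X})"
proof -
  have "(\<lambda>\<omega>. indicat_real X (s # \<omega>)) = indicator {\<omega>. s # \<omega> \<in> X}"
    by (auto simp: indicator_def fun_eq_iff)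
  thus ?thesis using trajectory_expectation_Suc[OF assms, of n "indicator X"] by simp
qed

lemma trajectory_expectation_sum:
  assumes "\<pi> \<in> policies M" "s \<in> S"
  shows "measure_pmf.expectation (trajectory M \<pi> n s) (\<lambda>\<omega>. \<Sum>t<n. f (\<omega> ! t))
    = (\<Sum>t<n. (av\<^sub>\<pi> \<pi> ^^ t) f s)"
  using assms(2)
proof (induction n arbitrary: s)
  case (Suc n)
  interpret stochastic_matrix S "trans \<pi>" using stoch assms by blast
  have "measure_pmf.expectation (trajectory M \<pi> (Suc n) s) (\<lambda>\<omega>. \<Sum>t<Suc n. f (\<omega> ! t))
      = (\<Sum>u\<in>S. trans \<pi> s u *
          measure_pmf.expectation (trajectory M \<pi> n u) (\<lambda>\<omega>. f s + (\<Sum>t<n. f (\<omega> ! t))))"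
    unfolding trajectory_expectation_Suc[OF assms(1) Suc.prems] sum.lessThan_Suc_shift by simp
  also have "\<dots> = (\<Sum>u\<in>S. trans \<pi> s u * (f s + (\<Sum>t<n. (av ^^ t) f u)))"
  proof (rule sum.cong[OF refl])
    fix u assume u: "u \<in> S"
    have "measure_pmf.expectation (trajectory M \<pi> n u) (\<lambda>\<omega>. f s + (\<Sum>t<n. f (\<omega> ! t)))
        = f s + (\<Sum>t<n. (av ^^ t) f u)"
      using Suc.IH[OF u] finite_trajectory[OF assms(1) u]
      by (subst Bochner_Integration.integral_add) (auto intro: integrable_measure_pmf_finite)
    thus "trans \<pi> s u * measure_pmf.expectation (trajectory M \<pi> n u) (\<lambda>\<omega>. f s + (\<Sum>t<n. f (\<omega> ! t)))
        = trans \<pi> s u * (f s + (\<Sum>t<n. (av ^^ t) f u))" by simp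
  qed
  also have "\<dots> = av (\<lambda>u. f s + (\<Sum>t<n. (av ^^ t) f u)) s"
    by (simp add: av_def)
  also have "\<dots> = f s + (\<Sum>t<n. av ((av ^^ t) f) s)"
    using Suc.prems by (simp add: av_add av_sum)
  also have "\<dots> = (\<Sum>t<Suc n. (av ^^ t) f s)"
    unfolding sum.lessThan_Suc_shift by simp
  finally show ?case .
qed simp

text \<open>The first part turns \<open>lim\<close> into a genuine limit; for a divergent sequence
  it would be unspecified. The second part makes the gain harmonic, which is what the minimum
  principle is applied to later.\<close>

lemma gain_limit:
  assumes "\<pi> \<in> policies M"
  shows "s \<in> S \<Longrightarrow> (\<lambda>n. stochastic_matrix.cesaro S (trans \<pi>) n (rew\<^sub>\<pi> \<pi>) s) \<longlonglongrightarrow> gain M \<pi> s"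
    and "s \<in> S \<Longrightarrow> av\<^sub>\<pi> \<pi> (gain M \<pi>) s = gain M \<pi> s"
proof -
  interpret stochastic_matrix S "trans \<pi>" using stoch assms by blast
  obtain g where g: "\<And>s. s \<in> S \<Longrightarrow> (\<lambda>n. cesaro n (rew\<^sub>\<pi> \<pi>) s) \<longlonglongrightarrow> g s"
    "\<And>s. s \<in> S \<Longrightarrow> av g s = g s" by (rule cesaro_convergence[of "rew\<^sub>\<pi> \<pi>"]) blast
  have gain: "gain M \<pi> s = g s" if "s \<in> S" for s
  proof -
    have "measure_pmf.expectation (trajectory M \<pi> n s)
        (\<lambda>\<omega>. 1 / real n * (\<Sum>t<n. reward M (\<omega> ! t, \<pi> (\<omega> ! t)))) = cesaro n (rew\<^sub>\<pi> \<pi>) s" for n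
      using trajectory_expectation_sum[OF assms that, of n "rew\<^sub>\<pi> \<pi>"] by (simp add: cesaro_def)
    thus ?thesis unfolding gain_def using g(1)[OF that] by (simp add: limI)
  qed
  show "s \<in> S \<Longrightarrow> (\<lambda>n. cesaro n (rew\<^sub>\<pi> \<pi>) s) \<longlonglongrightarrow> gain M \<pi> s" using g gain by simp
  have "av (gain M \<pi>) = av g" by (rule av_cong) (rule gain)
  thus "s \<in> S \<Longrightarrow> av (gain M \<pi>) s = gain M \<pi> s" using g gain by simp
qed

text \<open>Any potential \<open>h\<close> certifies a lower bound for the gain. The choice for
  greedy policies is \<open>max_act M Q\<close>.\<close>

lemma gain_ge:
  assumes "\<pi> \<in> policies M" "s \<in> S"
    and "\<And>t. t \<in> S \<Longrightarrow> c \<le> reward M (t, \<pi> t) + av\<^sub>\<pi> \<pi> h t - h t"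
  shows "c \<le> gain M \<pi> s"
proof -
  interpret stochastic_matrix S "trans \<pi>" using stoch assms by blast
  show ?thesis
    by (rule cesaro_limit_ge[OF assms(2) gain_limit(1)[OF assms(1,2)]]) (rule assms(3))
qed

lemma gain_abs_le:
  assumes "\<pi> \<in> policies M" "s \<in> S" "\<And>s a. s \<in> S \<Longrightarrow> a \<in> A \<Longrightarrow> \<bar>reward M (s, a)\<bar> \<le> B"
  shows "\<bar>gain M \<pi> s\<bar> \<le> B"
proof -
  interpret stochastic_matrix S "trans \<pi>" using stoch assms by blast
  have "\<bar>cesaro n (rew\<^sub>\<pi> \<pi>) s\<bar> \<le> B" for n
    by (rule cesaro_abs_le) (use assms policy_mem in auto)
  thus ?thesis
    using tendsto_rabs[OF gain_limit(1)[OF assms(1,2)]] by (intro LIMSEQ_le_const2) auto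
qed

lemma gain_le_opt_gain: "\<pi> \<in> policies M \<Longrightarrow> gain M \<pi> s \<le> opt_gain M s"
  unfolding opt_gain_def using finite_policies by auto

lemma opt_gain_attained: obtains \<pi> where "\<pi> \<in> policies M" "opt_gain M s = gain M \<pi> s"
proof -
  have "opt_gain M s \<in> (\<lambda>\<pi>. gain M \<pi> s) ` policies M"
    unfolding opt_gain_def using finite_policies policies_ne by (intro Max_in) auto
  thus ?thesis using that by auto
qed

section \<open>Constancy of the optimal gain\<close>

text \<open>Time 0 is excluded, so \<open>hit \<pi> u n u\<close> is a return probability and
  \<open>return_prob M \<pi> u\<close> is its supremum over \<open>n\<close>.\<close>

definition hit :: "('s \<Rightarrow> 'a) \<Rightarrow> 's \<Rightarrow> nat \<Rightarrow> 's \<Rightarrow> real" where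
  "hit \<pi> u n s = measure_pmf.prob (trajectory M \<pi> (Suc n) s) {\<omega>. \<exists>t\<in>{1..n}. \<omega> ! t = u}"

text \<open>First-step analysis. A walk whose next state is \<open>u\<close> has hit it with
  certainty, whereas \<open>hit \<pi> u n u\<close> would ask for a return; hence the case
  distinction inside the average.\<close>

lemma hit_Suc:
  assumes "\<pi> \<in> policies M" "s \<in> S"
  shows "hit \<pi> u (Suc n) s = av\<^sub>\<pi> \<pi> (\<lambda>t. if t = u then 1 else hit \<pi> u n t) s"
proof -
  interpret stochastic_matrix S "trans \<pi>" using stoch assms by blast
  have "measure_pmf.prob (trajectory M \<pi> (Suc n) v) {\<omega>. s # \<omega> \<in> {\<omega>. \<exists>t\<in>{1..Suc n}. \<omega> ! t = u}}
      = (if v = u then 1 else hit \<pi> u n v)" (is "measure_pmf.prob ?p ?X = _") if "v \<in> S" for v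
  proof -
    \<comment> \<open>Prepending \<open>s\<close> moves index \<open>t\<close> to
      \<open>t - 1\<close>, so the state at index 0 now counts as a hit.\<close>
    have X: "?X = {\<omega>. \<omega> ! 0 = u \<or> (\<exists>t\<in>{1..n}. \<omega> ! t = u)}"
    proof -
      have 1: "{1..Suc n} = Suc ` {0..n}" and 2: "{0..n} = insert 0 {1..n}"
        by (auto simp: image_Suc_atLeastAtMost)
      have "(\<exists>t\<in>Suc ` insert 0 {1..n}. Q t) \<longleftrightarrow> Q (Suc 0) \<or> (\<exists>t\<in>{1..n}. Q (Suc t))" for Q
        by blast
      thus ?thesis unfolding 1 2 by (simp only: mem_Collect_eq nth_Cons_Suc)
    qed
    show ?thesis
    proof (cases "v = u")
      case True
      have ae: "AE \<omega> in measure_pmf ?p. \<omega> \<in> ?X"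
        unfolding X AE_measure_pmf_iff using trajectory_hd True by auto
      have "measure_pmf.prob ?p ?X = 1"
        by (rule iffD2[OF measure_pmf.prob_eq_1]) (simp, rule ae)
      thus ?thesis using True by simp
    next
      case False
      have "?X \<inter> set_pmf ?p = {\<omega>. \<exists>t\<in>{1..n}. \<omega> ! t = u} \<inter> set_pmf ?p"
        unfolding X using trajectory_hd False by auto
      thus ?thesis using False unfolding hit_def by (metis (lifting) measure_Int_set_pmf)
    qed
  qed
  thus ?thesis
    unfolding hit_def[of _ _ "Suc n"] trajectory_prob_Suc[OF assms, of "Suc n"] av_def
    by (intro sum.cong) auto
qed

text \<open>Any state \<open>s\<close> of a minimal nonempty closed subset \<open>Y\<close> is
  recurrent. If some state of \<open>Y\<close> reached \<open>s\<close> with probability below 1,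
  the states with the smallest such probability would form a closed subset of \<open>Y\<close> that
  misses \<open>s\<close>, contradicting minimality.\<close>

lemma recurrent_state_exists:
  assumes \<pi>: "\<pi> \<in> policies M" and X: "closed\<^sub>\<pi> \<pi> X" "X \<noteq> {}"
  shows "\<exists>s\<in>X. \<not> transient M \<pi> s"
proof -
  interpret stochastic_matrix S "trans \<pi>" using stoch assms by blast
  have "finite {Y. closed_set Y \<and> Y \<noteq> {} \<and> Y \<subseteq> X}"
    by (rule finite_subset[of _ "Pow S"]) (auto simp: finS closed_set_def)
  moreover have "X \<in> {Y. closed_set Y \<and> Y \<noteq> {} \<and> Y \<subseteq> X}" using X by auto
  ultimately obtain Y where Y': "Y \<in> {Y. closed_set Y \<and> Y \<noteq> {} \<and> Y \<subseteq> X}"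
    and minY': "\<forall>Z\<in>{Y. closed_set Y \<and> Y \<noteq> {} \<and> Y \<subseteq> X}. Z \<subseteq> Y \<longrightarrow> Y = Z"
    using finite_has_minimal[of "{Y. closed_set Y \<and> Y \<noteq> {} \<and> Y \<subseteq> X}"] by (metis (lifting) empty_iff)
  have Y: "closed_set Y" "Y \<noteq> {}" "Y \<subseteq> X" using Y' by auto
  have minY: "Z = Y" if "closed_set Z" "Z \<noteq> {}" "Z \<subseteq> Y" for Z
    using minY' that Y(3) by blast
  have YS: "Y \<subseteq> S" using Y by (simp add: closed_set_def)
  obtain s where s: "s \<in> Y" using Y by blast
  define q where "q t = (SUP n. hit \<pi> s n t)" for t
  \<comment> \<open>With the value 1 put in at \<open>s\<close>, the equation
    \<open>q = av w\<close> holds on all of \<open>S\<close>, and \<open>w\<close> itself is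
    harmonic away from \<open>s\<close>.\<close>
  define w where "w t = (if t = s then 1 else q t)" for t
  have inc: "hit \<pi> s n t \<le> hit \<pi> s (Suc n) t" if "t \<in> S" for n t
    using that
  proof (induction n arbitrary: t)
    case (Suc n)
    thus ?case unfolding hit_Suc[OF \<pi> Suc.prems] by (intro av_mono) auto
  qed (simp add: hit_def del: trajectory.simps)
  have q: "(\<lambda>n. hit \<pi> s n t) \<longlonglongrightarrow> q t" if "t \<in> S" for t
    unfolding q_def
  proof (rule LIMSEQ_incseq_SUP)
    show "bdd_above (range (\<lambda>n. hit \<pi> s n t))" by (rule bdd_aboveI[of _ 1]) (auto simp: hit_def)
    show "incseq (\<lambda>n. hit \<pi> s n t)" by (rule incseq_SucI) (rule inc[OF that])
  qed
  have qav: "q t = av w t" if "t \<in> S" for t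
  proof -
    have "(\<lambda>n. hit \<pi> s (Suc n) t) \<longlonglongrightarrow> q t" using q[OF that] by (rule LIMSEQ_Suc)
    moreover have "(\<lambda>n. hit \<pi> s (Suc n) t) \<longlonglongrightarrow> av w t"
      unfolding hit_Suc[OF \<pi> that] av_def w_def by (intro tendsto_intros) (auto intro: q)
    ultimately show ?thesis by (rule LIMSEQ_unique)
  qed
  have finY: "finite Y" using YS finS finite_subset by auto
  define m where "m = Min (w ` Y)"
  have m: "m \<le> w t" if "t \<in> Y" for t using finY that by (simp add: m_def)
  have "m \<ge> 1"
  proof (rule ccontr)
    assume "\<not> m \<ge> 1"
    \<comment> \<open>Since \<open>m < 1 = w s\<close>, no minimizer equals \<open>s\<close>, so at
      minimizers \<open>w\<close> coincides with \<open>q = av w\<close>.\<close>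
    have "closed_set {t \<in> Y. w t = m}"
    proof (rule superharmonic_argmin_closed[OF Y(1) m])
      fix t assume "t \<in> Y" "w t = m"
      thus "av w t \<le> m" using qav[of t] YS \<open>\<not> m \<ge> 1\<close> by (auto simp: w_def split: if_splits)
    qed
    moreover have "m \<in> w ` Y" unfolding m_def using finY Y by (intro Min_in) auto
    hence "{t \<in> Y. w t = m} \<noteq> {}" by auto
    ultimately have "{t \<in> Y. w t = m} = Y" by (rule minY) auto
    hence "w s = m" using s by blast
    thus False using \<open>\<not> m \<ge> 1\<close> by (simp add: w_def)
  qed
  have "(\<Sum>t\<in>S. trans \<pi> s t * 1) \<le> av w s"
    unfolding av_def
  proof (rule sum_mono)
    fix t assume t: "t \<in> S"
    show "trans \<pi> s t * 1 \<le> trans \<pi> s t * w t"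
    proof (cases "trans \<pi> s t = 0")
      case False
      hence "0 < trans \<pi> s t" using P_nonneg[of s t] s YS t by auto
      hence "t \<in> Y" using Y(1) s t by (auto simp: closed_set_def)
      hence "1 \<le> w t" using m \<open>m \<ge> 1\<close> by force
      thus ?thesis using \<open>0 < trans \<pi> s t\<close> by simp
    qed simp
  qed
  hence "1 \<le> q s" using P_sum[of s] qav[of s] s YS by auto
  hence "\<not> transient M \<pi> s" by (simp add: transient_def return_prob_def q_def hit_def del: trajectory.simps)
  thus ?thesis using s Y by blast
qed

section \<open>Reachability in the graph of all possible transitions\<close>

definition edges :: "('s \<times> 's) set" where
  "edges = {(s, t). s \<in> S \<and> t \<in> S \<and> (\<exists>a\<in>A. 0 < pmf (kernel M s a) t)}"

text \<open>Paths in \<open>edges\<close> can be concatenated even when they come from different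
  policies; this is why accessibility is weakened to a path.\<close>

lemma accessible_path:
  assumes "\<pi> \<in> policies M" "s \<in> S" "accessible M \<pi> s t"
  shows "(s, t) \<in> edges\<^sup>*"
proof -
  have "0 < measure_pmf.prob (trajectory M \<pi> (Suc n) s) {\<omega>. \<omega> ! n = t} \<Longrightarrow> (s, t) \<in> edges\<^sup>*" for n
    using assms(2)
  proof (induction n arbitrary: s)
    case 0
    hence "set_pmf (trajectory M \<pi> 1 s) \<inter> {\<omega>. \<omega> ! 0 = t} \<noteq> {}"
      by (metis One_nat_def less_irrefl measure_Int_set_pmf inf_commute measure_empty)
    thus ?case using trajectory_hd by fastforce
  next
    case (Suc n)
    have "0 < (\<Sum>u\<in>S. trans \<pi> s u * measure_pmf.prob (trajectory M \<pi> (Suc n) u) {\<omega>. \<omega> ! n = t})"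
      using Suc.prems(1) unfolding trajectory_prob_Suc[OF assms(1) Suc.prems(2), of "Suc n"] by simp
    then obtain u where u: "u \<in> S"
      "0 < trans \<pi> s u * measure_pmf.prob (trajectory M \<pi> (Suc n) u) {\<omega>. \<omega> ! n = t}"
      by (meson sum_nonpos not_less)
    hence "0 < trans \<pi> s u" "0 < measure_pmf.prob (trajectory M \<pi> (Suc n) u) {\<omega>. \<omega> ! n = t}"
      by (auto simp: zero_less_mult_iff trans_def)
    hence "(s, u) \<in> edges" "(u, t) \<in> edges\<^sup>*"
      using Suc.IH u Suc.prems(2) policy_mem[OF assms(1)] by (auto simp: edges_def trans_def)
    thus ?case by simp
  qed
  thus ?thesis using assms(3) by (auto simp: accessible_def)
qed

text \<open>\<open>D\<close> is the graph distance to \<open>X\<close>. Outside \<open>X\<close> the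
  new policy plays an action that starts a shortest path, so the distance drops with positive
  probability in one step.\<close>

lemma approaching_policy:
  assumes \<pi>: "\<pi> \<in> policies M" and path: "\<And>s. s \<in> S \<Longrightarrow> \<exists>x\<in>X. (s, x) \<in> edges\<^sup>*"
  obtains \<pi>' D where "\<pi>' \<in> policies M" "\<And>s. s \<in> X \<Longrightarrow> \<pi>' s = \<pi> s"
    "\<And>s. s \<in> S \<Longrightarrow> s \<notin> X \<Longrightarrow> \<exists>t\<in>S. 0 < trans \<pi>' s t \<and> D t < (D s :: nat)"
proof -
  define D where "D s = (LEAST n. \<exists>x\<in>X. (s, x) \<in> edges ^^ n)" for s
  have "\<exists>a\<in>A. \<exists>t\<in>S. 0 < pmf (kernel M s a) t \<and> D t < D s" if s: "s \<in> S" "s \<notin> X" for s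
  proof -
    obtain x n where "x \<in> X" "(s, x) \<in> edges ^^ n"
      using path[OF s(1)] by (auto simp: rtrancl_power)
    hence "\<exists>n. \<exists>x\<in>X. (s, x) \<in> edges ^^ n" by blast
    hence "\<exists>x\<in>X. (s, x) \<in> edges ^^ D s" unfolding D_def by (rule LeastI_ex)
    then obtain x where x: "x \<in> X" "(s, x) \<in> edges ^^ D s" by blast
    then obtain k where k: "D s = Suc k" using s(2) by (cases "D s") auto
    then obtain t where t: "(s, t) \<in> edges" "(t, x) \<in> edges ^^ k"
      using relpow_Suc_D2[of s x k edges] x(2) by auto
    have "D t \<le> k" unfolding D_def by (rule Least_le) (use t x in blast)
    moreover obtain a where "t \<in> S" "a \<in> A" "0 < pmf (kernel M s a) t"
      using t(1) by (auto simp: edges_def)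
    ultimately show ?thesis using k by (intro bexI[of _ a] bexI[of _ t]) auto
  qed
  then obtain f where f: "\<And>s. s \<in> S \<Longrightarrow> s \<notin> X \<Longrightarrow>
      f s \<in> A \<and> (\<exists>t\<in>S. 0 < pmf (kernel M s (f s)) t \<and> D t < D s)" by metis
  define \<pi>' where "\<pi>' s = (if s \<in> X \<or> s \<notin> S then \<pi> s else f s)" for s
  have "\<pi>' \<in> policies M" using \<pi> f by (auto simp: policies_def \<pi>'_def PiE_def extensional_def)
  thus ?thesis using f by (intro that[of \<pi>' D]) (auto simp: \<pi>'_def trans_def)
qed

text \<open>The set of states reachable from \<open>s\<close> is closed under every policy, in
  particular under \<open>\<pi>\<close>. Every nonempty \<open>\<pi>\<close>-closed set contains a
  state that is not transient under \<open>\<pi>\<close>, hence one of the communicating set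
  \<open>C\<close>. So the reachable set and \<open>X\<close> both meet \<open>C\<close>, inside
  which everything is connected.\<close>

lemma recurrent_reachable:
  assumes wc: "weakly_communicating M" and \<pi>: "\<pi> \<in> policies M"
    and X: "closed\<^sub>\<pi> \<pi> X" "X \<noteq> {}" and s: "s \<in> S"
  shows "\<exists>x\<in>X. (s, x) \<in> edges\<^sup>*"
proof -
  interpret stochastic_matrix S "trans \<pi>" using stoch \<pi> by blast
  obtain C where C: "C \<subseteq> S" "\<And>s t. s \<in> C \<Longrightarrow> t \<in> C \<Longrightarrow> \<exists>\<pi>\<in>policies M. accessible M \<pi> s t"
    "\<And>s \<pi>. s \<in> S - C \<Longrightarrow> \<pi> \<in> policies M \<Longrightarrow> transient M \<pi> s"
    using wc unfolding weakly_communicating_def by metis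
  have ex: "\<exists>x\<in>Y. x \<in> C" if "closed_set Y" "Y \<noteq> {}" for Y
  proof -
    from recurrent_state_exists[OF \<pi> that] obtain x where x: "x \<in> Y" "\<not> transient M \<pi> x" by blast
    moreover have "x \<in> S" using x that by (auto simp: closed_set_def)
    ultimately show ?thesis using C(3)[OF _ \<pi>] by blast
  qed
  let ?Y = "{t. (s, t) \<in> edges\<^sup>*}"
  have "(s, t) \<in> edges\<^sup>* \<Longrightarrow> t \<in> S" for t
    by (induction rule: rtrancl_induct) (auto simp: s edges_def)
  hence YS: "t \<in> S" if "t \<in> ?Y" for t using that by blast
  have "closed_set ?Y"
    unfolding closed_set_def
  proof safe
    fix t u assume t: "(s, t) \<in> edges\<^sup>*" "u \<in> S" "0 < trans \<pi> t u"
    have "t \<in> S" using YS t(1) by blast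
    with t(2,3) policy_mem[OF \<pi> this] have "(t, u) \<in> edges"
      unfolding edges_def trans_def by blast
    with t(1) show "(s, u) \<in> edges\<^sup>*" by (rule rtrancl_into_rtrancl)
  qed (use YS in auto)
  moreover have "?Y \<noteq> {}" by blast
  ultimately obtain y where y: "(s, y) \<in> edges\<^sup>*" "y \<in> C" using ex by blast
  obtain x where x: "x \<in> X" "x \<in> C" using ex X by blast
  have "(y, x) \<in> edges\<^sup>*" using C(1) C(2)[OF y(2) x(2)] accessible_path y(2) by blast
  from rtrancl_trans[OF y(1) this] x(1) show ?thesis by blast
qed

text \<open>Let \<open>\<pi>\<close> attain the largest optimal gain \<open>G\<close> at some state.
  The set \<open>X\<close> where its gain equals \<open>G\<close> is closed under
  \<open>\<pi>\<close>. Let \<open>\<pi>'\<close> follow \<open>\<pi>\<close> on \<open>X\<close>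
  and approach \<open>X\<close> elsewhere. The states of least gain under \<open>\<pi>'\<close> form
  a set closed under \<open>\<pi>'\<close>; its member closest to \<open>X\<close> must lie in
  \<open>X\<close>, as otherwise some successor would be closer still. Hence the least gain of
  \<open>\<pi>'\<close> is already \<open>G\<close>.\<close>

theorem opt_gain_constant:
  assumes wc: "weakly_communicating M" and s: "s \<in> S" "s' \<in> S"
  shows "opt_gain M s = opt_gain M s'"
proof -
  define G where "G = Max (opt_gain M ` S)"
  have G: "opt_gain M t \<le> G" if "t \<in> S" for t using that finS by (simp add: G_def)
  have "G \<in> opt_gain M ` S" unfolding G_def by (intro Max_in) (use finS neS in auto)
  then obtain s0 where s0: "s0 \<in> S" "opt_gain M s0 = G" by auto
  obtain \<pi> where \<pi>: "\<pi> \<in> policies M" "opt_gain M s0 = gain M \<pi> s0" by (rule opt_gain_attained)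
  interpret p: stochastic_matrix S "trans \<pi>" using stoch \<pi> by blast
  define X where "X = {t \<in> S. gain M \<pi> t = G}"
  \<comment> \<open>The maximum principle is obtained from the minimum principle for the negated
    gain, written with \<open>- 1 *\<close> so that \<open>av_cmult\<close> applies.\<close>
  have "p.closed_set {t \<in> S. - 1 * gain M \<pi> t = - G}"
  proof (rule p.superharmonic_argmin_closed)
    show "p.closed_set S" by (simp add: p.closed_set_def)
    show "- G \<le> - 1 * gain M \<pi> t" if "t \<in> S" for t
      using gain_le_opt_gain[OF \<pi>(1), of t] G[OF that] by simp
    show "p.av (\<lambda>t. - 1 * gain M \<pi> t) t \<le> - G" if "t \<in> S" "- 1 * gain M \<pi> t = - G" for t
      unfolding p.av_cmult using gain_limit(2)[OF \<pi>(1) that(1)] that(2) by simp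
  qed
  hence X: "p.closed_set X" by (simp add: X_def)
  have X0: "X \<noteq> {}" using s0 \<pi> by (auto simp: X_def)
  have path: "\<exists>x\<in>X. (t, x) \<in> edges\<^sup>*" if "t \<in> S" for t
    using recurrent_reachable[OF wc \<pi>(1) X X0 that] .
  obtain \<pi>' D where \<pi>': "\<pi>' \<in> policies M"
    and onX: "\<And>s. s \<in> X \<Longrightarrow> \<pi>' s = \<pi> s"
    and dec: "\<And>s. s \<in> S \<Longrightarrow> s \<notin> X \<Longrightarrow> \<exists>t\<in>S. 0 < trans \<pi>' s t \<and> D t < (D s :: nat)"
    by (rule approaching_policy[OF \<pi>(1)], erule path, rule that)
  interpret p': stochastic_matrix S "trans \<pi>'" using stoch \<pi>' by blast
  \<comment> \<open>A walk that starts in \<open>X\<close> never leaves it, and there the two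
    policies act alike.\<close>
  have same: "(p'.av ^^ n) (rew\<^sub>\<pi> \<pi>') t = (p.av ^^ n) (rew\<^sub>\<pi> \<pi>) t" if "t \<in> X" for n t
    using that
  proof (induction n arbitrary: t)
    case 0
    thus ?case using onX by simp
  next
    case (Suc n)
    have tr: "trans \<pi>' t = trans \<pi> t" using onX[OF Suc.prems] by (auto simp: trans_def)
    have "trans \<pi> t u * (p'.av ^^ n) (rew\<^sub>\<pi> \<pi>') u = trans \<pi> t u * (p.av ^^ n) (rew\<^sub>\<pi> \<pi>) u"
      if u: "u \<in> S" for u
    proof (cases "trans \<pi> t u = 0")
      case False
      hence "0 < trans \<pi> t u" by (simp add: trans_def pmf_pos)
      hence "u \<in> X" using X Suc.prems u by (auto simp: p.closed_set_def)
      thus ?thesis using Suc.IH by simp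
    qed simp
    hence "p'.av ((p'.av ^^ n) (rew\<^sub>\<pi> \<pi>')) t = p.av ((p.av ^^ n) (rew\<^sub>\<pi> \<pi>)) t"
      unfolding p'.av_def[of _ t] p.av_def[of _ t] tr by (rule sum.cong[OF refl])
    thus ?case by simp
  qed
  have gX: "gain M \<pi>' t = G" if t: "t \<in> X" for t
  proof -
    have tS: "t \<in> S" using t by (simp add: X_def)
    have "p'.cesaro n (rew\<^sub>\<pi> \<pi>') t = p.cesaro n (rew\<^sub>\<pi> \<pi>) t" for n
      by (simp add: p'.cesaro_def p.cesaro_def same[OF t])
    hence "(\<lambda>n. p.cesaro n (rew\<^sub>\<pi> \<pi>) t) \<longlonglongrightarrow> gain M \<pi>' t"
      using gain_limit(1)[OF \<pi>' tS] by simp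
    from LIMSEQ_unique[OF this gain_limit(1)[OF \<pi>(1) tS]] have "gain M \<pi>' t = gain M \<pi> t" .
    thus ?thesis using t by (simp add: X_def)
  qed
  define m where "m = Min (gain M \<pi>' ` S)"
  define Z where "Z = {t \<in> S. gain M \<pi>' t = m}"
  have m: "m \<le> gain M \<pi>' t" if "t \<in> S" for t using that finS by (simp add: m_def)
  have Z: "p'.closed_set Z"
    unfolding Z_def
  proof (rule p'.superharmonic_argmin_closed[OF _ m])
    show "p'.closed_set S" by (simp add: p'.closed_set_def)
    show "p'.av (gain M \<pi>') t \<le> m" if "t \<in> S" "gain M \<pi>' t = m" for t
      using gain_limit(2)[OF \<pi>' that(1)] that(2) by simp
  qed
  have "m \<in> gain M \<pi>' ` S" unfolding m_def by (intro Min_in) (use finS neS in auto)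
  hence "Z \<noteq> {}" by (auto simp: Z_def)
  then obtain z0 where "z0 \<in> Z" by blast
  from ex_has_least_nat[of "\<lambda>z. z \<in> Z", OF this, of D]
  obtain z where z: "z \<in> Z" "\<And>y. y \<in> Z \<Longrightarrow> D z \<le> D y" by blast
  have "z \<in> X"
  proof (rule ccontr)
    assume "z \<notin> X"
    then obtain t where "t \<in> S" "0 < trans \<pi>' z t" "D t < D z"
      using dec[of z] z(1) by (auto simp: Z_def)
    moreover from this have "t \<in> Z" using Z z(1) by (auto simp: p'.closed_set_def)
    ultimately show False using z(2) by force
  qed
  hence "m = G" using gX z(1) by (auto simp: Z_def)
  hence "opt_gain M t = G" if "t \<in> S" for t
    using m[OF that] G[OF that] gain_le_opt_gain[OF \<pi>', of t] by simp
  thus ?thesis using s by simp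
qed

end

section \<open>The Bellman operator and greedy policies\<close>

context fin_mdp
begin

abbreviation "SA \<equiv> state_actions M"

definition kop :: "('s \<Rightarrow> real) \<Rightarrow> ('s, 'a) qfun" where
  "kop h = (\<lambda>(s, a). \<Sum>t\<in>S. pmf (kernel M s a) t * h t)"

lemma bellman_op_kop: "bellman_op M Q z = reward M z + kop (max_act M Q) z"
  by (simp add: bellman_op_def kop_def split: prod.splits)

lemma kop_add: "kop (\<lambda>t. f t + g t) z = kop f z + kop g z"
  by (simp add: kop_def split_beta sum.distrib distrib_left)

lemma kop_diff: "kop (\<lambda>t. f t - g t) z = kop f z - kop g z"
  by (simp add: kop_def split_beta sum_subtractf right_diff_distrib)

lemma kop_const: "z \<in> SA \<Longrightarrow> kop (\<lambda>_. c) z = c"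
  by (auto simp: kop_def sum_kernel simp flip: sum_distrib_right)

lemma kop_mono: "(\<And>t. t \<in> S \<Longrightarrow> f t \<le> g t) \<Longrightarrow> kop f z \<le> kop g z"
  by (auto simp: kop_def split_beta intro!: sum_mono mult_left_mono)

lemma sp_kop_le: "sp SA (kop d) \<le> sp S d"
proof (rule sp_leI[OF finSA neSA])
  fix y z assume yz: "y \<in> SA" "z \<in> SA"
  have "kop d y \<le> kop (\<lambda>_. Max (d ` S)) y" "kop (\<lambda>_. Min (d ` S)) z \<le> kop d z"
    using finS by (auto intro!: kop_mono)
  thus "kop d y - kop d z \<le> sp S d" using yz by (simp add: kop_const sp_def)
qed

lemma max_act_ge: "a \<in> A \<Longrightarrow> Q (s, a) \<le> max_act M Q s"
  unfolding max_act_def using finA by auto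

lemma max_act_attained: obtains a where "a \<in> A" "max_act M Q s = Q (s, a)"
proof -
  have "max_act M Q s \<in> (\<lambda>a. Q (s, a)) ` A"
    unfolding max_act_def using finA neA by (intro Max_in) auto
  thus ?thesis using that by auto
qed

lemma sp_max_act_diff_le:
  "sp S (\<lambda>s. max_act M Q s - max_act M Q' s) \<le> sp SA (\<lambda>z. Q z - Q' z)"
proof (rule sp_leI[OF finS neS])
  fix s t assume st: "s \<in> S" "t \<in> S"
  obtain a where a: "a \<in> A" "max_act M Q s = Q (s, a)" by (rule max_act_attained)
  obtain b where b: "b \<in> A" "max_act M Q' t = Q' (t, b)" by (rule max_act_attained)
  have "(Q (s, a) - Q' (s, a)) - (Q (t, b) - Q' (t, b)) \<le> sp SA (\<lambda>z. Q z - Q' z)"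
    by (rule sp_ge[OF finSA]) (use st a b in auto)
  thus "max_act M Q s - max_act M Q' s - (max_act M Q t - max_act M Q' t)
      \<le> sp SA (\<lambda>z. Q z - Q' z)"
    using a b max_act_ge[OF a(1), of Q' s] max_act_ge[OF b(1), of Q t] by linarith
qed

lemma sp_bellman_diff_le:
  "sp SA (\<lambda>z. bellman_op M Q z - bellman_op M Q' z) \<le> sp SA (\<lambda>z. Q z - Q' z)"
proof -
  have "(\<lambda>z. bellman_op M Q z - bellman_op M Q' z)
      = kop (\<lambda>s. max_act M Q s - max_act M Q' s)"
    by (simp add: fun_eq_iff bellman_op_kop kop_diff)
  thus ?thesis using order_trans[OF sp_kop_le sp_max_act_diff_le] by simp
qed

text \<open>The witness minimizes \<open>Q - Qs\<close>. With \<open>m\<close> the minimum,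
  \<open>Q\<close> dominates \<open>Qs + m\<close> and agrees with it at the witness, so
  monotonicity of the Bellman operator gives a residual there of at least that of \<open>Qs\<close>,
  which is \<open>g\<close>.\<close>

lemma bellman_residual_ge_gain:
  assumes "\<And>z. z \<in> SA \<Longrightarrow> Qs z = bellman_op M Qs z - g"
  obtains z where "z \<in> SA" "g \<le> bellman_op M Q z - Q z"
proof -
  define m where "m = Min ((\<lambda>z. Q z - Qs z) ` SA)"
  have "m \<in> (\<lambda>z. Q z - Qs z) ` SA" unfolding m_def by (intro Min_in) (use finSA neSA in auto)
  then obtain z where z: "z \<in> SA" "Q z - Qs z = m" by auto
  have m: "m \<le> Q y - Qs y" if "y \<in> SA" for y using that finSA by (simp add: m_def)
  have "kop (\<lambda>t. max_act M Qs t + m) z \<le> kop (max_act M Q) z"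
  proof (rule kop_mono)
    fix t assume t: "t \<in> S"
    obtain a where a: "a \<in> A" "max_act M Qs t = Qs (t, a)" by (rule max_act_attained)
    thus "max_act M Qs t + m \<le> max_act M Q t"
      using m[of "(t, a)"] max_act_ge[OF a(1), of Q t] t by auto
  qed
  hence "kop (max_act M Qs) z + m \<le> kop (max_act M Q) z"
    using z(1) by (simp add: kop_add kop_const)
  hence "g \<le> bellman_op M Q z - Q z"
    using z assms[OF z(1)] by (simp add: bellman_op_kop)
  thus ?thesis using z(1) that by blast
qed

text \<open>Along a greedy policy \<open>max_act M Q\<close> is the value of \<open>Q\<close> at the
  action played. Taken as potential in \<open>gain_ge\<close>, it turns the smallest Bellman
  residual into a lower bound for the gain.\<close>

lemma greedy_gain_ge:
  assumes "\<pi> \<in> greedy M Q" "s \<in> S"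
  obtains z where "z \<in> SA" "bellman_op M Q z - Q z \<le> gain M \<pi> s"
proof -
  have \<pi>: "\<pi> \<in> policies M" using assms by (simp add: greedy_def)
  interpret stochastic_matrix S "trans \<pi>" using stoch \<pi> by blast
  define c where "c = Min ((\<lambda>z. bellman_op M Q z - Q z) ` SA)"
  have "c \<in> (\<lambda>z. bellman_op M Q z - Q z) ` SA"
    unfolding c_def by (intro Min_in) (use finSA neSA in auto)
  then obtain z where z: "z \<in> SA" "bellman_op M Q z - Q z = c" by auto
  have "c \<le> gain M \<pi> s"
  proof (rule gain_ge[OF \<pi> assms(2)])
    fix t assume t: "t \<in> S"
    have \<pi>t: "\<pi> t \<in> A" using policy_mem[OF \<pi> t] .
    have "max_act M Q t \<le> Q (t, \<pi> t)"
      unfolding max_act_def using finA neA assms t by (auto simp: greedy_def)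
    hence "max_act M Q t = Q (t, \<pi> t)" using max_act_ge[OF \<pi>t, of Q t] by simp
    moreover have "c \<le> bellman_op M Q (t, \<pi> t) - Q (t, \<pi> t)"
      unfolding c_def using finSA t \<pi>t by (intro Min_le) auto
    moreover have "kop (max_act M Q) (t, \<pi> t) = av (max_act M Q) t"
      by (simp add: kop_def av_def trans_def)
    ultimately show "c \<le> reward M (t, \<pi> t) + av (max_act M Q) t - max_act M Q t"
      by (simp add: bellman_op_kop)
  qed
  thus ?thesis using z that by blast
qed

lemma greedy_gap_le:
  assumes "weakly_communicating M" "bellman_solution M Qs" "\<pi> \<in> greedy M Q" "s \<in> S"
  shows "opt_gain M s - gain M \<pi> s \<le> sp SA (\<lambda>z. bellman_op M Q z - Q z)"
proof -
  \<comment> \<open>The equation at \<open>z\<close> carries the optimal gain of the state of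
    \<open>z\<close>; constancy replaces it by the one at \<open>s\<close>.\<close>
  have "Qs z = bellman_op M Qs z - opt_gain M s" if "z \<in> SA" for z
    using that assms(2) opt_gain_constant[OF assms(1), of "fst z" s] assms(4)
    by (auto simp: bellman_solution_def)
  then obtain y where y: "y \<in> SA" "opt_gain M s \<le> bellman_op M Q y - Q y"
    using bellman_residual_ge_gain by metis
  obtain z where z: "z \<in> SA" "bellman_op M Q z - Q z \<le> gain M \<pi> s"
    using greedy_gain_ge[OF assms(3,4)] .
  show ?thesis using sp_ge[OF finSA y(1) z(1), of "\<lambda>z. bellman_op M Q z - Q z"] y(2) z(2) by simp
qed

end

section \<open>Concentration of the sampled averages\<close>

text \<open>Hoeffding's lemma for \<open>l\<close> of either sign, the negative case through
  \<open>- f\<close>. Nonnegative integrals let such bounds be chained without integrability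
  conditions.\<close>

lemma nn_integral_exp_pmf_le:
  fixes p :: "'b pmf" and f :: "'b \<Rightarrow> real"
  assumes "\<And>x. x \<in> set_pmf p \<Longrightarrow> a \<le> f x \<and> f x \<le> b"
  shows "(\<integral>\<^sup>+x. ennreal (exp (l * (f x - measure_pmf.expectation p f))) \<partial>measure_pmf p)
    \<le> ennreal (exp (l\<^sup>2 * (b - a)\<^sup>2 / 8))"
proof -
  consider "l > 0" | "l = 0" | "l < 0" by linarith
  thus ?thesis
  proof cases
    case 1
    interpret interval_bounded_random_variable "measure_pmf p" f a b
      by unfold_locales (use assms in \<open>auto simp: AE_measure_pmf_iff\<close>)
    show ?thesis by (rule Hoeffdings_lemma_nn_integral[OF 1])
  next
    case 2
    thus ?thesis by simp
  next
    case 3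
    interpret interval_bounded_random_variable "measure_pmf p" "\<lambda>x. - f x" "- b" "- a"
      by unfold_locales (use assms in \<open>auto simp: AE_measure_pmf_iff\<close>)
    show ?thesis using Hoeffdings_lemma_nn_integral[of "- l"] 3 by (simp add: algebra_simps)
  qed
qed

lemma nn_integral_exp_sum_replicate_pmf:
  fixes f :: "'b \<Rightarrow> real"
  shows "(\<integral>\<^sup>+xs. ennreal (exp (\<Sum>x\<leftarrow>xs. f x)) \<partial>measure_pmf (replicate_pmf m p))
    = (\<integral>\<^sup>+x. ennreal (exp (f x)) \<partial>measure_pmf p) ^ m"
proof (induction m)
  case (Suc m)
  show ?case
    by (simp add: exp_add ennreal_mult nn_integral_cmult nn_integral_multc Suc mult.commute)
qed simp

context fin_mdp
begin

lemma sample_component: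
  assumes "(s, a) \<in> SA"
  shows "map_pmf (\<lambda>D. D (s, a)) (sample M d m)
    = map_pmf (\<lambda>xs. 1 / real m * (\<Sum>x\<leftarrow>xs. d x)) (replicate_pmf m (kernel M s a))"
  unfolding sample_def using assms finSA by (subst Pi_pmf_component) auto

lemma sample_bounds:
  assumes D: "D \<in> set_pmf (sample M d m)" and z: "z \<in> SA" and m: "m \<ge> 1"
  shows "Min (d ` S) \<le> D z" "D z \<le> Max (d ` S)"
proof -
  obtain s a where sa: "z = (s, a)" by (cases z)
  have "D z \<in> set_pmf (map_pmf (\<lambda>D. D (s, a)) (sample M d m))" using D sa by auto
  then obtain xs where xs: "D z = 1 / real m * (\<Sum>x\<leftarrow>xs. d x)" "set xs \<subseteq> set_pmf (kernel M s a)"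
    "length xs = m"
    using z unfolding sa by (subst (asm) sample_component) (auto simp: set_replicate_pmf)
  have "set xs \<subseteq> S" using xs ker z sa by fastforce
  hence le: "\<And>x. x \<in> set xs \<Longrightarrow> Min (d ` S) \<le> d x" "\<And>x. x \<in> set xs \<Longrightarrow> d x \<le> Max (d ` S)"
    using finS by auto
  have "(\<Sum>x\<leftarrow>xs. d x) \<le> (\<Sum>x\<leftarrow>xs. Max (d ` S))" "(\<Sum>x\<leftarrow>xs. Min (d ` S)) \<le> (\<Sum>x\<leftarrow>xs. d x)"
    by (intro sum_list_mono le; assumption)+
  moreover have "(\<Sum>x\<leftarrow>xs. d x) = real m * D z" using xs(1) m by simp
  ultimately have "real m * Min (d ` S) \<le> real m * D z" "real m * D z \<le> real m * Max (d ` S)"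
    using xs(3) by (auto simp: sum_list_triv)
  thus "Min (d ` S) \<le> D z" "D z \<le> Max (d ` S)" using m by auto
qed

lemma sp_sample_le:
  assumes "D \<in> set_pmf (sample M d m)" "m \<ge> 1"
  shows "sp SA D \<le> sp S d"
proof (rule sp_leI[OF finSA neSA])
  fix y z assume "y \<in> SA" "z \<in> SA"
  thus "D y - D z \<le> sp S d" using sample_bounds[OF assms(1) _ assms(2)] by (smt (verit) sp_def)
qed

text \<open>The average of \<open>m\<close> independent samples factors into \<open>m\<close>
  exponential moments with parameter \<open>l / m\<close>. Their exponents add up to
  \<open>m * (l / m)^2\<close>, so the variance proxy shrinks by the factor
  \<open>m\<close>.\<close>

lemma nn_integral_exp_sample_le:
  assumes z: "z \<in> SA" and m: "m \<ge> 1"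
  shows "(\<integral>\<^sup>+D. ennreal (exp (l * (D z - kop d z))) \<partial>measure_pmf (sample M d m))
    \<le> ennreal (exp (l\<^sup>2 * ((sp S d)\<^sup>2 / real m) / 8))"
proof -
  obtain s a where sa: "z = (s, a)" by (cases z)
  let ?p = "kernel M s a"
  have p: "set_pmf ?p \<subseteq> S" using ker z sa by auto
  have \<mu>: "measure_pmf.expectation ?p d = kop d z"
    by (subst integral_measure_pmf[OF finS]) (use p in \<open>auto simp: sa kop_def\<close>)
  have "(\<integral>\<^sup>+D. ennreal (exp (l * (D z - kop d z))) \<partial>measure_pmf (sample M d m))
      = (\<integral>\<^sup>+y. ennreal (exp (l * (y - kop d z))) \<partial>measure_pmf (map_pmf (\<lambda>D. D (s, a)) (sample M d m)))"
    by (simp add: sa)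
  also have "\<dots> = (\<integral>\<^sup>+xs. ennreal (exp (l * (1 / real m * (\<Sum>x\<leftarrow>xs. d x) - kop d z)))
      \<partial>measure_pmf (replicate_pmf m ?p))"
    using z sa by (subst sample_component) auto
  also have "\<dots> = (\<integral>\<^sup>+xs. ennreal (exp (\<Sum>x\<leftarrow>xs. l / real m * (d x - kop d z)))
      \<partial>measure_pmf (replicate_pmf m ?p))"
  proof (intro nn_integral_cong_AE AE_pmfI)
    fix xs assume "xs \<in> set_pmf (replicate_pmf m ?p)"
    hence "length xs = m" by (simp add: set_replicate_pmf)
    hence "l * (1 / real m * (\<Sum>x\<leftarrow>xs. d x) - kop d z) = (\<Sum>x\<leftarrow>xs. l / real m * (d x - kop d z))"
    proof -
      have "(\<Sum>x\<leftarrow>ys. k * (d x - \<mu>)) = k * ((\<Sum>x\<leftarrow>ys. d x) - real (length ys) * \<mu>)" for ys k \<mu>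
        by (induction ys) (auto simp: algebra_simps)
      from this[of "l / real m" "kop d z" xs] show ?thesis
        using m \<open>length xs = m\<close> by (simp add: field_simps)
    qed
    thus "ennreal (exp (l * (1 / real m * (\<Sum>x\<leftarrow>xs. d x) - kop d z)))
        = ennreal (exp (\<Sum>x\<leftarrow>xs. l / real m * (d x - kop d z)))" by simp
  qed
  also have "\<dots> = (\<integral>\<^sup>+x. ennreal (exp (l / real m * (d x - kop d z))) \<partial>measure_pmf ?p) ^ m"
    by (rule nn_integral_exp_sum_replicate_pmf)
  also have "\<dots> \<le> ennreal (exp ((l / real m)\<^sup>2 * (Max (d ` S) - Min (d ` S))\<^sup>2 / 8)) ^ m"
    unfolding \<mu>[symmetric]
    by (intro power_mono nn_integral_exp_pmf_le) (use p finS in auto)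
  also have "\<dots> = ennreal (exp (l\<^sup>2 * ((sp S d)\<^sup>2 / real m) / 8))"
    using m by (simp add: ennreal_power sp_def power_divide power2_eq_square flip: exp_of_nat_mult)
  finally show ?thesis .
qed

end

section \<open>One run of SAVIA\<close>

locale savia_run = fin_mdp M for M :: "('s, 'a) mdp" +
  fixes c :: "nat \<Rightarrow> real" and \<alpha> \<epsilon> :: real
  assumes \<epsilon>: "0 < \<epsilon>" and \<alpha>: "0 < \<alpha>" and c: "0 < c k"
    and reward: "s \<in> states M \<Longrightarrow> a \<in> actions M \<Longrightarrow> 0 \<le> reward M (s, a) \<and> reward M (s, a) \<le> 1"
begin

definition \<beta> :: "nat \<Rightarrow> real" where "\<beta> k = real k / (real k + 2)"

abbreviation "step \<equiv> savia_step M c \<beta> (\<lambda>_. 0) \<alpha> \<epsilon>"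
abbreviation "loop \<equiv> savia_loop M c \<beta> (\<lambda>_. 0) \<alpha> \<epsilon>"

abbreviation "cSA \<equiv> real (card S) * real (card A)"

lemma \<beta>_bounds: "0 \<le> \<beta> k" "\<beta> k \<le> 1"
  by (auto simp: \<beta>_def)

lemma \<beta>_Suc_diff: "\<beta> (Suc k) - \<beta> k = 2 / ((real k + 2) * (real k + 3))"
  by (simp add: \<beta>_def divide_simps) (simp add: algebra_simps)

lemma step_eq:
  "step k x = map_pmf (\<lambda>D. \<lparr>lq = (\<lambda>z. \<beta> k * lt x z), lt = (\<lambda>z. lt x z + D z),
      lh = max_act M (\<lambda>z. \<beta> k * lt x z), lsamples = lsamples x + card S * card A *
        batch_size M \<alpha> (c k) \<epsilon> (\<lambda>s. max_act M (\<lambda>z. \<beta> k * lt x z) s - lh x s)\<rparr>)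
    (sample M (\<lambda>s. max_act M (\<lambda>z. \<beta> k * lt x z) s - lh x s)
      (batch_size M \<alpha> (c k) \<epsilon> (\<lambda>s. max_act M (\<lambda>z. \<beta> k * lt x z) s - lh x s)))"
proof -
  \<comment> \<open>\<open>\<beta> 0 = 0\<close>, so the separate treatment of iteration 0
    disappears.\<close>
  have "(if k = 0 then 0 else \<beta> k) = \<beta> k" by (simp add: \<beta>_def)
  thus ?thesis unfolding savia_step_def Let_def map_pmf_def by simp
qed

lemma batch_size_ge_1: "batch_size M \<alpha> ck e d \<ge> 1"
  by (simp add: batch_size_def)

lemma batch_size_ge: "\<alpha> * c k * (sp S d)\<^sup>2 / \<epsilon>\<^sup>2 \<le> real (batch_size M \<alpha> (c k) \<epsilon> d)"
proof -
  have "\<alpha> * c k * (sp S d)\<^sup>2 / \<epsilon>\<^sup>2 \<le> real (nat \<lceil>\<alpha> * c k * (sp S d)\<^sup>2 / \<epsilon>\<^sup>2\<rceil>)" by linarith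
  also have "\<dots> \<le> real (batch_size M \<alpha> (c k) \<epsilon> d)" unfolding batch_size_def by simp
  finally show ?thesis .
qed

lemma batch_size_le:
  assumes "sp S d \<le> e"
  shows "real (batch_size M \<alpha> (c k) \<epsilon> d) \<le> \<alpha> * c k * e\<^sup>2 / \<epsilon>\<^sup>2 + 1"
proof -
  have "0 \<le> sp S d" using sp_nonneg finS neS by blast
  hence "\<alpha> * c k * (sp S d)\<^sup>2 / \<epsilon>\<^sup>2 \<le> \<alpha> * c k * e\<^sup>2 / \<epsilon>\<^sup>2"
    using assms \<epsilon> \<alpha> c[of k] by (intro divide_right_mono mult_left_mono power_mono) auto
  moreover have "0 \<le> \<alpha> * c k * (sp S d)\<^sup>2 / \<epsilon>\<^sup>2" using \<alpha> c[of k] by simp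
  ultimately show ?thesis unfolding batch_size_def
    by (auto simp: of_nat_max intro!: max.boundedI) linarith+
qed

text \<open>The error \<open>T\<^sup>k - \<T>(Q\<^sup>k)\<close>.\<close>

definition err :: "('s, 'a) loop_state \<Rightarrow> ('s, 'a) qfun" where
  "err x z = lt x z - (reward M z + kop (lh x) z)"

text \<open>As \<open>err\<close> is formed with \<open>lh\<close>, it starts at exactly 0 and
  changes in step \<open>k\<close> by \<open>D z - kop d z\<close> only. The batch size is
  proportional to the squared span of \<open>d\<close>, so the conditional variance proxy is at most
  \<open>\<epsilon>^2 / (\<alpha> * c k)\<close> whatever the current state; being deterministic,
  these factors multiply.\<close>

lemma nn_integral_exp_err_le:
  assumes z: "z \<in> SA"
  shows "(\<integral>\<^sup>+x. ennreal (exp (l * err x z)) \<partial>measure_pmf (loop j))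
    \<le> ennreal (exp (l\<^sup>2 * (\<epsilon>\<^sup>2 / (8 * \<alpha>)) * (\<Sum>i<j. 1 / c i)))"
proof (induction j)
  case 0
  have "kop (\<lambda>_. 0) z = 0" using kop_const[OF z] .
  thus ?case by (simp add: err_def)
next
  case (Suc k)
  let ?E = "ennreal (exp (l\<^sup>2 * (\<epsilon>\<^sup>2 / (8 * \<alpha>)) * (1 / c k)))"
  have step: "(\<integral>\<^sup>+x'. ennreal (exp (l * err x' z)) \<partial>measure_pmf (step k x))
      \<le> ennreal (exp (l * err x z)) * ?E" for x
  proof -
    define d where "d = (\<lambda>s. max_act M (\<lambda>z. \<beta> k * lt x z) s - lh x s)"
    define m where "m = batch_size M \<alpha> (c k) \<epsilon> d"
    have "(\<integral>\<^sup>+x'. ennreal (exp (l * err x' z)) \<partial>measure_pmf (step k x))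
        = (\<integral>\<^sup>+D. ennreal (exp (l * err x z)) * ennreal (exp (l * (D z - kop d z)))
            \<partial>measure_pmf (sample M d m))"
      unfolding step_eq d_def[symmetric] m_def[symmetric] nn_integral_map_pmf
    proof (intro nn_integral_cong)
      fix D
      have kop: "kop (max_act M (\<lambda>z. \<beta> k * lt x z)) z = kop d z + kop (lh x) z"
        unfolding d_def kop_diff by simp
      have "l * (lt x z + D z - (reward M z + kop (max_act M (\<lambda>z. \<beta> k * lt x z)) z))
          = l * err x z + l * (D z - kop d z)"
        unfolding err_def kop by (simp add: algebra_simps)
      thus "ennreal (exp (l * err \<lparr>lq = \<lambda>z. \<beta> k * lt x z, lt = \<lambda>z. lt x z + D z,
            lh = max_act M (\<lambda>z. \<beta> k * lt x z), lsamples = lsamples x + card S * card A * m\<rparr> z))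
          = ennreal (exp (l * err x z)) * ennreal (exp (l * (D z - kop d z)))"
        by (simp add: err_def exp_add ennreal_mult)
    qed
    also have "\<dots> = ennreal (exp (l * err x z)) *
        (\<integral>\<^sup>+D. ennreal (exp (l * (D z - kop d z))) \<partial>measure_pmf (sample M d m))"
      by (rule nn_integral_cmult) simp
    also have "\<dots> \<le> ennreal (exp (l * err x z)) * ?E"
    proof (rule mult_left_mono)
      have m1: "m \<ge> 1" unfolding m_def by (rule batch_size_ge_1)
      have "\<alpha> * c k * (sp S d)\<^sup>2 / \<epsilon>\<^sup>2 \<le> real m" unfolding m_def by (rule batch_size_ge)
      hence "(sp S d)\<^sup>2 / real m \<le> \<epsilon>\<^sup>2 / (\<alpha> * c k)"
        using m1 \<alpha> c[of k] \<epsilon> by (simp add: field_simps)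
      hence "l\<^sup>2 * ((sp S d)\<^sup>2 / real m) / 8 \<le> l\<^sup>2 * (\<epsilon>\<^sup>2 / (\<alpha> * c k)) / 8"
        by (intro divide_right_mono mult_left_mono) auto
      also have "\<dots> = l\<^sup>2 * (\<epsilon>\<^sup>2 / (8 * \<alpha>)) * (1 / c k)" by simp
      finally show "(\<integral>\<^sup>+D. ennreal (exp (l * (D z - kop d z))) \<partial>measure_pmf (sample M d m)) \<le> ?E"
        by (intro order_trans[OF nn_integral_exp_sample_le[OF z m1]] ennreal_leI) simp
    qed simp
    finally show ?thesis .
  qed
  have "(\<integral>\<^sup>+x. ennreal (exp (l * err x z)) \<partial>measure_pmf (loop (Suc k)))
      \<le> (\<integral>\<^sup>+x. ennreal (exp (l * err x z)) * ?E \<partial>measure_pmf (loop k))"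
    unfolding savia_loop.simps nn_integral_bind_pmf by (intro nn_integral_mono step)
  also have "\<dots> = (\<integral>\<^sup>+x. ennreal (exp (l * err x z)) \<partial>measure_pmf (loop k)) * ?E"
    by (rule nn_integral_multc) simp
  also have "\<dots> \<le> ennreal (exp (l\<^sup>2 * (\<epsilon>\<^sup>2 / (8 * \<alpha>)) * (\<Sum>i<k. 1 / c i))) * ?E"
    by (rule mult_right_mono[OF Suc]) simp
  also have "\<dots> = ennreal (exp (l\<^sup>2 * (\<epsilon>\<^sup>2 / (8 * \<alpha>)) * (\<Sum>i<Suc k. 1 / c i)))"
    by (simp only: sum.lessThan_Suc distrib_left exp_add ennreal_mult exp_ge_zero)
  finally show ?case .
qed

text \<open>Chernoff's bound; the sign \<open>\<sigma>\<close> covers both tails at once.\<close>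

lemma err_one_sided_tail:
  assumes z: "z \<in> SA" and sum: "(\<Sum>i<j. 1 / c i) \<le> 1" and \<sigma>: "\<sigma> = 1 \<or> \<sigma> = - 1"
  shows "emeasure (measure_pmf (loop j)) {x. \<epsilon> < \<sigma> * err x z} \<le> ennreal (exp (- \<alpha>))"
proof -
  \<comment> \<open>With this parameter the exponent is at most
    \<open>\<alpha> / 2 - 2 * \<alpha>\<close>, hence below \<open>- \<alpha>\<close>.\<close>
  define l where "l = 2 * \<alpha> / \<epsilon>"
  have l: "0 < l" "l * \<epsilon> = 2 * \<alpha>" using \<epsilon> \<alpha> by (auto simp: l_def)
  have "emeasure (measure_pmf (loop j)) {x. \<epsilon> < \<sigma> * err x z}
      = (\<integral>\<^sup>+x. indicator {x. \<epsilon> < \<sigma> * err x z} x \<partial>measure_pmf (loop j))" by simp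
  also have "\<dots> \<le> (\<integral>\<^sup>+x. ennreal (exp (l * \<sigma> * err x z)) * ennreal (exp (- 2 * \<alpha>)) \<partial>measure_pmf (loop j))"
  proof (intro nn_integral_mono)
    fix x
    show "indicator {x. \<epsilon> < \<sigma> * err x z} x \<le> ennreal (exp (l * \<sigma> * err x z)) * ennreal (exp (- 2 * \<alpha>))"
    proof (cases "\<epsilon> < \<sigma> * err x z")
      case True
      hence "l * \<epsilon> \<le> l * (\<sigma> * err x z)" using l by (intro mult_left_mono) auto
      hence "1 \<le> exp (l * \<sigma> * err x z) * exp (- 2 * \<alpha>)"
        unfolding exp_add[symmetric] using l(2) by simp
      thus ?thesis using True by (simp add: ennreal_mult[symmetric] flip: ennreal_1)
    qed simp
  qed
  also have "\<dots> = (\<integral>\<^sup>+x. ennreal (exp (l * \<sigma> * err x z)) \<partial>measure_pmf (loop j)) * ennreal (exp (- 2 * \<alpha>))"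
    by (rule nn_integral_multc) simp
  also have "\<dots> \<le> ennreal (exp ((l * \<sigma>)\<^sup>2 * (\<epsilon>\<^sup>2 / (8 * \<alpha>)) * (\<Sum>i<j. 1 / c i))) * ennreal (exp (- 2 * \<alpha>))"
    by (intro mult_right_mono nn_integral_exp_err_le z) simp
  also have "\<dots> = ennreal (exp ((l * \<sigma>)\<^sup>2 * (\<epsilon>\<^sup>2 / (8 * \<alpha>)) * (\<Sum>i<j. 1 / c i) - 2 * \<alpha>))"
    by (simp add: ennreal_mult[symmetric] exp_diff exp_minus field_simps)
  also have "\<dots> \<le> ennreal (exp (- \<alpha>))"
  proof (intro ennreal_leI iffD2[OF exp_le_cancel_iff])
    have "(l * \<sigma>)\<^sup>2 * (\<epsilon>\<^sup>2 / (8 * \<alpha>)) = (l * \<epsilon>)\<^sup>2 / (8 * \<alpha>)"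
      using \<sigma> by (auto simp: power_mult_distrib)
    also have "\<dots> = \<alpha> / 2" using \<alpha> unfolding l(2) by (simp add: power2_eq_square)
    finally have eq: "(l * \<sigma>)\<^sup>2 * (\<epsilon>\<^sup>2 / (8 * \<alpha>)) = \<alpha> / 2" .
    have "\<alpha> / 2 * (\<Sum>i<j. 1 / c i) \<le> \<alpha> / 2 * 1" using sum \<alpha> by (intro mult_left_mono) auto
    thus "(l * \<sigma>)\<^sup>2 * (\<epsilon>\<^sup>2 / (8 * \<alpha>)) * (\<Sum>i<j. 1 / c i) - 2 * \<alpha> \<le> - \<alpha>"
      unfolding eq using \<alpha> by simp
  qed
  finally show ?thesis .
qed

lemma err_tail:
  assumes sum: "(\<Sum>i<j. 1 / c i) \<le> 1"
  shows "emeasure (measure_pmf (loop j)) {x. \<exists>z\<in>SA. \<epsilon> < \<bar>err x z\<bar>} \<le> ennreal (2 * cSA * exp (- \<alpha>))"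
proof -
  let ?P = "measure_pmf (loop j)"
  have "{x. \<exists>z\<in>SA. \<epsilon> < \<bar>err x z\<bar>}
      = (\<Union>z\<in>SA. {x. \<epsilon> < 1 * err x z} \<union> {x. \<epsilon> < - 1 * err x z})"
  proof -
    have "\<epsilon> < \<bar>e\<bar> \<longleftrightarrow> \<epsilon> < 1 * e \<or> \<epsilon> < - 1 * e" for e by linarith
    thus ?thesis by blast
  qed
  hence "emeasure ?P {x. \<exists>z\<in>SA. \<epsilon> < \<bar>err x z\<bar>}
      \<le> (\<Sum>z\<in>SA. emeasure ?P ({x. \<epsilon> < 1 * err x z} \<union> {x. \<epsilon> < - 1 * err x z}))"
    by (simp only:) (rule emeasure_subadditive_finite[OF finSA], simp)
  also have "\<dots> \<le> (\<Sum>z\<in>SA. ennreal (2 * exp (- \<alpha>)))"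
  proof (rule sum_mono)
    fix z assume z: "z \<in> SA"
    have "emeasure ?P ({x. \<epsilon> < 1 * err x z} \<union> {x. \<epsilon> < - 1 * err x z})
        \<le> emeasure ?P {x. \<epsilon> < 1 * err x z} + emeasure ?P {x. \<epsilon> < - 1 * err x z}"
      by (rule emeasure_subadditive) auto
    also have "\<dots> \<le> ennreal (exp (- \<alpha>)) + ennreal (exp (- \<alpha>))"
      by (intro add_mono err_one_sided_tail z sum) auto
    also have "\<dots> = ennreal (2 * exp (- \<alpha>))" by (simp add: ennreal_plus[symmetric] del: ennreal_plus)
    finally show "emeasure ?P ({x. \<epsilon> < 1 * err x z} \<union> {x. \<epsilon> < - 1 * err x z})
        \<le> ennreal (2 * exp (- \<alpha>))" .
  qed
  also have "\<dots> = ennreal (2 * cSA * exp (- \<alpha>))"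
    by (simp add: card_cartesian_product ennreal_of_nat_eq_real_of_nat ennreal_mult[symmetric] algebra_simps)
  finally show ?thesis .
qed

text \<open>
  A state \<open>x\<close> after the iterations with index below \<open>j\<close> holds \<open>Q\<^bsup>j-1\<^esup>\<close> and \<open>T\<^bsup>j-1\<^esup>\<close>, so this is the
  span seminorm of \<open>Q\<^sup>j - Q\<^bsup>j-1\<^esup>\<close>.
\<close>

definition incr :: "nat \<Rightarrow> ('s, 'a) loop_state \<Rightarrow> real" where
  "incr j x = sp SA (\<lambda>z. \<beta> j * lt x z - lq x z)"

definition crude_inv :: "nat \<Rightarrow> ('s, 'a) loop_state \<Rightarrow> bool" where
  "crude_inv j x \<longleftrightarrow> lh x = max_act M (lq x) \<and> incr j x \<le> 1 \<and> sp SA (lt x) \<le> 1 + real j \<and>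
     real (lsamples x) \<le> cSA * (\<Sum>k<j. \<alpha> * c k / \<epsilon>\<^sup>2 + 1)"

text \<open>
  The entries of \<open>D\<^sup>k\<close> are averages of values of \<open>d\<^sup>k\<close>, so \<open>\<parallel>D\<^sup>k\<parallel> \<le> \<parallel>d\<^sup>k\<parallel>\<close> holds surely in span seminorm; bounding
  \<open>Q\<^bsup>k+1\<^esup> - Q\<^sup>k\<close> through \<open>D\<^sup>k\<close> rather than through \<open>\<T>\<close> avoids an accumulation of sampling errors.
\<close>

lemma step_cases:
  assumes x: "lh x = max_act M (lq x)" and x': "x' \<in> set_pmf (step k x)"
  obtains D where "sp SA D \<le> incr k x" "lq x' = (\<lambda>z. \<beta> k * lt x z)" "lt x' = (\<lambda>z. lt x z + D z)"
    "lh x' = max_act M (lq x')"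
    "real (lsamples x') \<le> real (lsamples x) + cSA * (\<alpha> * c k * (incr k x)\<^sup>2 / \<epsilon>\<^sup>2 + 1)"
    "incr (Suc k) x' \<le> \<beta> (Suc k) * incr k x + 2 / ((real k + 2) * (real k + 3)) * sp SA (lt x)"
proof -
  define d where "d = (\<lambda>s. max_act M (\<lambda>z. \<beta> k * lt x z) s - lh x s)"
  define m where "m = batch_size M \<alpha> (c k) \<epsilon> d"
  obtain D where D: "D \<in> set_pmf (sample M d m)" and eq: "x' = \<lparr>lq = (\<lambda>z. \<beta> k * lt x z),
      lt = (\<lambda>z. lt x z + D z), lh = max_act M (\<lambda>z. \<beta> k * lt x z),
      lsamples = lsamples x + card S * card A * m\<rparr>"
    using x' unfolding step_eq d_def[symmetric] m_def[symmetric] by auto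
  have d: "sp S d \<le> incr k x" unfolding d_def x incr_def by (rule sp_max_act_diff_le)
  have spD: "sp SA D \<le> incr k x"
    by (rule order_trans[OF sp_sample_le[OF D] d]) (unfold m_def, rule batch_size_ge_1)
  have m: "real m \<le> \<alpha> * c k * (incr k x)\<^sup>2 / \<epsilon>\<^sup>2 + 1"
    unfolding m_def by (rule batch_size_le[OF d])
  \<comment> \<open>The next iterate is \<open>\<beta> (Suc k)\<close> times
    \<open>lt x + D\<close>, and the current one is \<open>\<beta> k * lt x\<close>: the fresh
    sample is damped, and the old total enters only through the small change of \<beta>.\<close>
  have "incr (Suc k) x' = sp SA (\<lambda>z. \<beta> (Suc k) * D z + (\<beta> (Suc k) - \<beta> k) * lt x z)"
    unfolding incr_def eq by (intro sp_cong) (simp add: algebra_simps)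
  also have "\<dots> \<le> sp SA (\<lambda>z. \<beta> (Suc k) * D z) + sp SA (\<lambda>z. (\<beta> (Suc k) - \<beta> k) * lt x z)"
    by (rule sp_add_le[OF finSA neSA])
  also have "\<dots> \<le> \<beta> (Suc k) * sp SA D + (\<beta> (Suc k) - \<beta> k) * sp SA (lt x)"
    by (intro add_mono sp_cmult_le[OF finSA neSA]) (auto simp: \<beta>_bounds \<beta>_Suc_diff)
  also have "\<dots> \<le> \<beta> (Suc k) * incr k x + 2 / ((real k + 2) * (real k + 3)) * sp SA (lt x)"
    unfolding \<beta>_Suc_diff by (intro add_mono mult_left_mono spD) (auto simp: \<beta>_bounds)
  finally have incr: "incr (Suc k) x'
    \<le> \<beta> (Suc k) * incr k x + 2 / ((real k + 2) * (real k + 3)) * sp SA (lt x)" .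
  have "cSA * real m \<le> cSA * (\<alpha> * c k * (incr k x)\<^sup>2 / \<epsilon>\<^sup>2 + 1)"
    using m by (intro mult_left_mono) auto
  thus ?thesis using incr spD by (intro that[of D]) (auto simp: eq)
qed

lemma incr_nonneg: "0 \<le> incr j x"
  unfolding incr_def using sp_nonneg finSA neSA by blast

text \<open>The placeholder \<open>lq = 0\<close> is consistent with \<open>lh = 0\<close>, so the
  relation between \<open>lq\<close> and \<open>lh\<close> holds before iteration 0 and no case
  distinction is needed later.\<close>

lemma crude_inv_init: "crude_inv 0 \<lparr>lq = (\<lambda>_. 0), lt = reward M, lh = (\<lambda>_. 0), lsamples = 0\<rparr>"
proof -
  have "max_act M (\<lambda>_. 0) s = 0" for s using max_act_attained[of "\<lambda>_. 0" s] by auto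
  hence "(\<lambda>_. 0) = max_act M (\<lambda>_. 0)" by (simp add: fun_eq_iff)
  moreover have "sp SA (reward M) \<le> 1"
  proof (rule sp_leI[OF finSA neSA])
    fix y z assume "y \<in> SA" "z \<in> SA"
    thus "reward M y - reward M z \<le> 1"
      using reward[of "fst y" "snd y"] reward[of "fst z" "snd z"] by auto
  qed
  ultimately show ?thesis
    by (simp add: crude_inv_def incr_def \<beta>_def sp_const[OF neSA])
qed

lemma crude_inv_step:
  assumes x: "crude_inv k x" and x': "x' \<in> set_pmf (step k x)"
  shows "crude_inv (Suc k) x'"
proof -
  obtain D where D: "sp SA D \<le> incr k x" "lq x' = (\<lambda>z. \<beta> k * lt x z)" "lt x' = (\<lambda>z. lt x z + D z)"
    "lh x' = max_act M (lq x')"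
    "real (lsamples x') \<le> real (lsamples x) + cSA * (\<alpha> * c k * (incr k x)\<^sup>2 / \<epsilon>\<^sup>2 + 1)"
    "incr (Suc k) x' \<le> \<beta> (Suc k) * incr k x + 2 / ((real k + 2) * (real k + 3)) * sp SA (lt x)"
    using step_cases[OF _ x'] x by (auto simp: crude_inv_def)
  have g: "incr k x \<le> 1" "sp SA (lt x) \<le> 1 + real k" using x by (auto simp: crude_inv_def)
  have "sp SA (lt x') \<le> sp SA (lt x) + sp SA D" unfolding D by (rule sp_add_le[OF finSA neSA])
  hence "sp SA (lt x') \<le> 1 + real (Suc k)" using D(1) g by simp
  moreover have "\<beta> (Suc k) * incr k x + 2 / ((real k + 2) * (real k + 3)) * sp SA (lt x)
      \<le> \<beta> (Suc k) * 1 + 2 / ((real k + 2) * (real k + 3)) * (1 + real k)"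
    by (intro add_mono mult_left_mono g) (auto simp: \<beta>_bounds)
  \<comment> \<open>The left side equals
    \<open>(k + 1) * (k + 4) / ((k + 2) * (k + 3))\<close>.\<close>
  moreover have "\<dots> \<le> 1" by (simp add: \<beta>_def divide_simps) (simp add: algebra_simps)
  moreover have "(incr k x)\<^sup>2 \<le> 1" using g incr_nonneg[of k x] by (simp add: power_le_one)
  hence "\<alpha> * c k * (incr k x)\<^sup>2 / \<epsilon>\<^sup>2 \<le> \<alpha> * c k * 1 / \<epsilon>\<^sup>2"
    using \<alpha> c[of k] by (intro divide_right_mono mult_left_mono) auto
  hence "cSA * (\<alpha> * c k * (incr k x)\<^sup>2 / \<epsilon>\<^sup>2 + 1) \<le> cSA * (\<alpha> * c k / \<epsilon>\<^sup>2 + 1)"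
    by (intro mult_left_mono) auto
  ultimately show ?thesis using D x by (auto simp: crude_inv_def distrib_left)
qed

lemma crude_inv_loop: "x \<in> set_pmf (loop j) \<Longrightarrow> crude_inv j x"
proof (induction j arbitrary: x)
  case 0
  thus ?case using crude_inv_init by simp
next
  case (Suc j)
  thus ?case using crude_inv_step by auto
qed

end

section \<open>The anchored iteration while sampling errors stay small\<close>

locale savia_run_sol = savia_run M c \<alpha> \<epsilon>
  for M :: "('s, 'a) mdp" and c :: "nat \<Rightarrow> real" and \<alpha> \<epsilon> :: real +
  fixes Qs :: "('s, 'a) qfun" and g :: real
  assumes Qs: "z \<in> state_actions M \<Longrightarrow> Qs z = bellman_op M Qs z - g"
begin

definition R :: real where "R = sp SA Qs"

text \<open>A bound for the span of \<open>lt\<close> after \<open>j\<close> iterations: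
  \<open>R\<close> for \<open>Qs\<close> itself, \<open>R + 2 / 3 * \<epsilon> * j\<close> for the
  distance of \<open>lq\<close> from it, and \<open>2 * \<epsilon>\<close> for the sampling
  error.\<close>

definition \<tau> :: "nat \<Rightarrow> real" where "\<tau> j = 2 * R + 2 * \<epsilon> + 2 / 3 * \<epsilon> * real j"

text \<open>The weight \<open>(j + 1) * (j + 2)\<close> is the summation factor that cancels
  \<open>\<beta>\<close> in the recursion for \<open>incr\<close>, so that weighted increments
  simply accumulate.\<close>

definition good_inv :: "nat \<Rightarrow> ('s, 'a) loop_state \<Rightarrow> bool" where
  "good_inv j x \<longleftrightarrow> lh x = max_act M (lq x) \<and> (\<forall>z\<in>SA. \<bar>err x z\<bar> \<le> \<epsilon>) \<and>
     sp SA (\<lambda>z. lq x z - Qs z) \<le> R + 2 / 3 * \<epsilon> * real j \<and>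
     (real j + 1) * (real j + 2) * incr j x \<le> 2 * real j * \<tau> j \<and>
     real (lsamples x) \<le> cSA * (\<Sum>k<j. \<alpha> * c k * (2 * \<tau> k / (real k + 2))\<^sup>2 / \<epsilon>\<^sup>2 + 1)"

lemma R_nonneg: "0 \<le> R"
  unfolding R_def using sp_nonneg finSA neSA by blast

lemma \<tau>_nonneg: "0 \<le> \<tau> j"
  using R_nonneg \<epsilon> by (simp add: \<tau>_def)

lemma lt_eq: "lh x = max_act M (lq x) \<Longrightarrow> lt x z = err x z + bellman_op M (lq x) z"
  by (simp add: err_def bellman_op_kop)

text \<open>Up to the sampling error, \<open>lt\<close> is the Bellman operator applied to
  \<open>lq\<close>, which is nonexpansive; the scalar \<open>g\<close> has no effect on the
  span.\<close>

lemma sp_lt_minus_Qs_le: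
  assumes "lh x = max_act M (lq x)" "\<forall>z\<in>SA. \<bar>err x z\<bar> \<le> \<epsilon>"
  shows "sp SA (\<lambda>z. lt x z - Qs z) \<le> 2 * \<epsilon> + sp SA (\<lambda>z. lq x z - Qs z)"
proof -
  let ?B = "\<lambda>z. bellman_op M (lq x) z - bellman_op M Qs z"
  have "sp SA (\<lambda>z. lt x z - Qs z) = sp SA (\<lambda>z. (err x z + g) + ?B z)"
    by (intro sp_cong) (simp add: lt_eq[OF assms(1)] Qs)
  also have "\<dots> \<le> sp SA (\<lambda>z. err x z + g) + sp SA ?B" by (rule sp_add_le[OF finSA neSA])
  also have "sp SA ?B \<le> sp SA (\<lambda>z. lq x z - Qs z)" by (rule sp_bellman_diff_le)
  also have "sp SA (\<lambda>z. err x z + g) \<le> 2 * \<epsilon>"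
    by (rule sp_leI[OF finSA neSA]) (use assms(2) in \<open>smt (verit)\<close>)
  finally show ?thesis by simp
qed

lemma good_inv_sp_lt:
  assumes "good_inv j x"
  shows "sp SA (\<lambda>z. lt x z - Qs z) \<le> R + 2 * \<epsilon> + 2 / 3 * \<epsilon> * real j" "sp SA (lt x) \<le> \<tau> j"
proof -
  show 1: "sp SA (\<lambda>z. lt x z - Qs z) \<le> R + 2 * \<epsilon> + 2 / 3 * \<epsilon> * real j"
    using sp_lt_minus_Qs_le[of x] assms by (simp add: good_inv_def)
  have "sp SA (lt x) \<le> sp SA (\<lambda>z. lt x z - Qs z) + sp SA Qs"
    using sp_add_le[OF finSA neSA, of "\<lambda>z. lt x z - Qs z" Qs] by simp
  thus "sp SA (lt x) \<le> \<tau> j" using 1 by (simp add: \<tau>_def R_def)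
qed

lemma good_inv_incr:
  assumes "good_inv j x"
  shows "incr j x \<le> 2 * \<tau> j / (real j + 2)"
proof -
  have "(real j + 1) * ((real j + 2) * incr j x) \<le> (real j + 1) * (2 * \<tau> j)"
    using assms \<tau>_nonneg[of j] by (auto simp: good_inv_def algebra_simps)
  hence "(real j + 2) * incr j x \<le> 2 * \<tau> j"
    by (subst (asm) mult_le_cancel_left_pos) auto
  thus ?thesis by (simp add: field_simps)
qed

lemma good_inv_init: "good_inv 0 \<lparr>lq = (\<lambda>_. 0), lt = reward M, lh = (\<lambda>_. 0), lsamples = 0\<rparr>"
  (is "good_inv 0 ?x")
proof -
  have 1: "lh ?x = max_act M (lq ?x)" and 2: "incr 0 ?x = 0"
    using crude_inv_init by (simp_all add: crude_inv_def incr_def \<beta>_def sp_const[OF neSA])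
  have "err ?x z = 0" if "z \<in> SA" for z using kop_const[OF that, of 0] by (simp add: err_def)
  moreover have "sp SA (\<lambda>z. 0 - Qs z) \<le> R" using sp_uminus_eq[OF finSA neSA, of Qs] by (simp add: R_def)
  ultimately show ?thesis using 1 2 \<epsilon> by (simp add: good_inv_def)
qed

lemma good_inv_step:
  assumes x: "good_inv k x" and x': "x' \<in> set_pmf (step k x)" and err: "\<forall>z\<in>SA. \<bar>err x' z\<bar> \<le> \<epsilon>"
  shows "good_inv (Suc k) x'"
proof -
  obtain D where D: "sp SA D \<le> incr k x" "lq x' = (\<lambda>z. \<beta> k * lt x z)" "lt x' = (\<lambda>z. lt x z + D z)"
    "lh x' = max_act M (lq x')"
    "real (lsamples x') \<le> real (lsamples x) + cSA * (\<alpha> * c k * (incr k x)\<^sup>2 / \<epsilon>\<^sup>2 + 1)"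
    "incr (Suc k) x' \<le> \<beta> (Suc k) * incr k x + 2 / ((real k + 2) * (real k + 3)) * sp SA (lt x)"
    using step_cases[OF _ x'] x by (auto simp: good_inv_def)
  \<comment> \<open>The anchor is 0, so mixing it in contributes
    \<open>- (1 - \<beta> k) * Qs\<close>.\<close>
  have "sp SA (\<lambda>z. lq x' z - Qs z) = sp SA (\<lambda>z. \<beta> k * (lt x z - Qs z) - (1 - \<beta> k) * Qs z)"
    unfolding D by (intro sp_cong) (simp add: algebra_simps)
  also have "\<dots> \<le> sp SA (\<lambda>z. \<beta> k * (lt x z - Qs z)) + sp SA (\<lambda>z. (1 - \<beta> k) * Qs z)"
    by (rule sp_diff_le[OF finSA neSA])
  also have "\<dots> \<le> \<beta> k * sp SA (\<lambda>z. lt x z - Qs z) + (1 - \<beta> k) * R"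
    unfolding R_def by (intro add_mono sp_cmult_le[OF finSA neSA]) (auto simp: \<beta>_bounds)
  also have "\<dots> \<le> \<beta> k * (R + 2 * \<epsilon> + 2 / 3 * \<epsilon> * real k) + (1 - \<beta> k) * R"
    by (intro add_mono mult_left_mono good_inv_sp_lt(1)[OF x]) (auto simp: \<beta>_bounds)
  also have "\<dots> = R + \<epsilon> * (\<beta> k * (2 + 2 / 3 * real k))" by (simp add: algebra_simps)
  \<comment> \<open>The slope 2/3 reproduces itself: \<open>\<beta> k * (2 + 2 / 3 * k)\<close> is
    \<open>2 / 3 * k * (k + 3) / (k + 2)\<close>, and
    \<open>k * (k + 3) \<le> (k + 1) * (k + 2)\<close>.\<close>
  also have "\<dots> \<le> R + \<epsilon> * (2 / 3 * real (Suc k))"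
    using \<epsilon> by (intro add_mono mult_left_mono) (auto simp: \<beta>_def field_simps)
  finally have Q: "sp SA (\<lambda>z. lq x' z - Qs z) \<le> R + 2 / 3 * \<epsilon> * real (Suc k)"
    by (simp add: algebra_simps)
  have "(real k + 2) * (real k + 3) * incr (Suc k) x'
      \<le> (real k + 2) * (real k + 3) *
        (\<beta> (Suc k) * incr k x + 2 / ((real k + 2) * (real k + 3)) * sp SA (lt x))"
    by (intro mult_left_mono D) auto
  \<comment> \<open>Here \<open>\<beta> (Suc k) = (k + 1) / (k + 3)\<close> turns the weight of step
    \<open>Suc k\<close> into that of step \<open>k\<close>.\<close>
  also have "\<dots> = (real k + 1) * (real k + 2) * incr k x + 2 * sp SA (lt x)"
    by (simp add: \<beta>_def divide_simps add_nonneg_eq_0_iff) (simp add: algebra_simps)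
  also have "\<dots> \<le> 2 * real k * \<tau> k + 2 * \<tau> k"
    using x good_inv_sp_lt(2)[OF x] by (simp add: good_inv_def)
  also have "\<dots> = 2 * real (Suc k) * \<tau> k" by (simp add: algebra_simps)
  also have "\<dots> \<le> 2 * real (Suc k) * \<tau> (Suc k)"
    using \<epsilon> by (intro mult_left_mono) (auto simp: \<tau>_def)
  finally have incr: "(real (Suc k) + 1) * (real (Suc k) + 2) * incr (Suc k) x' \<le> 2 * real (Suc k) * \<tau> (Suc k)"
    by (simp add: add_ac)
  have "(incr k x)\<^sup>2 \<le> (2 * \<tau> k / (real k + 2))\<^sup>2"
    by (intro power_mono good_inv_incr x incr_nonneg)
  hence "\<alpha> * c k * (incr k x)\<^sup>2 / \<epsilon>\<^sup>2 \<le> \<alpha> * c k * (2 * \<tau> k / (real k + 2))\<^sup>2 / \<epsilon>\<^sup>2"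
    using \<alpha> c[of k] by (intro divide_right_mono mult_left_mono) auto
  hence "cSA * (\<alpha> * c k * (incr k x)\<^sup>2 / \<epsilon>\<^sup>2 + 1) \<le> cSA * (\<alpha> * c k * (2 * \<tau> k / (real k + 2))\<^sup>2 / \<epsilon>\<^sup>2 + 1)"
    by (intro mult_left_mono) auto
  moreover have "real (lsamples x) \<le> cSA * (\<Sum>k<k. \<alpha> * c k * (2 * \<tau> k / (real k + 2))\<^sup>2 / \<epsilon>\<^sup>2 + 1)"
    using x by (simp add: good_inv_def)
  ultimately have "real (lsamples x') \<le>
      cSA * (\<Sum>k<Suc k. \<alpha> * c k * (2 * \<tau> k / (real k + 2))\<^sup>2 / \<epsilon>\<^sup>2 + 1)"
    using D(5) by (subst sum.lessThan_Suc, subst distrib_left) linarith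
  thus ?thesis using D(4) err Q incr unfolding good_inv_def by blast
qed

text \<open>By \<open>good_inv_step\<close> the invariant can break only at a step whose error
  exceeds \<epsilon>, so failure is a union bound over the steps. The tail for step
  \<open>Suc k\<close> is taken under the full law of the loop, not conditionally on success so
  far.\<close>

lemma good_inv_fail_le:
  assumes sum: "\<And>j. (\<Sum>i<j. 1 / c i) \<le> 1"
  shows "emeasure (measure_pmf (loop j)) {x. \<not> good_inv j x} \<le> ennreal (real j * (2 * cSA * exp (- \<alpha>)))"
proof (induction j)
  case 0
  show ?case using good_inv_init by simp
next
  case (Suc k)
  let ?E = "{x. \<exists>z\<in>SA. \<epsilon> < \<bar>err x z\<bar>}"
  have "emeasure (measure_pmf (loop (Suc k))) {x. \<not> good_inv (Suc k) x}
      = (\<integral>\<^sup>+x. emeasure (measure_pmf (step k x)) {x. \<not> good_inv (Suc k) x} \<partial>measure_pmf (loop k))"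
    by (simp add: emeasure_bind_pmf)
  also have "\<dots> \<le> (\<integral>\<^sup>+x. indicator {x. \<not> good_inv k x} x + emeasure (measure_pmf (step k x)) ?E
      \<partial>measure_pmf (loop k))"
  proof (intro nn_integral_mono)
    fix x
    show "emeasure (measure_pmf (step k x)) {x. \<not> good_inv (Suc k) x}
        \<le> indicator {x. \<not> good_inv k x} x + emeasure (measure_pmf (step k x)) ?E"
    proof (cases "good_inv k x")
      case True
      have "emeasure (measure_pmf (step k x)) {x. \<not> good_inv (Suc k) x} \<le> emeasure (measure_pmf (step k x)) ?E"
      proof (rule emeasure_mono_AE)
        show "AE x' in measure_pmf (step k x). x' \<in> {x. \<not> good_inv (Suc k) x} \<longrightarrow> x' \<in> ?E"
          using good_inv_step[OF True] by (force simp: AE_measure_pmf_iff not_less)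
      qed simp
      thus ?thesis by (simp add: add_increasing)
    next
      case False
      have "emeasure (measure_pmf (step k x)) {x. \<not> good_inv (Suc k) x} \<le> 1"
        by (rule measure_pmf.emeasure_le_1)
      thus ?thesis using False by (simp add: add_increasing2)
    qed
  qed
  also have "\<dots> = emeasure (measure_pmf (loop k)) {x. \<not> good_inv k x} + emeasure (measure_pmf (loop (Suc k))) ?E"
    by (subst nn_integral_add) (auto simp: emeasure_bind_pmf)
  also have "\<dots> \<le> ennreal (real k * (2 * cSA * exp (- \<alpha>))) + ennreal (2 * cSA * exp (- \<alpha>))"
    by (intro add_mono Suc err_tail sum)
  also have "\<dots> = ennreal (real (Suc k) * (2 * cSA * exp (- \<alpha>)))"
    by (subst ennreal_plus[symmetric]) (auto simp: algebra_simps)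
  finally show ?case .
qed

text \<open>Links the quantity that the algorithm can observe, \<open>lq - lt\<close>, to the
  Bellman residual that controls the gap.\<close>

lemma good_inv_residual:
  assumes x: "good_inv j x"
  shows "sp SA (\<lambda>z. bellman_op M (lq x) z - lq x z) \<le> sp SA (\<lambda>z. lq x z - lt x z) + 2 * \<epsilon>"
proof -
  have eq: "bellman_op M (lq x) z - lq x z = - (lq x z - lt x z) - err x z" for z
    using lt_eq[of x z] x by (simp add: good_inv_def)
  have "sp SA (\<lambda>z. bellman_op M (lq x) z - lq x z)
      \<le> sp SA (\<lambda>z. - (lq x z - lt x z)) + sp SA (err x)"
    unfolding eq by (rule sp_diff_le[OF finSA neSA])
  also have "sp SA (\<lambda>z. - (lq x z - lt x z)) = sp SA (\<lambda>z. lq x z - lt x z)"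
    by (rule sp_uminus_eq[OF finSA neSA])
  also have "sp SA (err x) \<le> 2 * \<epsilon>"
    using x by (intro sp_le_of_abs_le[OF finSA neSA]) (auto simp: good_inv_def)
  finally show ?thesis by simp
qed

text \<open>Splitting \<open>lt - lq\<close> into the next increment and
  \<open>(1 - \<beta> j) * lt\<close> gives two terms of size at most
  \<open>2 * \<tau> j / (j + 2)\<close> each.\<close>

lemma good_inv_stop:
  assumes x: "good_inv j x" and j: "R \<le> \<epsilon> * (real j + 2)"
  shows "sp SA (\<lambda>z. lq x z - lt x z) \<le> 14 * \<epsilon>"
proof -
  have \<beta>: "1 - \<beta> j = 2 / (real j + 2)" by (simp add: \<beta>_def field_simps)
  have "sp SA (\<lambda>z. lq x z - lt x z) = sp SA (\<lambda>z. - (lq x z - lt x z))"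
    by (rule sp_uminus_eq[OF finSA neSA, symmetric])
  also have "\<dots> = sp SA (\<lambda>z. (\<beta> j * lt x z - lq x z) + (1 - \<beta> j) * lt x z)"
    by (intro sp_cong) (simp add: algebra_simps)
  also have "\<dots> \<le> incr j x + sp SA (\<lambda>z. (1 - \<beta> j) * lt x z)"
    unfolding incr_def by (rule sp_add_le[OF finSA neSA])
  also have "\<dots> \<le> incr j x + (1 - \<beta> j) * sp SA (lt x)"
    by (intro add_left_mono sp_cmult_le[OF finSA neSA]) (simp add: \<beta>_bounds)
  also have "\<dots> \<le> 2 * \<tau> j / (real j + 2) + 2 / (real j + 2) * \<tau> j"
    unfolding \<beta> by (intro add_mono mult_left_mono good_inv_incr good_inv_sp_lt(2) x) simp
  also have "\<dots> = 4 * \<tau> j / (real j + 2)" by simp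
  also have "\<dots> \<le> 14 * \<epsilon>"
  proof -
    \<comment> \<open>Origin of 14: the right side is \<open>\<epsilon> * (32 / 3 * j + 24)\<close>,
      which is at most \<open>14 * \<epsilon> * (j + 2)\<close>.\<close>
    have "4 * \<tau> j \<le> 8 * (\<epsilon> * (real j + 2)) + 8 * \<epsilon> + 8 / 3 * \<epsilon> * real j"
      using j by (simp add: \<tau>_def)
    also have "\<dots> \<le> 14 * \<epsilon> * (real j + 2)"
    proof -
      have "0 \<le> \<epsilon> * real j" using \<epsilon> by simp
      thus ?thesis using \<epsilon> by (simp add: algebra_simps)
    qed
    finally show ?thesis by (simp add: field_simps)
  qed
  finally show ?thesis .
qed

end

section \<open>The output of a single run\<close>

context savia_run_sol
begin

definition good_samples :: "nat \<Rightarrow> real" where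
  "good_samples j = cSA * (\<Sum>k<j. \<alpha> * c k * (2 * \<tau> k / (real k + 2))\<^sup>2 / \<epsilon>\<^sup>2 + 1)"

definition crude_samples :: "nat \<Rightarrow> real" where
  "crude_samples j = cSA * (\<Sum>k<j. \<alpha> * c k / \<epsilon>\<^sup>2 + 1)"

text \<open>A run with parameter \<open>n\<close> performs \<open>n + 1\<close> iterations, so the
  \<open>j + 2\<close> of \<open>good_inv_stop\<close> becomes \<open>n + 3\<close>.\<close>

definition good_out :: "nat \<Rightarrow> ('s, 'a) savia_output \<Rightarrow> bool" where
  "good_out n y \<longleftrightarrow>
     sp SA (\<lambda>z. bellman_op M (out_Q y) z - out_Q y z) \<le> sp SA (\<lambda>z. out_Q y z - out_T y z) + 2 * \<epsilon> \<and>
     (R \<le> \<epsilon> * (real n + 3) \<longrightarrow> stop_test M \<epsilon> y) \<and>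
     real (out_samples y) \<le> good_samples (Suc n)"

text \<open>This is \<open>savia\<close> with \<alpha> as a free parameter in place of \<delta>;
  \<open>run_eq\<close> identifies the two.\<close>

definition run :: "('s, 'a) selection \<Rightarrow> nat \<Rightarrow> ('s, 'a) savia_output pmf" where
  "run sel n = do {x \<leftarrow> loop (Suc n); \<pi> \<leftarrow> sel n (lq x) (lt x);
     return_pmf \<lparr>out_Q = lq x, out_T = lt x, out_policy = \<pi>, out_samples = lsamples x\<rparr>}"

lemma run_surely:
  assumes y: "y \<in> set_pmf (run sel n)" and sel: "argmax_selection M sel"
  shows "out_policy y \<in> greedy M (out_Q y)" "real (out_samples y) \<le> crude_samples (Suc n)"
proof -
  obtain x \<pi> where x: "x \<in> set_pmf (loop (Suc n))" "\<pi> \<in> set_pmf (sel n (lq x) (lt x))"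
    "y = \<lparr>out_Q = lq x, out_T = lt x, out_policy = \<pi>, out_samples = lsamples x\<rparr>"
    using y unfolding run_def set_bind_pmf set_return_pmf by blast
  show "out_policy y \<in> greedy M (out_Q y)"
    using x sel by (auto simp: argmax_selection_def)
  show "real (out_samples y) \<le> crude_samples (Suc n)"
    using crude_inv_loop[OF x(1)] x(3) by (simp add: crude_inv_def crude_samples_def)
qed

lemma run_fail_le:
  assumes sum: "\<And>j. (\<Sum>i<j. 1 / c i) \<le> 1"
  shows "emeasure (measure_pmf (run sel n)) {y. \<not> good_out n y}
    \<le> ennreal (real (Suc n) * (2 * cSA * exp (- \<alpha>)))"
proof -
  have "emeasure (measure_pmf (run sel n)) {y. \<not> good_out n y}
      \<le> (\<integral>\<^sup>+x. indicator {x. \<not> good_inv (Suc n) x} x \<partial>measure_pmf (loop (Suc n)))"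
    unfolding run_def emeasure_bind_pmf
  proof (rule nn_integral_mono)
    fix x :: "('s, 'a) loop_state"
    let ?y = "\<lambda>\<pi>. \<lparr>out_Q = lq x, out_T = lt x, out_policy = \<pi>, out_samples = lsamples x\<rparr>"
    show "(\<integral>\<^sup>+\<pi>. emeasure (measure_pmf (return_pmf (?y \<pi>))) {y. \<not> good_out n y}
        \<partial>measure_pmf (sel n (lq x) (lt x))) \<le> indicator {x. \<not> good_inv (Suc n) x} x"
    proof (cases "good_inv (Suc n) x")
      case True
      \<comment> \<open>\<open>good_out\<close> speaks of the two matrices and the sample count, so
        the bound is uniform over randomized selections.\<close>
      have "good_out n (?y \<pi>)" for \<pi>
        using good_inv_residual[OF True] good_inv_stop[OF True] True
        by (auto simp: good_out_def stop_test_def good_samples_def good_inv_def add_ac)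
      thus ?thesis by simp
    next
      case False
      have "(\<integral>\<^sup>+\<pi>. emeasure (measure_pmf (return_pmf (?y \<pi>))) {y. \<not> good_out n y}
          \<partial>measure_pmf (sel n (lq x) (lt x))) \<le> (\<integral>\<^sup>+\<pi>. 1 \<partial>measure_pmf (sel n (lq x) (lt x)))"
        by (intro nn_integral_mono measure_pmf.emeasure_le_1)
      thus ?thesis using False by simp
    qed
  qed
  also have "\<dots> = emeasure (measure_pmf (loop (Suc n))) {x. \<not> good_inv (Suc n) x}" by simp
  also have "\<dots> \<le> ennreal (real (Suc n) * (2 * cSA * exp (- \<alpha>)))"
    by (rule good_inv_fail_le[OF sum])
  finally show ?thesis .
qed

end

section \<open>Independent runs\<close>

lemma emeasure_PiM_pmf_cylinder:
  fixes p :: "'i \<Rightarrow> 'b pmf"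
  assumes "finite J"
  shows "emeasure (PiM UNIV (\<lambda>i. measure_pmf (p i))) {\<omega>. \<forall>j\<in>J. \<omega> j \<in> B j}
    = (\<Prod>j\<in>J. emeasure (measure_pmf (p j)) (B j))"
proof -
  have "{\<omega>. \<forall>j\<in>J. \<omega> j \<in> B j} = prod_emb UNIV (\<lambda>i. measure_pmf (p i)) J (Pi\<^sub>E J B)"
    by (auto simp: prod_emb_def space_PiM PiE_def Pi_def restrict_def extensional_def)
  thus ?thesis using assms
    by (simp only:) (rule emeasure_PiM_emb, auto intro: measure_pmf.prob_space_axioms)
qed

text \<open>Every set is measurable in the space of a \<open>pmf\<close>, so every function of one
  coordinate is measurable on the product.\<close>

lemma measurable_PiM_pmf_component:
  fixes p :: "'i \<Rightarrow> 'b pmf"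
  assumes "F \<in> UNIV \<rightarrow> space N"
  shows "(\<lambda>\<omega>. F (\<omega> i)) \<in> measurable (PiM UNIV (\<lambda>i. measure_pmf (p i))) N"
proof -
  have "F \<in> measurable (measure_pmf (p i)) N" using assms by simp
  thus ?thesis
    by (rule measurable_compose[where f = "\<lambda>\<omega>. \<omega> i" and g = F,
          OF measurable_component_singleton[OF UNIV_I]])
qed

lemma prod_mono_ennreal:
  fixes f h :: "'i \<Rightarrow> ennreal"
  shows "(\<And>i. f i \<le> h i) \<Longrightarrow> prod f J \<le> prod h J"
  by (induction J rule: infinite_finite_induct) (auto intro: mult_mono)

lemma suminf_ennreal_le:
  fixes f :: "nat \<Rightarrow> ennreal"
  assumes "\<And>n. sum f {..<n} \<le> C"
  shows "suminf f \<le> C"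
  unfolding suminf_eq_SUP by (rule SUP_least) (rule assms)

section \<open>The loops of SAVIA+ as independent runs\<close>

locale savia_plus = fin_mdp M for M :: "('s, 'a) mdp" +
  fixes c :: "nat \<Rightarrow> real" and \<epsilon> \<delta> :: real and sel :: "('s, 'a) selection"
    and Qs :: "('s, 'a) qfun"
  assumes \<epsilon>: "0 < \<epsilon>" and \<delta>: "0 < \<delta>" "\<delta> \<le> 1" and c: "1 \<le> c k"
    and sum_c: "(\<Sum>k<j. 1 / c k) \<le> 1"
    and reward: "s \<in> states M \<Longrightarrow> a \<in> actions M \<Longrightarrow> 0 \<le> reward M (s, a) \<and> reward M (s, a) \<le> 1"
    and wc: "weakly_communicating M"
    and Qs: "bellman_solution M Qs"
    and sel: "argmax_selection M sel"
begin

definition \<alpha> :: "nat \<Rightarrow> real" where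
  "\<alpha> i = ln (2 * real (card S) * real (card A) * (real (2 ^ i) + 1) / (\<delta> / c i))"

abbreviation "b \<equiv> \<lambda>k. real k / (real k + 2)"
abbreviation "\<Omega> \<equiv> savia_plus_space M c b sel (\<lambda>_. 0) \<epsilon> \<delta>"
abbreviation "run\<^sub>i \<equiv> \<lambda>i. savia M c b sel (\<lambda>_. 0) (2 ^ i) \<epsilon> (\<delta> / c i)"

lemma card_ge_1: "1 \<le> real (card S)" "1 \<le> real (card A)"
  using finS neS finA neA by (auto simp: Suc_le_eq card_gt_0_iff)

lemma \<alpha>_arg: "2 \<le> 2 * real (card S) * real (card A) * (real (2 ^ i) + 1) / (\<delta> / c i)"
proof -
  have "1 * 1 \<le> real (card S) * real (card A)" using card_ge_1 by (intro mult_mono) auto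
  hence "1 * 1 \<le> real (card S) * real (card A) * (real (2 ^ i) + 1)" by (intro mult_mono) auto
  moreover have "1 \<le> c i / \<delta>" using \<delta> c[of i] by (simp add: field_simps)
  ultimately have "1 * 1 \<le> real (card S) * real (card A) * (real (2 ^ i) + 1) * (c i / \<delta>)"
    by (intro mult_mono) auto
  thus ?thesis by simp
qed

lemma \<alpha>_pos: "0 < \<alpha> i"
  unfolding \<alpha>_def using \<alpha>_arg[of i] by (intro ln_gt_zero) linarith

definition gs :: real where "gs = opt_gain M (SOME s. s \<in> S)"

lemma opt_gain_eq: "s \<in> S \<Longrightarrow> opt_gain M s = gs"
  unfolding gs_def using opt_gain_constant[OF wc] neS some_in_eq by metis

lemma run_locale: "savia_run_sol M c (\<alpha> i) \<epsilon> Qs gs"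
proof unfold_locales
  show "0 < c k" for k using c[of k] by simp
  fix z assume "z \<in> SA"
  thus "Qs z = bellman_op M Qs z - gs"
    using Qs opt_gain_eq by (auto simp: bellman_solution_def)
qed (use \<epsilon> \<alpha>_pos reward in auto)

sublocale R: savia_run_sol M c "\<alpha> i" \<epsilon> Qs gs for i
  by (rule run_locale)

lemma run_eq: "run\<^sub>i i = R.run i sel (2 ^ i)"
proof -
  have "R.\<beta> = b" by (simp add: R.\<beta>_def fun_eq_iff)
  thus ?thesis unfolding savia_def R.run_def Let_def unfolding \<alpha>_def by simp
qed

text \<open>The definition of \<alpha> is tuned to this: \<open>exp (- \<alpha> i)\<close> times the
  number of signs, pairs and iterations equals \<open>\<delta> / c i\<close>.\<close>

lemma run_fail: "emeasure (measure_pmf (run\<^sub>i i)) {y. \<not> R.good_out i (2 ^ i) y} \<le> ennreal (\<delta> / c i)"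
proof -
  have pos: "0 < 2 * real (card S) * real (card A) * (real (2 ^ i) + 1) / (\<delta> / c i)"
    using \<alpha>_arg[of i] by linarith
  define K where "K = 2 * real (card S) * real (card A) * (real (2 ^ i) + 1)"
  have "exp (\<alpha> i) = K / (\<delta> / c i)" unfolding \<alpha>_def K_def by (rule exp_ln[OF pos])
  hence "exp (- \<alpha> i) = (\<delta> / c i) / K" unfolding exp_minus by simp
  moreover have "real (Suc (2 ^ i)) * (2 * (real (card S) * real (card A)) * exp (- \<alpha> i)) = K * exp (- \<alpha> i)"
    by (simp add: K_def algebra_simps)
  moreover have "K \<noteq> 0"
    using card_ge_1 mult_pos_pos[of "real (card S)" "real (card A)"] unfolding K_def
    by (auto simp: add_nonneg_eq_0_iff)
  ultimately have "real (Suc (2 ^ i)) * (2 * (real (card S) * real (card A)) * exp (- \<alpha> i)) = \<delta> / c i"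
    by simp
  thus ?thesis using R.run_fail_le[OF sum_c, of i sel "2 ^ i"] unfolding run_eq by simp
qed

sublocale \<Omega>: prob_space \<Omega>
  unfolding savia_plus_space_def by (rule prob_space_PiM) (rule measure_pmf.prob_space_axioms)

lemma space_\<Omega> [simp]: "space \<Omega> = UNIV"
  by (simp add: savia_plus_space_def space_PiM)

lemma cylinder: "finite J \<Longrightarrow> emeasure \<Omega> {\<omega>. \<forall>j\<in>J. \<omega> j \<in> B j}
    = (\<Prod>j\<in>J. emeasure (measure_pmf (run\<^sub>i j)) (B j))"
  unfolding savia_plus_space_def by (rule emeasure_PiM_pmf_cylinder)

lemma measurable_component [measurable]:
  "(\<lambda>\<omega>. F (\<omega> i)) \<in> measurable \<Omega> (count_space UNIV)"
  unfolding savia_plus_space_def by (rule measurable_PiM_pmf_component) auto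

lemma measurable_component_borel [measurable]:
  "(\<lambda>\<omega>. F (\<omega> i)) \<in> borel_measurable \<Omega>"
  unfolding savia_plus_space_def by (rule measurable_PiM_pmf_component) auto

lemma AE_component: "AE \<omega> in \<Omega>. \<forall>i. \<omega> i \<in> set_pmf (run\<^sub>i i)"
  unfolding AE_all_countable
proof
  fix i
  have "AE y in measure_pmf (run\<^sub>i i). y \<in> set_pmf (run\<^sub>i i)" by (simp add: AE_measure_pmf)
  from AE_PiM_component[where M = "\<lambda>i. measure_pmf (run\<^sub>i i)" and I = UNIV and i = i, OF _ _ this]
  show "AE \<omega> in \<Omega>. \<omega> i \<in> set_pmf (run\<^sub>i i)"
    unfolding savia_plus_space_def by (simp add: measure_pmf.prob_space_axioms)
qed

definition bad :: "nat \<Rightarrow> (nat \<Rightarrow> ('s, 'a) savia_output) set" where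
  "bad i = {\<omega>. \<not> R.good_out i (2 ^ i) (\<omega> i)}"

lemma bad_measurable [measurable]: "bad i \<in> sets \<Omega>"
  using measurable_sets[OF measurable_component[of "\<lambda>y. \<not> R.good_out i (2 ^ i) y" i], of "{True}"]
  by (simp add: bad_def vimage_def)

lemma emeasure_bad: "emeasure \<Omega> (bad i) \<le> ennreal (\<delta> / c i)"
  using cylinder[of "{i}" "\<lambda>i. {y. \<not> R.good_out i (2 ^ i) y}"] run_fail[of i] by (simp add: bad_def)

lemma emeasure_all_bad:
  "finite J \<Longrightarrow> emeasure \<Omega> {\<omega>. \<forall>j\<in>J. \<omega> \<in> bad j} \<le> ennreal (\<Prod>j\<in>J. \<delta> / c j)"
proof -
  assume J: "finite J"
  have "emeasure \<Omega> {\<omega>. \<forall>j\<in>J. \<omega> \<in> bad j} = (\<Prod>j\<in>J. emeasure (measure_pmf (run\<^sub>i j)) {y. \<not> R.good_out j (2 ^ j) y})"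
    using cylinder[OF J, of "\<lambda>j. {y. \<not> R.good_out j (2 ^ j) y}"] by (simp add: bad_def)
  also have "\<dots> \<le> (\<Prod>j\<in>J. ennreal (\<delta> / c j))" by (rule prod_mono_ennreal[OF run_fail])
  also have "\<dots> = ennreal (\<Prod>j\<in>J. \<delta> / c j)"
    using \<delta> c by (intro prod_ennreal) (auto intro!: divide_nonneg_nonneg order_trans[OF _ c])
  finally show ?thesis .
qed

text \<open>The stopping index is random, so the gap bound has to exclude failure of all loops at
  once; \<open>sum_c\<close> makes the failure probabilities add up to at most \<delta>.\<close>

lemma emeasure_some_bad: "emeasure \<Omega> (\<Union>i. bad i) \<le> ennreal \<delta>"
proof -
  have "emeasure \<Omega> (\<Union>i. bad i) \<le> (\<Sum>i. emeasure \<Omega> (bad i))"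
    by (intro emeasure_subadditive_countably) auto
  also have "\<dots> \<le> ennreal \<delta>"
  proof (rule suminf_ennreal_le)
    fix n
    have c0: "0 \<le> \<delta> / c i" for i using \<delta> c[of i] by simp
    have "(\<Sum>i<n. emeasure \<Omega> (bad i)) \<le> (\<Sum>i<n. ennreal (\<delta> / c i))"
      by (intro sum_mono emeasure_bad)
    also have "\<dots> = ennreal (\<delta> * (\<Sum>i<n. 1 / c i))" using c0 by (simp add: sum_ennreal sum_distrib_left)
    also have "\<dots> \<le> ennreal (\<delta> * 1)" using sum_c[of n] \<delta> by (intro ennreal_leI mult_left_mono) auto
    finally show "(\<Sum>i<n. emeasure \<Omega> (bad i)) \<le> ennreal \<delta>" by simp
  qed
  finally show ?thesis .
qed

definition unstopped :: "nat \<Rightarrow> (nat \<Rightarrow> ('s, 'a) savia_output) \<Rightarrow> bool" where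
  "unstopped i \<omega> \<longleftrightarrow> (\<forall>j<i. \<not> stop_test M \<epsilon> (\<omega> j))"

lemma unstopped_measurable [measurable]: "Measurable.pred \<Omega> (unstopped i)"
  unfolding unstopped_def by measurable

text \<open>From loop \<open>i0\<close> on, \<open>n\<close> is large enough for every good run to
  pass the test, so passing on to a later loop requires a failure.\<close>

lemma unstopped_bad:
  assumes i0: "sp SA Qs \<le> \<epsilon> * 2 ^ i0" and "unstopped i \<omega>" "i0 \<le> j" "j < i"
  shows "\<omega> \<in> bad j"
proof -
  have "(2 :: real) ^ i0 \<le> 2 ^ j" using assms by (intro power_increasing) auto
  hence "2 ^ i0 \<le> real (2 ^ j) + 3" unfolding of_nat_power of_nat_numeral by linarith
  hence "\<epsilon> * 2 ^ i0 \<le> \<epsilon> * (real (2 ^ j) + 3)" using \<epsilon> by (intro mult_left_mono) auto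
  hence "sp SA Qs \<le> \<epsilon> * (real (2 ^ j) + 3)" using i0 by linarith
  thus ?thesis using assms by (auto simp: bad_def R.good_out_def unstopped_def R.R_def)
qed

lemma emeasure_unstopped:
  assumes i0: "sp SA Qs \<le> \<epsilon> * 2 ^ i0"
  shows "emeasure \<Omega> {\<omega>. unstopped i \<omega>} \<le> ennreal (\<Prod>j\<in>{i0..<i}. \<delta> / c j)"
proof -
  have "Measurable.pred \<Omega> (\<lambda>\<omega>. \<forall>j\<in>{i0..<i}. \<omega> \<in> bad j)" by measurable
  hence "{\<omega>. \<forall>j\<in>{i0..<i}. \<omega> \<in> bad j} \<in> sets \<Omega>" by (simp add: pred_def)
  hence "emeasure \<Omega> {\<omega>. unstopped i \<omega>} \<le> emeasure \<Omega> {\<omega>. \<forall>j\<in>{i0..<i}. \<omega> \<in> bad j}"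
    by (intro emeasure_mono) (use unstopped_bad[OF i0] in auto)
  thus ?thesis using emeasure_all_bad[of "{i0..<i}"] by simp
qed

text \<open>Never stopping forces all loops from \<open>i0\<close> on to fail; these are independent
  with probabilities at most \<open>q < 1\<close>.\<close>

lemma AE_stops:
  assumes i0: "sp SA Qs \<le> \<epsilon> * 2 ^ i0" and q: "q < 1" "\<And>j. \<delta> / c j \<le> q"
  shows "AE \<omega> in \<Omega>. \<exists>i. stop_test M \<epsilon> (\<omega> i)"
proof (rule AE_I)
  let ?N = "{\<omega>. \<forall>i. unstopped i \<omega>}"
  show "{\<omega> \<in> space \<Omega>. \<not> (\<exists>i. stop_test M \<epsilon> (\<omega> i))} \<subseteq> ?N" by (auto simp: unstopped_def)
  have "Measurable.pred \<Omega> (\<lambda>\<omega>. \<forall>i. unstopped i \<omega>)" by measurable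
  thus "?N \<in> sets \<Omega>" by (simp add: pred_def)
  have q0: "0 \<le> q" using q(2)[of 0] \<delta> c[of 0] by (smt (verit) divide_nonneg_nonneg)
  have le: "emeasure \<Omega> ?N \<le> ennreal (q ^ m)" for m
  proof -
    have "emeasure \<Omega> ?N \<le> emeasure \<Omega> {\<omega>. unstopped (i0 + m) \<omega>}"
      by (rule emeasure_mono) (use unstopped_measurable[of "i0 + m"] in \<open>auto simp: pred_def\<close>)
    also have "\<dots> \<le> ennreal (\<Prod>j\<in>{i0..<i0 + m}. \<delta> / c j)" by (rule emeasure_unstopped[OF i0])
    also have "\<dots> \<le> ennreal (\<Prod>j\<in>{i0..<i0 + m}. q)"
      using \<delta> c q by (intro ennreal_leI prod_mono) (auto intro!: divide_nonneg_nonneg order_trans[OF _ c])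
    finally show ?thesis by simp
  qed
  have "(\<lambda>m. ennreal (q ^ m)) \<longlonglongrightarrow> ennreal 0"
    by (intro tendsto_ennrealI LIMSEQ_realpow_zero q0 q)
  hence "emeasure \<Omega> ?N \<le> ennreal 0"
    by (rule LIMSEQ_le_const) (use le in blast)
  thus "emeasure \<Omega> ?N = 0" by simp
qed

abbreviation "out \<equiv> savia_plus_output M \<epsilon>"

lemma gain_in_unit: "\<pi> \<in> policies M \<Longrightarrow> s \<in> S \<Longrightarrow> 0 \<le> gain M \<pi> s \<and> gain M \<pi> s \<le> 1"
proof -
  assume \<pi>: "\<pi> \<in> policies M" and s: "s \<in> S"
  interpret stochastic_matrix S "trans \<pi>" using stoch \<pi> by blast
  have "0 \<le> gain M \<pi> s"
    by (rule gain_ge[OF \<pi> s, where h = "\<lambda>_. 0"]) (use reward policy_mem[OF \<pi>] in auto)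
  moreover have "\<bar>gain M \<pi> s\<bar> \<le> 1" by (rule gain_abs_le[OF \<pi> s]) (use reward in auto)
  ultimately show ?thesis by simp
qed

lemma opt_gain_in_unit: "s \<in> S \<Longrightarrow> 0 \<le> opt_gain M s \<and> opt_gain M s \<le> 1"
  using opt_gain_attained[of s] gain_in_unit by metis

definition gap :: "'s \<Rightarrow> (nat \<Rightarrow> ('s, 'a) savia_output) \<Rightarrow> real" where
  "gap s \<omega> = opt_gain M s - gain M (out_policy (out \<omega>)) s"

text \<open>The stopping index is a measurable function into a countable set, and for each fixed
  index the gap depends on one coordinate.\<close>

lemma gap_measurable [measurable]: "gap s \<in> borel_measurable \<Omega>"
proof -
  have "(\<lambda>\<omega>. LEAST i. stop_test M \<epsilon> (\<omega> i)) \<in> measurable \<Omega> (count_space UNIV)"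
    by (rule measurable_Least) measurable
  from measurable_compose_countable[where f = "\<lambda>i \<omega>. opt_gain M s - gain M (out_policy (\<omega> i)) s",
      OF measurable_component_borel this]
  show ?thesis unfolding gap_def[abs_def] savia_plus_output_def .
qed

lemma AE_policy: "AE \<omega> in \<Omega>. \<forall>i. out_policy (\<omega> i) \<in> greedy M (out_Q (\<omega> i)) \<and>
    real (out_samples (\<omega> i)) \<le> R.crude_samples i (Suc (2 ^ i))"
  using AE_component
proof eventually_elim
  case (elim \<omega>)
  thus ?case using R.run_surely[OF _ sel] unfolding run_eq by blast
qed

lemma gap_integrable:
  assumes s: "s \<in> S"
  shows "integrable \<Omega> (gap s)"
proof (rule \<Omega>.integrable_const_bound)
  show "AE \<omega> in \<Omega>. norm (gap s \<omega>) \<le> 1"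
    using AE_policy
  proof eventually_elim
    case (elim \<omega>)
    \<comment> \<open>\<open>LEAST\<close> denotes some index on every path and
      \<open>AE_policy\<close> covers all indices, so the bound extends to paths that never
      stop.\<close>
    hence "out_policy (out \<omega>) \<in> policies M" by (simp add: savia_plus_output_def greedy_def)
    thus ?case using gain_in_unit[of _ s] opt_gain_in_unit[OF s] s
      by (fastforce simp: gap_def abs_le_iff)
  qed
qed measurable

text \<open>If the stopping run is good, the test gives \<open>14 * \<epsilon>\<close> and the
  residual estimate another \<open>2 * \<epsilon>\<close>; otherwise the gap is still at most 1, on
  an event of probability at most \<delta>.\<close>

lemma gap_expectation_le:
  assumes s: "s \<in> S" and stops: "AE \<omega> in \<Omega>. \<exists>i. stop_test M \<epsilon> (\<omega> i)"
  shows "(\<integral>\<omega>. gap s \<omega> \<partial>\<Omega>) \<le> 16 * \<epsilon> + \<delta>"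
proof -
  let ?B = "\<Union>i. bad i"
  have B: "?B \<in> sets \<Omega>" by measurable
  have int: "integrable \<Omega> (indicat_real ?B)"
    by (rule integrable_real_indicator[OF B]) (rule le_less_trans[OF \<Omega>.emeasure_le_1], simp)
  have "(\<integral>\<omega>. gap s \<omega> \<partial>\<Omega>) \<le> (\<integral>\<omega>. 16 * \<epsilon> + indicat_real ?B \<omega> \<partial>\<Omega>)"
  proof (rule integral_mono_AE[OF gap_integrable[OF s]])
    show "integrable \<Omega> (\<lambda>\<omega>. 16 * \<epsilon> + indicat_real ?B \<omega>)" using int by simp
    show "AE \<omega> in \<Omega>. gap s \<omega> \<le> 16 * \<epsilon> + indicat_real ?B \<omega>"
      using AE_policy stops
    proof eventually_elim
      case (elim \<omega>)
      define N where "N = (LEAST i. stop_test M \<epsilon> (\<omega> i))"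
      have N: "stop_test M \<epsilon> (\<omega> N)" unfolding N_def using elim(2) by (rule LeastI_ex)
      have gr: "out_policy (\<omega> N) \<in> greedy M (out_Q (\<omega> N))" using elim(1) by simp
      have gap: "gap s \<omega> = opt_gain M s - gain M (out_policy (\<omega> N)) s"
        by (simp add: gap_def savia_plus_output_def N_def)
      show ?case
      proof (cases "\<omega> \<in> bad N")
        case True
        have "gap s \<omega> \<le> 1" unfolding gap
          using gain_in_unit[of _ s] opt_gain_in_unit[OF s] s gr by (fastforce simp: greedy_def)
        moreover have "indicat_real ?B \<omega> = 1" using True by (auto simp: indicator_def)
        ultimately show ?thesis using \<epsilon> by simp
      next
        case False
        have "gap s \<omega> \<le> sp SA (\<lambda>z. bellman_op M (out_Q (\<omega> N)) z - out_Q (\<omega> N) z)"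
          unfolding gap by (rule greedy_gap_le[OF wc Qs gr s])
        also have "\<dots> \<le> sp SA (\<lambda>z. out_Q (\<omega> N) z - out_T (\<omega> N) z) + 2 * \<epsilon>"
          using False by (simp add: bad_def R.good_out_def)
        also have "\<dots> \<le> 16 * \<epsilon>" using N by (simp add: stop_test_def)
        finally show ?thesis by (simp add: add_increasing2)
      qed
    qed
  qed
  also have "\<dots> = 16 * \<epsilon> + measure \<Omega> ?B"
    using int B by (subst Bochner_Integration.integral_add) (auto simp: \<Omega>.prob_space[simplified])
  also have "measure \<Omega> ?B \<le> \<delta>"
    using emeasure_some_bad \<delta> by (simp add: \<Omega>.emeasure_eq_measure)
  finally show ?thesis by simp
qed

text \<open>Loops up to \<open>i0\<close> may have to run, so they are charged the good cost, plus
  the crude cost weighted by their own failure probability. A later loop is charged the sure crude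
  cost, weighted by the probability that all loops from \<open>i0\<close> up to it failed.\<close>

lemma samples_expectation_le:
  assumes i0: "sp SA Qs \<le> \<epsilon> * 2 ^ i0"
  shows "(\<integral>\<^sup>+\<omega>. savia_plus_samples M \<epsilon> \<omega> \<partial>\<Omega>)
    \<le> (\<Sum>i. ennreal (if i \<le> i0
          then R.good_samples i (Suc (2 ^ i)) + R.crude_samples i (Suc (2 ^ i)) * (\<delta> / c i)
          else R.crude_samples i (Suc (2 ^ i)) * (\<Prod>j\<in>{i0..<i}. \<delta> / c j)))"
proof -
  have cr0: "0 \<le> R.crude_samples i j" for i j
    unfolding R.crude_samples_def using \<alpha>_pos[of i] c
    by (intro mult_nonneg_nonneg sum_nonneg add_nonneg_nonneg divide_nonneg_nonneg)
      (auto intro: order_trans[OF _ c] less_imp_le)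
  have go0: "0 \<le> R.good_samples i j" for i j
    unfolding R.good_samples_def using \<alpha>_pos[of i] c
    by (intro mult_nonneg_nonneg sum_nonneg add_nonneg_nonneg divide_nonneg_nonneg)
      (auto intro: order_trans[OF _ c] less_imp_le)
  have dc0: "0 \<le> \<delta> / c i" for i using \<delta> c[of i] by simp
  have "(\<integral>\<^sup>+\<omega>. savia_plus_samples M \<epsilon> \<omega> \<partial>\<Omega>)
      = (\<Sum>i. \<integral>\<^sup>+\<omega>. (if unstopped i \<omega> then of_nat (out_samples (\<omega> i)) else 0) \<partial>\<Omega>)"
    unfolding savia_plus_samples_def unstopped_def[symmetric]
    by (rule nn_integral_suminf) measurable
  also have "\<dots> \<le> (\<Sum>i. ennreal (if i \<le> i0
          then R.good_samples i (Suc (2 ^ i)) + R.crude_samples i (Suc (2 ^ i)) * (\<delta> / c i)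
          else R.crude_samples i (Suc (2 ^ i)) * (\<Prod>j\<in>{i0..<i}. \<delta> / c j)))"
  proof (intro suminf_le summableI allI)
    fix i
    let ?G = "R.good_samples i (Suc (2 ^ i))" and ?C = "R.crude_samples i (Suc (2 ^ i))"
    let ?I = "\<integral>\<^sup>+\<omega>. (if unstopped i \<omega> then of_nat (out_samples (\<omega> i)) else 0) \<partial>\<Omega>"
    show "?I \<le> ennreal (if i \<le> i0 then ?G + ?C * (\<delta> / c i) else ?C * (\<Prod>j\<in>{i0..<i}. \<delta> / c j))"
    proof (cases "i \<le> i0")
      case True
      have "?I \<le> (\<integral>\<^sup>+\<omega>. ennreal ?G + ennreal ?C * indicator (bad i) \<omega> \<partial>\<Omega>)"
      proof (rule nn_integral_mono_AE)
        show "AE \<omega> in \<Omega>. (if unstopped i \<omega> then of_nat (out_samples (\<omega> i)) else 0)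
            \<le> ennreal ?G + ennreal ?C * indicator (bad i) \<omega>"
          using AE_policy
        proof eventually_elim
          case (elim \<omega>)
          have "of_nat (out_samples (\<omega> i)) \<le> ennreal ?G + ennreal ?C * indicator (bad i) \<omega>"
          proof (cases "\<omega> \<in> bad i")
            case True
            have "ennreal (real (out_samples (\<omega> i))) \<le> ennreal ?C" using elim by (intro ennreal_leI) auto
            thus ?thesis using True by (simp add: ennreal_of_nat_eq_real_of_nat add_increasing)
          next
            case False
            hence "ennreal (real (out_samples (\<omega> i))) \<le> ennreal ?G"
              by (intro ennreal_leI) (auto simp: bad_def R.good_out_def)
            thus ?thesis using False by (simp add: ennreal_of_nat_eq_real_of_nat)
          qed
          thus ?case by simp
        qed
      qed
      also have "\<dots> = ennreal ?G + ennreal ?C * emeasure \<Omega> (bad i)"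
        by (subst nn_integral_add) (auto simp: \<Omega>.emeasure_space_1[simplified] nn_integral_cmult_indicator)
      also have "\<dots> \<le> ennreal ?G + ennreal ?C * ennreal (\<delta> / c i)"
        by (intro add_left_mono mult_left_mono emeasure_bad) auto
      also have "\<dots> = ennreal (?G + ?C * (\<delta> / c i))"
        using cr0 go0 dc0 by (simp add: ennreal_mult ennreal_plus del: times_divide_eq_right)
      finally show ?thesis using True by simp
    next
      case False
      have "?I \<le> (\<integral>\<^sup>+\<omega>. ennreal ?C * indicator {\<omega>. unstopped i \<omega>} \<omega> \<partial>\<Omega>)"
      proof (rule nn_integral_mono_AE)
        show "AE \<omega> in \<Omega>. (if unstopped i \<omega> then of_nat (out_samples (\<omega> i)) else 0)
            \<le> ennreal ?C * indicator {\<omega>. unstopped i \<omega>} \<omega>"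
          using AE_policy
        proof eventually_elim
          case (elim \<omega>)
          have "ennreal (real (out_samples (\<omega> i))) \<le> ennreal ?C" using elim by (intro ennreal_leI) auto
          thus ?case by (auto simp: ennreal_of_nat_eq_real_of_nat indicator_def)
        qed
      qed
      also have "\<dots> = ennreal ?C * emeasure \<Omega> {\<omega>. unstopped i \<omega>}"
        by (rule nn_integral_cmult_indicator) (use unstopped_measurable[of i] in \<open>simp add: pred_def\<close>)
      also have "\<dots> \<le> ennreal ?C * ennreal (\<Prod>j\<in>{i0..<i}. \<delta> / c j)"
        by (intro mult_left_mono emeasure_unstopped i0) auto
      also have "\<dots> = ennreal (?C * (\<Prod>j\<in>{i0..<i}. \<delta> / c j))"
        by (rule ennreal_mult[symmetric]) (auto intro: cr0 prod_nonneg dc0)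
      finally show ?thesis using False by simp
    qed
  qed
  finally show ?thesis .
qed

end

section \<open>The parameter sequence of SAVIA+\<close>

definition c_seq :: "nat \<Rightarrow> real" where
  "c_seq k = 5 * (real k + 2) * (ln (real k + 2))\<^sup>2"

lemma ln_k2_ge: "2 / 3 \<le> ln (real k + 2)"
  using ln2_ge_two_thirds ln_mono[of 2 "real k + 2"] by linarith

lemma c_seq_ge: "4 \<le> c_seq k"
proof -
  have "(2 / 3)\<^sup>2 \<le> (ln (real k + 2))\<^sup>2" using ln_k2_ge[of k] by (intro power_mono) auto
  hence "5 * 2 * (2 / 3)\<^sup>2 \<le> c_seq k"
    unfolding c_seq_def by (intro mult_mono) auto
  thus ?thesis by (simp add: power2_eq_square)
qed

lemma ln_diff_ge: "0 < x \<Longrightarrow> 1 / (x + 1) \<le> ln (x + 1) - ln (x :: real)"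
  using ln_le_minus_one[of "x / (x + 1)"] by (simp add: ln_div field_simps)

text \<open>Comparison with the telescoping sum of \<open>1 / ln (k + 2) - 1 / ln (k + 3)\<close>,
  as \<open>- 1 / ln x\<close> has derivative \<open>1 / (x * (ln x)^2)\<close>. The first term is
  estimated by 9/40 separately; the total is at most 21/40.\<close>

lemma sum_c_seq_le: "(\<Sum>k<j. 1 / c_seq k) \<le> 1"
proof -
  have *: "(\<Sum>k<Suc j. 1 / c_seq k) \<le> 1 / 5 * (9 / 8 + 3 / 2 - 1 / ln (real j + 2))" for j
  proof (induction j)
    case 0
    have "(2 / 3)\<^sup>2 \<le> (ln (2 :: real))\<^sup>2" using ln2_ge_two_thirds by (intro power_mono) auto
    hence "1 / (10 * (ln (2 :: real))\<^sup>2) \<le> 9 / 40" by (simp add: power2_eq_square field_simps)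
    moreover have "1 / ln (2 :: real) \<le> 3 / 2" using ln2_ge_two_thirds by (simp add: field_simps)
    ultimately show ?case by (simp add: c_seq_def)
  next
    case (Suc j)
    let ?a = "ln (real j + 2)" and ?b = "ln (real j + 3)"
    have a: "2 / 3 \<le> ?a" "?a \<le> ?b" using ln_k2_ge[of j] by auto
    have "1 / ((real j + 3) * ?b\<^sup>2) = 1 / (real j + 3) / ?b\<^sup>2" by simp
    also have "\<dots> \<le> (?b - ?a) / ?b\<^sup>2"
      using ln_diff_ge[of "real j + 2"] by (intro divide_right_mono) (auto simp: add_ac)
    also have "\<dots> \<le> (?b - ?a) / (?a * ?b)"
      using a by (intro divide_left_mono) (auto simp: power2_eq_square intro!: mult_right_mono)
    also have "\<dots> = 1 / ?a - 1 / ?b" using a by (simp add: field_simps)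
    finally have "1 / 5 * (1 / ((real j + 3) * ?b\<^sup>2)) \<le> 1 / 5 * (1 / ?a - 1 / ?b)"
      by (intro mult_left_mono) auto
    moreover have "1 / c_seq (Suc j) = 1 / 5 * (1 / ((real j + 3) * ?b\<^sup>2))"
      by (simp add: c_seq_def add_ac mult.assoc del: distrib_left_numeral)
    ultimately have "1 / c_seq (Suc j) \<le> 1 / 5 * (1 / ?a - 1 / ?b)" by simp
    thus ?case using Suc by (simp add: add_ac)
  qed
  show ?thesis
  proof (cases j)
    case (Suc i)
    have "0 \<le> 1 / ln (real i + 2)" using ln_k2_ge[of i] by simp
    moreover have "x \<le> 1 / 5 * (9 / 8 + 3 / 2 - y) \<Longrightarrow> 0 \<le> y \<Longrightarrow> x \<le> 1" for x y :: real
      by (simp add: field_simps)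
    ultimately show ?thesis using *[of i] unfolding Suc by blast
  qed simp
qed

lemma sum_inverse_le_ln: "(\<Sum>k<j. 1 / (real k + 2)) \<le> ln (real j + 1)"
proof (induction j)
  case (Suc j)
  show ?case using Suc ln_diff_ge[of "real j + 1"] by (simp add: add_ac)
qed simp

text \<open>A late loop costs 4 times more per doubling but is 17 times less likely; this absorbs
  the cubic growth of its logarithmic factors. Bernoulli gives
  \<open>1 + m \<le> 4 * (5 / 4) ^ m\<close>, and \<open>(5 / 4) ^ 3 \<le> 17 / 8\<close> leaves the
  ratio 1/2.\<close>

lemma cube_le_exponential: "(1 + real m) ^ 3 * (4 / 17) ^ m \<le> 64 * (1 / 2) ^ m"
proof -
  have "1 + real m * (1 / 4) \<le> (1 + 1 / 4) ^ m" by (rule Bernoulli_inequality) simp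
  hence "1 + real m \<le> 4 * (5 / 4) ^ m" by simp
  hence "(1 + real m) ^ 3 \<le> (4 * (5 / 4) ^ m) ^ 3" by (intro power_mono) auto
  also have "\<dots> = 64 * ((5 / 4) ^ 3) ^ m" by (simp add: power_mult_distrib power_mult[symmetric] mult.commute)
  also have "\<dots> \<le> 64 * (17 / 8) ^ m"
    by (intro mult_left_mono power_mono) (auto simp: power3_eq_cube)
  finally have "(1 + real m) ^ 3 * (4 / 17) ^ m \<le> 64 * (17 / 8) ^ m * (4 / 17) ^ m"
    by (intro mult_right_mono) auto
  also have "\<dots> = 64 * (1 / 2) ^ m" by (simp add: power_mult_distrib[symmetric])
  finally show ?thesis .
qed

section \<open>Explicit constants for the sample bound\<close>

locale corollary_setting = fin_mdp M for M :: "('s, 'a) mdp" +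
  fixes sel :: "('s, 'a) selection" and Qs :: "('s, 'a) qfun" and \<epsilon> :: real
  assumes wc: "weakly_communicating M"
    and reward: "s \<in> states M \<Longrightarrow> a \<in> actions M \<Longrightarrow> 0 \<le> reward M (s, a) \<and> reward M (s, a) \<le> 1"
    and Qs: "bellman_solution M Qs"
    and H_ge: "1 \<le> sp (states M) (max_act M Qs)"
    and \<epsilon>: "0 < \<epsilon>" "\<epsilon> \<le> 1"
    and sel: "argmax_selection M sel"
begin

lemma \<epsilon>2: "0 < \<epsilon>\<^sup>2" "\<epsilon>\<^sup>2 \<le> 1"
  using \<epsilon> by (auto simp: power_le_one)

sublocale P: savia_plus M c_seq "\<epsilon> / 17" "\<epsilon>\<^sup>2 / 17" sel Qs
proof unfold_locales
  show "1 \<le> c_seq k" for k using c_seq_ge[of k] by simp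
qed (use \<epsilon> \<epsilon>2 reward wc Qs sel sum_c_seq_le in auto)

abbreviation "H \<equiv> sp S (max_act M Qs)"
abbreviation "N \<equiv> real (card S) * real (card A)"

definition L :: real where "L = ln (exp 1 * N * H / (\<epsilon> * (\<epsilon>\<^sup>2 / 17)))"

lemma N_ge: "1 \<le> N"
  using mult_mono[OF P.card_ge_1] by simp

lemma H_over_eps: "1 \<le> H / \<epsilon>"
  using H_ge \<epsilon> by (simp add: field_simps)

text \<open>The argument of \<open>L\<close> is a product of \<open>exp 1\<close> and two factors
  that are at least 1, so \<open>L\<close> dominates the logarithm of each factor and also every
  additive constant.\<close>

lemma L_bounds: "1 \<le> L" "ln (H / \<epsilon>) \<le> L" "ln (N / (\<epsilon>\<^sup>2 / 17)) \<le> L"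
proof -
  have d: "1 \<le> 1 / (\<epsilon>\<^sup>2 / 17)" using \<epsilon>2 by (simp add: field_simps)
  have e: "1 \<le> exp (1 :: real)" by simp
  have arg: "exp 1 * N * H / (\<epsilon> * (\<epsilon>\<^sup>2 / 17)) = exp 1 * (N * (1 / (\<epsilon>\<^sup>2 / 17))) * (H / \<epsilon>)"
    by (simp add: mult_ac)
  have Nd: "1 \<le> N * (1 / (\<epsilon>\<^sup>2 / 17))" using mult_mono[OF N_ge d] N_ge by simp
  have 1: "1 \<le> N * (1 / (\<epsilon>\<^sup>2 / 17)) * (H / \<epsilon>)" using mult_mono[OF Nd H_over_eps] Nd by simp
  have "exp 1 * 1 \<le> exp 1 * (N * (1 / (\<epsilon>\<^sup>2 / 17)) * (H / \<epsilon>))"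
    by (intro mult_left_mono 1) simp
  hence "exp 1 \<le> exp 1 * (N * (1 / (\<epsilon>\<^sup>2 / 17))) * (H / \<epsilon>)" by (simp only: mult_1_right mult.assoc)
  hence "ln (exp 1) \<le> L" unfolding L_def arg using exp_gt_zero by (rule ln_mono)
  thus "1 \<le> L" by simp
  have "1 * 1 * (H / \<epsilon>) \<le> exp 1 * (N * (1 / (\<epsilon>\<^sup>2 / 17))) * (H / \<epsilon>)"
    by (intro mult_right_mono mult_mono e Nd) (use H_over_eps in auto)
  thus "ln (H / \<epsilon>) \<le> L" unfolding L_def arg using H_over_eps by (intro ln_mono) auto
  have "1 * (N * (1 / (\<epsilon>\<^sup>2 / 17))) * 1 \<le> exp 1 * (N * (1 / (\<epsilon>\<^sup>2 / 17))) * (H / \<epsilon>)"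
    by (intro mult_mono e H_over_eps order_refl) (use Nd in auto)
  thus "ln (N / (\<epsilon>\<^sup>2 / 17)) \<le> L" unfolding L_def arg using Nd by (intro ln_mono) auto
qed

text \<open>\<open>Qs\<close> is the reward shifted by a constant plus the kernel applied to its own
  maximum; the reward has span at most 1, which is at most \<open>H\<close>.\<close>

lemma sp_Qs_le: "sp SA Qs \<le> 2 * H"
proof -
  have "sp SA Qs = sp SA (\<lambda>z. (reward M z - P.gs) + kop (max_act M Qs) z)"
  proof (rule sp_cong)
    fix z assume z: "z \<in> SA"
    show "Qs z = reward M z - P.gs + kop (max_act M Qs) z"
      using P.R.Qs[OF z] by (simp add: bellman_op_kop)
  qed
  also have "\<dots> \<le> sp SA (\<lambda>z. reward M z - P.gs) + sp SA (kop (max_act M Qs))"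
    by (rule sp_add_le[OF finSA neSA])
  also have "sp SA (kop (max_act M Qs)) \<le> H" by (rule sp_kop_le)
  also have "sp SA (\<lambda>z. reward M z - P.gs) \<le> 1"
  proof (rule sp_leI[OF finSA neSA])
    fix y z assume "y \<in> SA" "z \<in> SA"
    thus "reward M y - P.gs - (reward M z - P.gs) \<le> 1"
      using reward[of "fst y" "snd y"] reward[of "fst z" "snd z"] by auto
  qed
  finally show ?thesis using H_ge by simp
qed

text \<open>34 is 2 times 17: the span of \<open>Qs\<close> is at most \<open>2 * H\<close> and the
  tolerance is \<open>\<epsilon> / 17\<close>. Minimality keeps \<open>2 ^ i0\<close> within a
  factor 2 of this threshold.\<close>

definition i0 :: nat where "i0 = (LEAST i. 34 * (H / \<epsilon>) \<le> 2 ^ i)"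

lemma i0_bounds: "34 * (H / \<epsilon>) \<le> 2 ^ i0" "2 ^ i0 \<le> 68 * (H / \<epsilon>)"
proof -
  obtain n where "34 * (H / \<epsilon>) < 2 ^ n" using real_arch_pow[of 2 "34 * (H / \<epsilon>)"] by auto
  hence "34 * (H / \<epsilon>) \<le> 2 ^ n" by simp
  thus 1: "34 * (H / \<epsilon>) \<le> 2 ^ i0" unfolding i0_def by (rule LeastI)
  have "i0 \<noteq> 0" using 1 H_over_eps by (intro notI) simp
  then obtain k where k: "i0 = Suc k" by (cases i0) auto
  hence "\<not> 34 * (H / \<epsilon>) \<le> 2 ^ k" unfolding i0_def by (metis lessI not_less_Least)
  thus "2 ^ i0 \<le> 68 * (H / \<epsilon>)" using k by simp
qed

lemma i0_suffices: "sp SA Qs \<le> \<epsilon> / 17 * 2 ^ i0"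
proof -
  have "sp SA Qs \<le> 2 * H" by (rule sp_Qs_le)
  also have "\<dots> = \<epsilon> / 17 * (34 * (H / \<epsilon>))" using \<epsilon> by simp
  also have "\<dots> \<le> \<epsilon> / 17 * 2 ^ i0" using \<epsilon> by (intro mult_left_mono i0_bounds) auto
  finally show ?thesis .
qed

lemma four_pow_le: "i \<le> i0 \<Longrightarrow> 4 ^ i \<le> 4624 * (H / \<epsilon>)\<^sup>2"
proof -
  assume "i \<le> i0"
  hence "(4 :: real) ^ i \<le> 4 ^ i0" by (intro power_increasing) auto
  also have "\<dots> = (2 ^ i0)\<^sup>2" by (simp add: power2_eq_square power_mult_distrib[symmetric])
  also have "\<dots> \<le> (68 * (H / \<epsilon>))\<^sup>2" by (intro power_mono i0_bounds) auto
  finally show ?thesis by (simp add: power_mult_distrib power_divide)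
qed

lemma i0_le: "real i0 \<le> 104 * L"
proof -
  have "real i0 * (2 / 3) \<le> real i0 * ln 2" by (intro mult_left_mono ln2_ge_two_thirds) auto
  also have "\<dots> = ln (2 ^ i0)" by (simp add: ln_realpow)
  also have "\<dots> \<le> ln (68 * (H / \<epsilon>))" using H_over_eps by (intro ln_mono i0_bounds) auto
  also have "\<dots> = ln 68 + ln (H / \<epsilon>)" using H_over_eps by (intro ln_mult_pos) auto
  also have "\<dots> \<le> 67 + L" using ln_le_minus_one[of 68] L_bounds by simp
  finally show ?thesis using L_bounds(1) by simp
qed

text \<open>Dominates the logarithms in loop \<open>i\<close>, whose iteration indices are at most
  \<open>2 ^ i\<close>.\<close>

abbreviation lam :: "nat \<Rightarrow> real" where "lam i \<equiv> real i + 2"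

lemma ln_le_lam: "k \<le> 2 ^ i \<Longrightarrow> ln (real k + 2) \<le> lam i"
proof -
  assume k: "k \<le> 2 ^ i"
  have "real k \<le> 2 ^ i" using k by (metis of_nat_le_iff of_nat_numeral of_nat_power)
  moreover have "(1 :: real) \<le> 2 ^ i" by simp
  ultimately have "real k + 2 \<le> 4 * 2 ^ i" by linarith
  hence "real k + 2 \<le> 2 ^ (i + 2)" by (simp add: power_add mult.commute)
  hence "ln (real k + 2) \<le> ln (2 ^ (i + 2))" by (intro ln_mono) auto
  also have "\<dots> = lam i * ln 2" by (subst ln_realpow) simp_all
  also have "\<dots> \<le> lam i * 1" using ln2_le_25_over_36 by (intro mult_left_mono) auto
  finally show ?thesis by simp
qed

lemma c_seq_le: "k \<le> 2 ^ i \<Longrightarrow> c_seq k \<le> 5 * (real k + 2) * (lam i)\<^sup>2"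
  unfolding c_seq_def using ln_k2_ge[of k] ln_le_lam[of k i]
  by (intro mult_left_mono power_mono) auto

lemma \<alpha>_le: "P.\<alpha> i \<le> 11 * (L + lam i)"
proof -
  have "P.\<alpha> i = ln ((N / (\<epsilon>\<^sup>2 / 17)) * (2 * (real (2 ^ i) + 1)) * c_seq i)"
    by (simp add: P.\<alpha>_def field_simps)
  also have "\<dots> = ln (N / (\<epsilon>\<^sup>2 / 17)) + ln (2 * (real (2 ^ i) + 1)) + ln (c_seq i)"
  proof -
    have "0 < N / (\<epsilon>\<^sup>2 / 17)" "0 < 2 * (real (2 ^ i) + 1)" "0 < c_seq i"
      using N_ge \<epsilon>2 c_seq_ge[of i] by (auto simp: divide_pos_pos add_pos_pos)
    thus ?thesis by (simp only: ln_mult_pos mult_pos_pos)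
  qed
  also have "ln (N / (\<epsilon>\<^sup>2 / 17)) \<le> L" by (rule L_bounds)
  also have "ln (2 * (real (2 ^ i) + 1)) \<le> lam i"
  proof -
    have "2 * (real (2 ^ i) + 1) = real (2 ^ Suc i) + 2" by simp
    moreover have "(1 :: real) \<le> 2 ^ i" by simp
    ultimately have "2 * (real (2 ^ i) + 1) \<le> 2 ^ (i + 2)" by (simp del: one_le_power)
    hence "ln (2 * (real (2 ^ i) + 1)) \<le> ln (2 ^ (i + 2))" by (intro ln_mono) (auto intro: add_nonneg_pos)
    also have "\<dots> = lam i * ln 2" by (subst ln_realpow) simp_all
    also have "\<dots> \<le> lam i * 1" using ln2_le_25_over_36 by (intro mult_left_mono) auto
    finally show ?thesis by simp
  qed
  also have "ln (c_seq i) \<le> 4 + 3 * lam i"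
  proof -
    have l: "0 < ln (lam i)" "ln (lam i) \<le> lam i" using ln_k2_ge[of i] ln_le_minus_one[of "lam i"] by auto
    have "c_seq i \<le> 5 * lam i * (lam i)\<^sup>2"
      unfolding c_seq_def using l by (intro mult_left_mono power_mono) auto
    also have "\<dots> = 5 * lam i ^ 3" by (simp add: power2_eq_square power3_eq_cube)
    finally have "ln (c_seq i) \<le> ln (5 * lam i ^ 3)" using c_seq_ge[of i] by (intro ln_mono) auto
    also have "\<dots> = ln 5 + ln (lam i ^ 3)" by (intro ln_mult_pos) auto
    also have "\<dots> = ln 5 + 3 * ln (lam i)" by (simp add: ln_realpow)
    also have "\<dots> \<le> 4 + 3 * lam i" using l ln_le_minus_one[of 5] by simp
    finally show ?thesis .
  qed
  finally show ?thesis using L_bounds(1) by simp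
qed

lemma \<alpha>_ge: "2 / 3 \<le> P.\<alpha> i"
proof -
  have "ln 2 \<le> P.\<alpha> i" unfolding P.\<alpha>_def using P.\<alpha>_arg[of i] by (intro ln_mono) auto
  thus ?thesis using ln2_ge_two_thirds by linarith
qed

text \<open>Lets the additive 1 in each batch size be absorbed into the main term.\<close>

lemma weight_ge: "2 \<le> P.\<alpha> i * (lam i)\<^sup>2 / \<epsilon>\<^sup>2"
proof -
  have "(2 :: real)\<^sup>2 \<le> (lam i)\<^sup>2" by (intro power_mono) auto
  hence "2 / 3 * 2\<^sup>2 \<le> P.\<alpha> i * (lam i)\<^sup>2" using \<alpha>_ge[of i] by (intro mult_mono) auto
  hence "2 / 3 * 2\<^sup>2 / 1 \<le> P.\<alpha> i * (lam i)\<^sup>2 / \<epsilon>\<^sup>2" using \<epsilon>2 by (intro frac_le) auto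
  moreover have "(2 :: real) \<le> 2 / 3 * 2\<^sup>2 / 1" by simp
  ultimately show ?thesis by (rule order_trans[rotated])
qed

text \<open>About \<open>2 ^ i\<close> iterations with batches of order
  \<open>2 ^ i / \<epsilon>^2\<close> each. The constant 4335 is 5 * 3 * 17^2.\<close>

lemma crude_samples_le:
  "P.R.crude_samples i (Suc (2 ^ i)) \<le> 9000 * N * 4 ^ i * (P.\<alpha> i * (lam i)\<^sup>2 / \<epsilon>\<^sup>2)"
proof -
  let ?W = "P.\<alpha> i * (lam i)\<^sup>2 / \<epsilon>\<^sup>2"
  have one: "(1 :: real) \<le> 2 ^ i" by simp
  have term_le: "P.\<alpha> i * c_seq k / (\<epsilon> / 17)\<^sup>2 + 1 \<le> 4335 * 2 ^ i * ?W + 1" if k: "k < Suc (2 ^ i)" for k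
  proof -
    have "real k \<le> 2 ^ i" using k by (metis less_Suc_eq_le of_nat_le_iff of_nat_numeral of_nat_power)
    hence "real k + 2 \<le> 3 * 2 ^ i" using one by linarith
    hence "5 * (real k + 2) * (lam i)\<^sup>2 \<le> 5 * (3 * 2 ^ i) * (lam i)\<^sup>2"
      by (intro mult_right_mono mult_left_mono) auto
    moreover have "c_seq k \<le> 5 * (real k + 2) * (lam i)\<^sup>2" using k by (intro c_seq_le) simp
    ultimately have "c_seq k \<le> 5 * (3 * 2 ^ i) * (lam i)\<^sup>2" by (rule order_trans[rotated])
    hence "P.\<alpha> i * c_seq k / (\<epsilon> / 17)\<^sup>2 \<le> P.\<alpha> i * (5 * (3 * 2 ^ i) * (lam i)\<^sup>2) / (\<epsilon> / 17)\<^sup>2"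
      using \<alpha>_ge[of i] by (intro divide_right_mono mult_left_mono) auto
    thus ?thesis by (simp add: power_divide algebra_simps)
  qed
  have "(\<Sum>k<Suc (2 ^ i). P.\<alpha> i * c_seq k / (\<epsilon> / 17)\<^sup>2 + 1) \<le> (\<Sum>k<Suc (2 ^ i). 4335 * 2 ^ i * ?W + 1)"
    by (intro sum_mono term_le) auto
  also have "\<dots> = (2 ^ i + 1) * (4335 * 2 ^ i * ?W + 1)" by (simp add: algebra_simps)
  also have "\<dots> \<le> (2 * 2 ^ i) * (4335 * 2 ^ i * ?W + 2 ^ i * ?W)"
  proof (intro mult_mono add_left_mono)
    have "1 * 1 \<le> 2 ^ i * ?W" using one weight_ge[of i] by (intro mult_mono) auto
    thus "1 \<le> 2 ^ i * ?W" by simp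
  qed (use one weight_ge[of i] \<alpha>_ge[of i] in
      \<open>auto intro!: add_nonneg_nonneg mult_nonneg_nonneg divide_nonneg_nonneg\<close>)
  also have "\<dots> = 8672 * 4 ^ i * ?W"
    by (simp add: algebra_simps power_mult_distrib[symmetric])
  also have "\<dots> \<le> 9000 * 4 ^ i * ?W" using weight_ge[of i] by (intro mult_right_mono) auto
  finally have "N * (\<Sum>k<Suc (2 ^ i). P.\<alpha> i * c_seq k / (\<epsilon> / 17)\<^sup>2 + 1) \<le> N * (9000 * 4 ^ i * ?W)"
    using N_ge by (intro mult_left_mono) auto
  thus ?thesis unfolding P.R.crude_samples_def by (simp add: algebra_simps)
qed

lemma step_bound_le: "2 * P.R.\<tau> k / (real k + 2) \<le> 9 * H / (real k + 2) + 4 / 3 * (\<epsilon> / 17)"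
proof -
  have "2 * P.R.\<tau> k \<le> 4 * (2 * H) + 4 * (\<epsilon> / 17) + 4 / 3 * (\<epsilon> / 17) * real k"
    using sp_Qs_le by (simp add: P.R.\<tau>_def P.R.R_def)
  \<comment> \<open>Completing \<open>k\<close> to \<open>k + 2\<close> uses up 8/3 of the 4 units
    of \<open>\<epsilon> / 17\<close>; the remaining 4/3 units are at most \<open>H\<close>.\<close>
  also have "\<dots> \<le> 9 * H + 4 / 3 * (\<epsilon> / 17) * (real k + 2)"
  proof -
    have "4 / 3 * (\<epsilon> / 17) * (real k + 2) = 4 / 3 * (\<epsilon> / 17) * real k + 8 / 3 * (\<epsilon> / 17)"
      by (simp add: algebra_simps)
    thus ?thesis using H_ge \<epsilon> by linarith
  qed
  finally have "2 * P.R.\<tau> k / (real k + 2) \<le> (9 * H + 4 / 3 * (\<epsilon> / 17) * (real k + 2)) / (real k + 2)"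
    by (intro divide_right_mono) auto
  moreover have "(a + b * x) / x = a / x + b" if "x \<noteq> 0" for a b x :: real
    using that by (simp add: add_divide_distrib)
  ultimately show ?thesis by (metis add_nonneg_eq_0_iff of_nat_0_le_iff zero_le_numeral zero_neq_numeral)
qed

text \<open>This is where \<open>H^2 / \<epsilon>^2\<close> arises. Against \<open>c_seq k\<close>,
  of order \<open>k + 2\<close>, the part \<open>H / (k + 2)\<close> of an increment leaves
  \<open>H^2 / (k + 2)\<close>, which sums to a logarithm. The part of order \<epsilon> leaves
  \<open>\<epsilon>^2 * (k + 2)\<close>, which sums to \<open>\<epsilon>^2 * 4 ^ i\<close>, and
  \<open>4 ^ i\<close> is of order \<open>(H / \<epsilon>)^2\<close> up to
  \<open>i0\<close>.\<close>

lemma good_samples_le: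
  assumes i: "i \<le> i0"
  shows "P.R.good_samples i (Suc (2 ^ i)) \<le> 600000 * (N * H\<^sup>2 / \<epsilon>\<^sup>2) * (P.\<alpha> i * lam i ^ 3)"
proof -
  let ?n = "Suc (2 ^ i)"
  let ?B = "5 * (lam i)\<^sup>2"
  have \<alpha>0: "0 \<le> P.\<alpha> i" using \<alpha>_ge[of i] by simp
  have one: "(1 :: real) \<le> 2 ^ i" by simp
  have term_le: "c_seq k * (2 * P.R.\<tau> k / (real k + 2))\<^sup>2
      \<le> ?B * (162 * H\<^sup>2 * (1 / (real k + 2)) + 4 * (\<epsilon> / 17)\<^sup>2 * (3 * 2 ^ i))" if k: "k < ?n" for k
  proof -
    have k2: "real k \<le> 2 ^ i" using k by (metis less_Suc_eq_le of_nat_le_iff of_nat_numeral of_nat_power)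
    have sq: "(x + y)\<^sup>2 \<le> 2 * x\<^sup>2 + 2 * y\<^sup>2" for x y :: real
      using zero_le_power2[of "x - y"] by (simp add: power2_eq_square algebra_simps)
    have "(2 * P.R.\<tau> k / (real k + 2))\<^sup>2 \<le> (9 * H / (real k + 2) + 4 / 3 * (\<epsilon> / 17))\<^sup>2"
      using P.R.\<tau>_nonneg[of k] by (intro power_mono step_bound_le) auto
    also have "\<dots> \<le> 2 * (9 * H / (real k + 2))\<^sup>2 + 2 * (4 / 3 * (\<epsilon> / 17))\<^sup>2" by (rule sq)
    also have "\<dots> \<le> 162 * H\<^sup>2 / (real k + 2)\<^sup>2 + 4 * (\<epsilon> / 17)\<^sup>2"
      by (simp add: power_divide power_mult_distrib)
    finally have "c_seq k * (2 * P.R.\<tau> k / (real k + 2))\<^sup>2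
        \<le> 5 * (real k + 2) * (lam i)\<^sup>2 * (162 * H\<^sup>2 / (real k + 2)\<^sup>2 + 4 * (\<epsilon> / 17)\<^sup>2)"
      using c_seq_ge[of k] k by (intro mult_mono c_seq_le) auto
    also have "\<dots> = ?B * ((real k + 2) * (162 * H\<^sup>2 / (real k + 2)\<^sup>2 + 4 * (\<epsilon> / 17)\<^sup>2))"
      by (simp only: mult_ac)
    also have "(real k + 2) * (162 * H\<^sup>2 / (real k + 2)\<^sup>2 + 4 * (\<epsilon> / 17)\<^sup>2)
        = 162 * H\<^sup>2 * (1 / (real k + 2)) + 4 * (\<epsilon> / 17)\<^sup>2 * (real k + 2)"
    proof -
      have "x * (p / x\<^sup>2 + q) = p * (1 / x) + q * x" if "x \<noteq> 0" for x p q :: real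
        using that by (simp add: power2_eq_square field_simps)
      thus ?thesis by (simp add: add_nonneg_eq_0_iff)
    qed
    also have "?B * (162 * H\<^sup>2 * (1 / (real k + 2)) + 4 * (\<epsilon> / 17)\<^sup>2 * (real k + 2))
        \<le> ?B * (162 * H\<^sup>2 * (1 / (real k + 2)) + 4 * (\<epsilon> / 17)\<^sup>2 * (3 * 2 ^ i))"
    proof (intro mult_left_mono add_left_mono)
      show "real k + 2 \<le> 3 * 2 ^ i" using k2 one by linarith
    qed auto
    finally show ?thesis .
  qed
  have "(\<Sum>k<?n. c_seq k * (2 * P.R.\<tau> k / (real k + 2))\<^sup>2)
      \<le> (\<Sum>k<?n. ?B * (162 * H\<^sup>2 * (1 / (real k + 2)) + 4 * (\<epsilon> / 17)\<^sup>2 * (3 * 2 ^ i)))"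
    by (intro sum_mono term_le) auto
  also have "\<dots> = ?B * (162 * H\<^sup>2 * (\<Sum>k<?n. 1 / (real k + 2)) + (2 ^ i + 1) * (4 * (\<epsilon> / 17)\<^sup>2 * (3 * 2 ^ i)))"
    unfolding sum_distrib_left[symmetric] sum.distrib by (simp add: algebra_simps)
  also have "\<dots> \<le> ?B * (162 * H\<^sup>2 * lam i + (2 * 2 ^ i) * (4 * (\<epsilon> / 17)\<^sup>2 * (3 * 2 ^ i)))"
  proof (intro mult_left_mono add_mono mult_right_mono)
    have "(\<Sum>k<?n. 1 / (real k + 2)) \<le> ln (real ?n + 1)" by (rule sum_inverse_le_ln)
    also have "\<dots> = ln (real (2 ^ i) + 2)" by (simp add: add_ac)
    also have "\<dots> \<le> lam i" by (rule ln_le_lam) simp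
    finally show "(\<Sum>k<?n. 1 / (real k + 2)) \<le> lam i" .
  qed (use one in auto)
  also have "(2 * 2 ^ i) * (4 * (\<epsilon> / 17)\<^sup>2 * (3 * 2 ^ i)) = 24 * (\<epsilon> / 17)\<^sup>2 * 4 ^ i"
    by (simp add: algebra_simps power_mult_distrib[symmetric])
  also have "?B * (162 * H\<^sup>2 * lam i + 24 * (\<epsilon> / 17)\<^sup>2 * 4 ^ i) \<le> ?B * (354 * H\<^sup>2 * lam i)"
  proof (rule mult_left_mono)
    have "24 * (\<epsilon> / 17)\<^sup>2 * 4 ^ i \<le> 24 * (\<epsilon> / 17)\<^sup>2 * (4624 * (H / \<epsilon>)\<^sup>2)"
      using four_pow_le[OF i] by (intro mult_left_mono) auto
    also have "\<dots> = 192 * H\<^sup>2 * 2" using \<epsilon> by (simp add: power_divide)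
    also have "\<dots> \<le> 192 * H\<^sup>2 * lam i" by (intro mult_left_mono) auto
    finally show "162 * H\<^sup>2 * lam i + 24 * (\<epsilon> / 17)\<^sup>2 * 4 ^ i \<le> 354 * H\<^sup>2 * lam i" by simp
  qed simp
  also have "\<dots> = 1770 * H\<^sup>2 * lam i ^ 3" by (simp add: power2_eq_square power3_eq_cube)
  finally have main: "(\<Sum>k<?n. c_seq k * (2 * P.R.\<tau> k / (real k + 2))\<^sup>2) \<le> 1770 * H\<^sup>2 * lam i ^ 3" .
  have "(\<Sum>k<?n. P.\<alpha> i * c_seq k * (2 * P.R.\<tau> k / (real k + 2))\<^sup>2 / (\<epsilon> / 17)\<^sup>2 + 1)
      = P.\<alpha> i / (\<epsilon> / 17)\<^sup>2 * (\<Sum>k<?n. c_seq k * (2 * P.R.\<tau> k / (real k + 2))\<^sup>2) + real ?n"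
    by (simp only: sum.distrib sum_distrib_left) (simp add: mult.assoc)
  also have "\<dots> \<le> P.\<alpha> i / (\<epsilon> / 17)\<^sup>2 * (1770 * H\<^sup>2 * lam i ^ 3) + 136 * (H\<^sup>2 / \<epsilon>\<^sup>2)"
  proof (intro add_mono mult_left_mono main)
    have "real ?n \<le> 2 * 2 ^ i" using one by simp
    also have "(2 :: real) ^ i \<le> 2 ^ i0" using i by (intro power_increasing) auto
    also have "\<dots> \<le> 68 * (H / \<epsilon>)" by (rule i0_bounds)
    also have "H / \<epsilon> \<le> (H / \<epsilon>)\<^sup>2" using H_over_eps by (simp add: self_le_power)
    finally show "real ?n \<le> 136 * (H\<^sup>2 / \<epsilon>\<^sup>2)" by (simp add: power_divide)
  qed (use \<alpha>0 in auto)
  \<comment> \<open>511530 is 1770 * 17^2.\<close>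
  also have "\<dots> = H\<^sup>2 / \<epsilon>\<^sup>2 * (511530 * (P.\<alpha> i * lam i ^ 3) + 136)"
    by (simp add: power_divide algebra_simps)
  also have "\<dots> \<le> H\<^sup>2 / \<epsilon>\<^sup>2 * (600000 * (P.\<alpha> i * lam i ^ 3))"
  proof (rule mult_left_mono)
    have "(2 :: real) ^ 3 \<le> lam i ^ 3" by (intro power_mono) auto
    hence "2 / 3 * 2 ^ 3 \<le> P.\<alpha> i * lam i ^ 3" using \<alpha>_ge[of i] by (intro mult_mono) auto
    moreover have "(2 :: real) / 3 * 2 ^ 3 = 16 / 3" by simp
    ultimately show "511530 * (P.\<alpha> i * lam i ^ 3) + 136 \<le> 600000 * (P.\<alpha> i * lam i ^ 3)" by linarith
  qed (use \<epsilon>2 in auto)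
  finally have "N * (\<Sum>k<?n. P.\<alpha> i * c_seq k * (2 * P.R.\<tau> k / (real k + 2))\<^sup>2 / (\<epsilon> / 17)\<^sup>2 + 1)
      \<le> N * (H\<^sup>2 / \<epsilon>\<^sup>2 * (600000 * (P.\<alpha> i * lam i ^ 3)))"
    using N_ge by (intro mult_left_mono) auto
  thus ?thesis unfolding P.R.good_samples_def by (simp add: algebra_simps)
qed

lemma lam_le: "lam (i0 + m) \<le> 106 * L * (1 + real m)"
proof -
  have "lam (i0 + m) \<le> 104 * L + 2 * L + real m * L"
    using i0_le L_bounds(1) mult_left_mono[OF L_bounds(1), of "real m"] by simp
  also have "\<dots> \<le> 106 * L * (1 + real m)"
    using L_bounds(1) mult_nonneg_nonneg[of L "real m"] by (simp add: algebra_simps)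
  finally show ?thesis .
qed

lemma \<alpha>_le': "P.\<alpha> (i0 + m) \<le> 1177 * L * (1 + real m)"
proof -
  have "P.\<alpha> (i0 + m) \<le> 11 * (L + lam (i0 + m))" by (rule \<alpha>_le)
  also have "\<dots> \<le> 11 * (L * (1 + real m) + 106 * L * (1 + real m))"
    by (intro mult_left_mono add_mono lam_le) (use L_bounds(1) in auto)
  finally show ?thesis by (simp add: algebra_simps)
qed

abbreviation "F \<equiv> N * H\<^sup>2 / \<epsilon>\<^sup>2"

text \<open>4000000 covers 600000 from the good and 2448000 from the crude samples; 1177 and 106 are
  the factors of \<open>L\<close> in the bounds for \<open>P.\<alpha>\<close> and
  \<open>lam\<close>.\<close>

definition K :: real where "K = 4000000 * (1177 * 106 ^ 3)"

lemma F_nonneg: "0 \<le> F"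
  using N_ge \<epsilon>2 by (intro divide_nonneg_nonneg mult_nonneg_nonneg) auto

text \<open>The failure probability, at most \<open>\<epsilon>^2 / 17\<close>, cancels the
  \<open>1 / \<epsilon>^2\<close> of the crude cost and leaves \<open>4 ^ i\<close>, again of order
  \<open>(H / \<epsilon>)^2\<close>.\<close>

lemma early_loop_le:
  assumes i: "i \<le> i0"
  shows "P.R.good_samples i (Suc (2 ^ i)) + P.R.crude_samples i (Suc (2 ^ i)) * (\<epsilon>\<^sup>2 / 17 / c_seq i)
    \<le> K * F * L ^ 4"
proof -
  have \<alpha>0: "0 \<le> P.\<alpha> i" using \<alpha>_ge[of i] by simp
  have L0: "0 \<le> L" using L_bounds by simp
  have "P.R.crude_samples i (Suc (2 ^ i)) * (\<epsilon>\<^sup>2 / 17 / c_seq i)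
      \<le> (9000 * N * 4 ^ i * (P.\<alpha> i * (lam i)\<^sup>2 / \<epsilon>\<^sup>2)) * (\<epsilon>\<^sup>2 / 17)"
  proof (intro mult_mono crude_samples_le)
    show "\<epsilon>\<^sup>2 / 17 / c_seq i \<le> \<epsilon>\<^sup>2 / 17"
      using c_seq_ge[of i] \<epsilon>2 by (simp add: divide_le_eq)
  qed (use N_ge \<alpha>0 c_seq_ge[of i] in auto)
  also have "\<dots> = 9000 / 17 * N * (P.\<alpha> i * (lam i)\<^sup>2) * 4 ^ i" using \<epsilon>2 by (simp add: field_simps)
  also have "\<dots> \<le> 9000 / 17 * N * (P.\<alpha> i * (lam i)\<^sup>2) * (4624 * (H / \<epsilon>)\<^sup>2)"
    using N_ge \<alpha>0 by (intro mult_left_mono four_pow_le i) auto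
  also have "\<dots> = 2448000 * F * (P.\<alpha> i * (lam i)\<^sup>2)" by (simp add: power_divide)
  also have "\<dots> \<le> 2448000 * F * (P.\<alpha> i * lam i ^ 3)"
    using \<alpha>0 F_nonneg by (intro mult_left_mono power_increasing) auto
  finally have crude: "P.R.crude_samples i (Suc (2 ^ i)) * (\<epsilon>\<^sup>2 / 17 / c_seq i)
      \<le> 2448000 * F * (P.\<alpha> i * lam i ^ 3)" .
  have "lam i \<le> lam (i0 + 0)" using i by simp
  hence lam: "lam i \<le> 106 * L" using lam_le[of 0] by simp
  have "P.\<alpha> i \<le> 11 * (L + lam i)" by (rule \<alpha>_le)
  hence "P.\<alpha> i \<le> 1177 * L" using lam by simp
  hence "P.\<alpha> i * lam i ^ 3 \<le> (1177 * L) * (106 * L) ^ 3"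
    using lam \<alpha>0 L0 by (intro mult_mono power_mono) auto
  also have "\<dots> = 1177 * 106 ^ 3 * L ^ 4" by (simp add: power_mult_distrib eval_nat_numeral)
  finally have "4000000 * F * (P.\<alpha> i * lam i ^ 3) \<le> 4000000 * F * (1177 * 106 ^ 3 * L ^ 4)"
    using F_nonneg by (intro mult_left_mono) auto
  moreover have "600000 * F * (P.\<alpha> i * lam i ^ 3) + 2448000 * F * (P.\<alpha> i * lam i ^ 3)
      \<le> 4000000 * F * (P.\<alpha> i * lam i ^ 3)"
    unfolding distrib_right[symmetric] using F_nonneg \<alpha>0 by (intro mult_right_mono) auto
  ultimately show ?thesis using crude good_samples_le[OF i] by (simp add: K_def mult_ac)
qed

text \<open>Reaching this loop takes \<open>m + 1\<close> failures. One of them pays for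
  \<open>1 / \<epsilon>^2\<close>, the other \<open>m\<close> outweigh the growth
  \<open>4 ^ m\<close>.\<close>

lemma late_loop_le:
  "P.R.crude_samples (Suc (i0 + m)) (Suc (2 ^ Suc (i0 + m))) *
    (\<Prod>j\<in>{i0..<Suc (i0 + m)}. \<epsilon>\<^sup>2 / 17 / c_seq j) \<le> 512 * K * F * L ^ 4 * (1 / 2) ^ m"
proof -
  define i where "i = Suc (i0 + m)"
  have i: "i = i0 + Suc m" by (simp add: i_def)
  have \<alpha>0: "0 \<le> P.\<alpha> i" using \<alpha>_ge[of i] by simp
  have L0: "0 \<le> L" "1 \<le> L" using L_bounds by auto
  have q: "0 \<le> \<epsilon>\<^sup>2 / 17 / c_seq j" "\<epsilon>\<^sup>2 / 17 / c_seq j \<le> \<epsilon>\<^sup>2 / 17" "\<epsilon>\<^sup>2 / 17 / c_seq j \<le> 1 / 17" for j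
  proof -
    show "0 \<le> \<epsilon>\<^sup>2 / 17 / c_seq j" using c_seq_ge[of j] by simp
    show le: "\<epsilon>\<^sup>2 / 17 / c_seq j \<le> \<epsilon>\<^sup>2 / 17" using c_seq_ge[of j] \<epsilon>2 by (simp add: divide_le_eq)
    show "\<epsilon>\<^sup>2 / 17 / c_seq j \<le> 1 / 17" using le \<epsilon>2 by simp
  qed
  \<comment> \<open>Only the factor at \<open>i0\<close> keeps its \<open>\<epsilon>^2\<close>; the
    others are bounded by 1/17.\<close>
  have "(\<Prod>j\<in>{i0..<i}. \<epsilon>\<^sup>2 / 17 / c_seq j) = (\<epsilon>\<^sup>2 / 17 / c_seq i0) * (\<Prod>j\<in>{Suc i0..<i}. \<epsilon>\<^sup>2 / 17 / c_seq j)"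
    unfolding i by (rule prod.atLeast_Suc_lessThan) simp
  also have "\<dots> \<le> (\<epsilon>\<^sup>2 / 17) * (\<Prod>j\<in>{Suc i0..<i}. 1 / 17)"
    by (intro mult_mono prod_mono conjI q prod_nonneg) (use q in auto)
  also have "\<dots> = \<epsilon>\<^sup>2 / 17 * (1 / 17) ^ m" by (simp add: i)
  finally have prod: "(\<Prod>j\<in>{i0..<i}. \<epsilon>\<^sup>2 / 17 / c_seq j) \<le> \<epsilon>\<^sup>2 / 17 * (1 / 17) ^ m" .
  have "P.R.crude_samples i (Suc (2 ^ i)) * (\<Prod>j\<in>{i0..<i}. \<epsilon>\<^sup>2 / 17 / c_seq j)
      \<le> (9000 * N * 4 ^ i * (P.\<alpha> i * (lam i)\<^sup>2 / \<epsilon>\<^sup>2)) * (\<epsilon>\<^sup>2 / 17 * (1 / 17) ^ m)"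
    using N_ge \<alpha>0 by (intro mult_mono crude_samples_le prod prod_nonneg q) auto
  also have "\<dots> = 9000 / 17 * N * (P.\<alpha> i * (lam i)\<^sup>2) * 4 * (4 ^ i0 * (4 / 17) ^ m)"
    using \<epsilon>2 by (simp add: i power_add power_divide field_simps)
  also have "\<dots> \<le> 9000 / 17 * N * (P.\<alpha> i * (lam i)\<^sup>2) * 4 * (4624 * (H / \<epsilon>)\<^sup>2 * (4 / 17) ^ m)"
    using N_ge \<alpha>0 by (intro mult_left_mono mult_right_mono four_pow_le) auto
  also have "\<dots> = 9792000 * F * ((4 / 17) ^ m * (P.\<alpha> i * (lam i)\<^sup>2))" by (simp add: power_divide)
  also have "\<dots> \<le> 9792000 * F * (512 * 1177 * 106 ^ 3 * L ^ 4 * (1 / 2) ^ m / 4)"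
  proof (rule mult_left_mono)
    have m2: "1 + real (Suc m) \<le> 2 * (1 + real m)" by simp
    have lam: "lam i \<le> 106 * L * (2 * (1 + real m))"
      unfolding i using L0 by (intro order_trans[OF lam_le] mult_left_mono m2) auto
    have "P.\<alpha> i \<le> 1177 * L * (2 * (1 + real m))"
      unfolding i using L0 by (intro order_trans[OF \<alpha>_le'] mult_left_mono m2) auto
    hence "P.\<alpha> i * (lam i)\<^sup>2 \<le> (1177 * L * (2 * (1 + real m))) * (106 * L * (2 * (1 + real m)))\<^sup>2"
      using lam \<alpha>0 L0 by (intro mult_mono power_mono) auto
    also have "\<dots> = 8 * 1177 * 106\<^sup>2 * L ^ 3 * (1 + real m) ^ 3"
    proof -
      have "(1177 * L * (2 * x)) * (106 * L * (2 * x))\<^sup>2 = 8 * 1177 * 106\<^sup>2 * L ^ 3 * x ^ 3" for x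
        by (simp add: power2_eq_square power3_eq_cube)
      thus ?thesis .
    qed
    finally have "(4 / 17) ^ m * (P.\<alpha> i * (lam i)\<^sup>2)
        \<le> (4 / 17) ^ m * (8 * 1177 * 106\<^sup>2 * L ^ 3 * (1 + real m) ^ 3)"
      by (intro mult_left_mono) auto
    also have "\<dots> = 8 * 1177 * 106\<^sup>2 * L ^ 3 * ((1 + real m) ^ 3 * (4 / 17) ^ m)"
      by (simp add: mult_ac)
    also have "\<dots> \<le> 8 * 1177 * 106\<^sup>2 * L ^ 3 * (64 * (1 / 2) ^ m)"
      using L0 by (intro mult_left_mono cube_le_exponential) auto
    also have "\<dots> \<le> 8 * 1177 * 106\<^sup>2 * L ^ 4 * (64 * (1 / 2) ^ m)"
      using L0 by (intro mult_left_mono mult_right_mono power_increasing) auto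
    also have "\<dots> \<le> 512 * 1177 * 106 ^ 3 * L ^ 4 * (1 / 2) ^ m / 4"
      using L0 by simp
    finally show "(4 / 17) ^ m * (P.\<alpha> i * (lam i)\<^sup>2) \<le> 512 * 1177 * 106 ^ 3 * L ^ 4 * (1 / 2) ^ m / 4" .
  qed (use F_nonneg in simp)
  also have "\<dots> = 9792000 / 4 * (512 * 1177 * 106 ^ 3) * (F * L ^ 4 * (1 / 2) ^ m)" by simp
  also have "\<dots> \<le> 512 * K * (F * L ^ 4 * (1 / 2) ^ m)"
    unfolding K_def by (rule mult_right_mono) (use F_nonneg L0 in auto)
  finally show ?thesis by (simp add: i_def mult.assoc)
qed

text \<open>The fifth power of \<open>L\<close> comes from the \<open>i0 + 1\<close> early loops,
  each of cost at most \<open>K * F * L ^ 4\<close>, since \<open>i0\<close> itself is of order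
  \<open>L\<close>. The late loops add a geometric series.\<close>

lemma expected_samples_le:
  "(\<integral>\<^sup>+\<omega>. savia_plus_samples M (\<epsilon> / 17) \<omega> \<partial>P.\<Omega>) \<le> ennreal (2000 * K * F * L ^ 5)"
proof -
  let ?b = "\<lambda>i. if i \<le> i0 then P.R.good_samples i (Suc (2 ^ i)) +
        P.R.crude_samples i (Suc (2 ^ i)) * (\<epsilon>\<^sup>2 / 17 / c_seq i)
      else P.R.crude_samples i (Suc (2 ^ i)) * (\<Prod>j\<in>{i0..<i}. \<epsilon>\<^sup>2 / 17 / c_seq j)"
  define V where "V = K * F * L ^ 4"
  have V: "0 \<le> V" using F_nonneg L_bounds by (simp add: V_def K_def)
  have early: "?b i \<le> V" if "i \<le> i0" for i using early_loop_le[OF that] that by (simp add: V_def)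
  have late: "?b (Suc i0 + m) \<le> 512 * V * (1 / 2) ^ m" for m
    using late_loop_le[of m] by (simp add: V_def mult.assoc)
  have "(\<Sum>i. ennreal (?b i)) \<le> ennreal (2000 * K * F * L ^ 5)"
  proof (rule suminf_ennreal_le)
    fix n
    have "(\<Sum>i<n. ennreal (?b i)) \<le> (\<Sum>i<Suc i0 + n. ennreal (?b i))"
      by (rule sum_mono2) auto
    also have "\<dots> = (\<Sum>i<Suc i0. ennreal (?b i)) + (\<Sum>m<n. ennreal (?b (Suc i0 + m)))"
      by (induction n) (simp_all add: add.assoc)
    also have "\<dots> \<le> (\<Sum>i<Suc i0. ennreal V) + (\<Sum>m<n. ennreal (512 * V * (1 / 2) ^ m))"
      by (intro add_mono sum_mono ennreal_leI early late) auto
    also have "\<dots> = ennreal (real (Suc i0) * V + 512 * V * (\<Sum>m<n. (1 / 2) ^ m))"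
    proof -
      have "(\<Sum>i<Suc i0. ennreal V) = ennreal (\<Sum>i<Suc i0. V)"
        using V by (intro sum_ennreal) auto
      moreover have "(\<Sum>m<n. ennreal (512 * V * (1 / 2) ^ m)) = ennreal (\<Sum>m<n. 512 * V * (1 / 2) ^ m)"
        using V by (intro sum_ennreal) auto
      ultimately show ?thesis using V
        by (simp add: sum_distrib_left ennreal_plus[symmetric] sum_nonneg del: ennreal_plus)
    qed
    also have "\<dots> \<le> ennreal (2000 * K * F * L ^ 5)"
    proof (rule ennreal_leI)
      have "(\<Sum>m<n. (1 / 2 :: real) ^ m) \<le> 2" by (simp add: geometric_sum)
      hence "512 * V * (\<Sum>m<n. (1 / 2) ^ m) \<le> 512 * V * 2" using V by (intro mult_left_mono) auto
      moreover have "real (Suc i0) * V \<le> 105 * L * V"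
        using i0_le L_bounds(1) V by (intro mult_right_mono) auto
      moreover have "512 * V * 2 \<le> 1024 * L * V"
        using mult_right_mono[OF L_bounds(1) V] by simp
      moreover have "105 * L * V + 1024 * L * V \<le> 2000 * (L * V)"
        using V L_bounds(1) mult_nonneg_nonneg[of L V] by simp
      ultimately have "real (Suc i0) * V + 512 * V * (\<Sum>m<n. (1 / 2) ^ m) \<le> 2000 * (L * V)" by linarith
      thus "real (Suc i0) * V + 512 * V * (\<Sum>m<n. (1 / 2) ^ m) \<le> 2000 * K * F * L ^ 5"
        by (simp add: V_def eval_nat_numeral mult_ac)
    qed
    finally show "(\<Sum>i<n. ennreal (?b i)) \<le> ennreal (2000 * K * F * L ^ 5)" .
  qed
  thus ?thesis using P.samples_expectation_le[OF i0_suffices] by (rule order_trans[rotated])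
qed

lemma stops: "AE \<omega> in P.\<Omega>. \<exists>i. stop_test M (\<epsilon> / 17) (\<omega> i)"
proof (rule P.AE_stops[OF i0_suffices, of "1 / 4"])
  show "\<epsilon>\<^sup>2 / 17 / c_seq j \<le> 1 / 4" for j
    using frac_le[of 1 "\<epsilon>\<^sup>2 / 17" 4 "c_seq j"] c_seq_ge[of j] \<epsilon>2 by simp
qed simp

text \<open>The bound \<open>16 * \<epsilon> / 17 + \<epsilon>^2 / 17\<close> is at most \<epsilon>
  because \<open>\<epsilon> \<le> 1\<close>.\<close>

lemma expected_gap_le:
  assumes "s \<in> S"
  shows "(\<integral>\<omega>. P.gap s \<omega> \<partial>P.\<Omega>) \<le> \<epsilon>"
proof -
  have "\<epsilon>\<^sup>2 \<le> \<epsilon>" using \<epsilon> by (simp add: power2_eq_square mult_left_le)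
  thus ?thesis using P.gap_expectation_le[OF assms stops] by simp
qed

end

text \<open>Almost sure stopping gives meaning to the \<open>LEAST\<close> in the output.
  Integrability is claimed with the gap bound because the Bochner integral of a function that is not
  integrable is 0.\<close>

theorem corollary3p7:
  shows "\<exists>C p :: real. C > 0 \<and> p > 0 \<and>
    (\<forall>(M :: ('s, 'a) mdp) (sel :: ('s, 'a) selection) (Qstar :: ('s, 'a) qfun) (\<epsilon> :: real).
       finite_mdp M \<longrightarrow>
       weakly_communicating M \<longrightarrow>
       (\<forall>s\<in>states M. \<forall>a\<in>actions M. 0 \<le> reward M (s, a) \<and> reward M (s, a) \<le> 1) \<longrightarrow>
       bellman_solution M Qstar \<longrightarrow>
       1 \<le> sp (states M) (max_act M Qstar) \<longrightarrow>
       0 < \<epsilon> \<longrightarrow> \<epsilon> \<le> 1 \<longrightarrow>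
       argmax_selection M sel \<longrightarrow>
       (let \<delta> = \<epsilon>\<^sup>2 / 17;
            c = (\<lambda>k. 5 * (real k + 2) * (ln (real k + 2))\<^sup>2);
            \<beta> = (\<lambda>k. real k / (real k + 2));
            R = savia_plus_space M c \<beta> sel (\<lambda>_. 0) (\<epsilon> / 17) \<delta>;
            gap = (\<lambda>s \<omega>. opt_gain M s - gain M (out_policy (savia_plus_output M (\<epsilon> / 17) \<omega>)) s);
            H = sp (states M) (max_act M Qstar);
            SA = real (card (states M)) * real (card (actions M))
        in (AE \<omega> in R. \<exists>i. stop_test M (\<epsilon> / 17) (\<omega> i)) \<and>
           (\<forall>s\<in>states M. integrable R (gap s) \<and> (\<integral>\<omega>. gap s \<omega> \<partial>R) \<le> \<epsilon>) \<and>
           (\<integral>\<^sup>+\<omega>. savia_plus_samples M (\<epsilon> / 17) \<omega> \<partial>R)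
             \<le> ennreal (C * (SA * H\<^sup>2 / \<epsilon>\<^sup>2) * (ln (exp 1 * SA * H / (\<epsilon> * \<delta>))) powr p)))"
\<comment> \<open>The first witness is \<open>2000 * K\<close> written out, since it has to be given
  before the MDP is fixed.\<close>
proof (rule exI[of _ "2000 * (4000000 * (1177 * 106 ^ 3))"], rule exI[of _ 5], intro conjI allI impI)
  fix M :: "('s, 'a) mdp" and sel :: "('s, 'a) selection" and Qstar :: "('s, 'a) qfun" and \<epsilon> :: real
  assume asms: "finite_mdp M" "weakly_communicating M"
    "\<forall>s\<in>states M. \<forall>a\<in>actions M. 0 \<le> reward M (s, a) \<and> reward M (s, a) \<le> 1"
    "bellman_solution M Qstar" "1 \<le> sp (states M) (max_act M Qstar)" "0 < \<epsilon>" "\<epsilon> \<le> 1"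
    "argmax_selection M sel"
  interpret corollary_setting M sel Qstar \<epsilon>
    by unfold_locales (use asms in auto)
  have c: "(\<lambda>k. 5 * (real k + 2) * (ln (real k + 2))\<^sup>2) = c_seq"
    by (simp add: c_seq_def fun_eq_iff)
  have L: "L powr 5 = L ^ 5" using L_bounds(1) powr_realpow[of L 5] by simp
  have gap: "(\<lambda>\<omega>. opt_gain M s - gain M (out_policy (savia_plus_output M (\<epsilon> / 17) \<omega>)) s) = P.gap s" for s
    by (simp add: P.gap_def fun_eq_iff)
  have "(\<integral>\<omega>. opt_gain M s - gain M (out_policy (savia_plus_output M (\<epsilon> / 17) \<omega>)) s \<partial>P.\<Omega>) \<le> \<epsilon>"
    "integrable P.\<Omega> (\<lambda>\<omega>. opt_gain M s - gain M (out_policy (savia_plus_output M (\<epsilon> / 17) \<omega>)) s)"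
    if "s \<in> states M" for s
    unfolding gap using expected_gap_le[OF that] P.gap_integrable[OF that] by auto
  moreover have "(\<integral>\<^sup>+\<omega>. savia_plus_samples M (\<epsilon> / 17) \<omega> \<partial>P.\<Omega>)
      \<le> ennreal (2000 * (4000000 * (1177 * 106 ^ 3)) * F *
          (ln (exp 1 * N * H / (\<epsilon> * (\<epsilon>\<^sup>2 / 17)))) powr 5)"
    using expected_samples_le unfolding L_def[symmetric] L K_def .
  ultimately show "let \<delta> = \<epsilon>\<^sup>2 / 17;
            c = (\<lambda>k. 5 * (real k + 2) * (ln (real k + 2))\<^sup>2);
            \<beta> = (\<lambda>k. real k / (real k + 2));
            R = savia_plus_space M c \<beta> sel (\<lambda>_. 0) (\<epsilon> / 17) \<delta>;
            gap = (\<lambda>s \<omega>. opt_gain M s - gain M (out_policy (savia_plus_output M (\<epsilon> / 17) \<omega>)) s);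
            H = sp (states M) (max_act M Qstar);
            SA = real (card (states M)) * real (card (actions M))
        in (AE \<omega> in R. \<exists>i. stop_test M (\<epsilon> / 17) (\<omega> i)) \<and>
           (\<forall>s\<in>states M. integrable R (gap s) \<and> (\<integral>\<omega>. gap s \<omega> \<partial>R) \<le> \<epsilon>) \<and>
           (\<integral>\<^sup>+\<omega>. savia_plus_samples M (\<epsilon> / 17) \<omega> \<partial>R)
             \<le> ennreal (2000 * (4000000 * (1177 * 106 ^ 3)) * (SA * H\<^sup>2 / \<epsilon>\<^sup>2) *
                 (ln (exp 1 * SA * H / (\<epsilon> * \<delta>))) powr 5)"
    unfolding Let_def c using stops by blast
qed auto

end
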